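(* Let $1\le\gamma<3$, $v_\infty=0$, $0<u_\infty<q_{cav}$, and let $\Omega$ be a domain of type (a) or (b) described in the context. For a sequence $\varepsilon\to0^+$ let $w^\varepsilon=(u^\varepsilon,v^\varepsilon)=(q^\varepsilon\cos\theta^\varepsilon,q^\varepsilon\sin\theta^\varepsilon)$ be solutions of the viscous problem $(VP_\varepsilon)$ on $\Omega$ with $q^\varepsilon\le q^*<q_{cav}$ ($q^*$ independent of $\varepsilon$) and $|\theta^\varepsilon|$ bounded uniformly in $\varepsilon$. Suppose that there is a positive, $\varepsilon$-independent $\alpha=\alpha(\delta)\to0$ as $\delta\to0$ such that $q^\varepsilon(x,y)\ge\alpha(\delta)$ for any $(x,y)\in\Omega_\delta=\{(x,y)\in\Omega:\operatorname{dist}((x,y),\partial\Omega_1)\ge\delta\}$, $\delta>0$. Then $$\partial_xQ_1(w^\varepsilon)+\partial_yQ_2(w^\varepsilon)\quad\text{is confined in a compact set in }H^{-1}_{loc}(\Omega)$$ for any entropy pair $(Q_1,Q_2)$ generated by $H\in C^3$.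
   Context: Gas law. For $\gamma>1$: $\rho(q)=(1-\frac{\gamma-1}{2}q^2)^{1/(\gamma-1)}$, $c^2(q)=1-\frac{\gamma-1}{2}q^2$, $q_{cav}=\sqrt{2/(\gamma-1)}$, $q_{cr}=\sqrt{2/(\gamma+1)}$. For $\gamma=1$: $\rho(q)=e^{-q^2/2}$, $c=1$, $q_{cr}=1$, $q_{cav}=\infty$. Here $q=\sqrt{u^2+v^2}$ and $(u,v)=(q\cos\theta,q\sin\theta)$; $M=q/c$. Functions of $q$ are also regarded as functions of $\rho$. Domains. $\Omega\subset\mathbb R^2$ is a bounded domain with $\partial\Omega=\partial\Omega_1\cup\partial\Omega_2$ ($\partial\Omega_1$ the obstacle boundary, $\partial\Omega_2$ the far-field boundary), of one of two types: (a) $\partial\Omega_1$ is a smooth arc forming the lower boundary, and $\partial\Omega_2$ consists of two vertical segments and one horizontal segment; (b) $\Omega$ is an axis-parallel rectangle with an obstacle removed, $\partial\Omega_1$ is the smooth simple closed boundary curve of the obstacle, and $\partial\Omega_2$ is the boundary of the rectangle. $\mathbf n$ is the unit normal on $\partial\Omega$ pointing into $\Omega$. Viscous problem $(VP_\varepsilon)$: $v_x-u_y=\varepsilon\nabla\cdot(\sigma_1(\rho)\nabla\theta)$ and $(\rho u)_x+(\rho v)_y=\varepsilon\nabla\cdot(\sigma_2(\rho)\nabla\rho)$ in $\Omega$, with $\nabla\theta\cdot\mathbf n=0$ and $\varepsilon\sigma_2\nabla\rho\cdot\mathbf n=-|\rho(u,v)\cdot\mathbf n|$ on $\partial\Omega_1$,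 and $(u,v)=(u_\infty,v_\infty)$, $\theta=0$ on $\partial\Omega_2$. Here $\sigma_1=1$, $\sigma_2=(q^2-c^2)/q^2$ for $q\ge\sqrt2\,q_{cr}$, and for $q\le\sqrt2\,q_{cr}$ they are any fixed smooth bounded positive continuations. A solution means a classical solution given by real-valued functions $\rho^\varepsilon,\theta^\varepsilon\in C^2(\Omega\cup\partial\Omega_1)\cap C(\overline\Omega)$. Entropy pairs. Let $\mu=\mu(\rho)$ satisfy $\mu'(\rho)=c^2/q^2$. The entropy pair generated by $H=H(\mu,\theta)$, a $C^3$ solution of $H_{\mu\mu}+\frac1{\rho^2}(1-M^2)H_{\theta\theta}=0$ (for $0<q<q_{cav}$, $\theta\in\mathbb R$), is $Q_1=\rho qH_\mu\cos\theta-qH_\theta\sin\theta$, $Q_2=\rho qH_\mu\sin\theta+qH_\theta\cos\theta$; $Q_i(w^\varepsilon)$ denotes its value at $(\rho^\varepsilon,\theta^\varepsilon)$. *)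

theory Defs
  imports "HOL-Analysis.Analysis"
begin

section \<open>Differential calculus in the plane\<close>

type_synonym point = "real \<times> real"

definition D1 :: "(point \<Rightarrow> real) \<Rightarrow> point \<Rightarrow> real" where
  "D1 f z = deriv (\<lambda>s. f (s, snd z)) (fst z)"

definition D2 :: "(point \<Rightarrow> real) \<Rightarrow> point \<Rightarrow> real" where
  "D2 f z = deriv (\<lambda>s. f (fst z, s)) (snd z)"

definition grad :: "(point \<Rightarrow> real) \<Rightarrow> point \<Rightarrow> point" where
  "grad f z = (D1 f z, D2 f z)"

definition divergence :: "(point \<Rightarrow> point) \<Rightarrow> point \<Rightarrow> real" where
  "divergence F z = D1 (\<lambda>p. fst (F p)) z + D2 (\<lambda>p. snd (F p)) z"

text \<open>The class \<open>C\<^sup>k(\<Omega> \<union> S)\<close> for \<open>\<Omega>\<close> open and \<open>S\<close> a part of its boundary: all partial derivatives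
  of order at most \<open>k\<close> exist in \<open>\<Omega>\<close> and extend continuously to \<open>\<Omega> \<union> S\<close>.  The values of \<open>f\<close> itself
  on \<open>S\<close> are not constrained.\<close>
primrec C_upto :: "nat \<Rightarrow> point set \<Rightarrow> point set \<Rightarrow> (point \<Rightarrow> real) \<Rightarrow> bool" where
  "C_upto 0 \<Omega> S f \<longleftrightarrow> (\<exists>g. continuous_on (\<Omega> \<union> S) g \<and> (\<forall>z\<in>\<Omega>. g z = f z))"
| "C_upto (Suc k) \<Omega> S f \<longleftrightarrow>
     (\<exists>g. continuous_on (\<Omega> \<union> S) g \<and> (\<forall>z\<in>\<Omega>. g z = f z)) \<and>
     f differentiable_on \<Omega> \<and> C_upto k \<Omega> S (D1 f) \<and> C_upto k \<Omega> S (D2 f)"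

abbreviation C_on :: "nat \<Rightarrow> point set \<Rightarrow> (point \<Rightarrow> real) \<Rightarrow> bool" where
  "C_on k \<Omega> \<equiv> C_upto k \<Omega> {}"

text \<open>The value of the gradient at a boundary point of \<open>\<Omega>\<close>, as the limit from inside.\<close>
definition bdry_grad :: "point set \<Rightarrow> (point \<Rightarrow> real) \<Rightarrow> point \<Rightarrow> point" where
  "bdry_grad \<Omega> f z = Lim (at z within \<Omega>) (grad f)"

text \<open>To be used for open \<open>U\<close> only.\<close>
definition smooth_real :: "real set \<Rightarrow> (real \<Rightarrow> real) \<Rightarrow> bool" where
  "smooth_real U f \<longleftrightarrow> (\<forall>k. \<forall>x\<in>U. ((deriv ^^ k) f) field_differentiable (at x))"


section \<open>Gas law\<close>

definition gas_rho :: "real \<Rightarrow> real \<Rightarrow> real" where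
  "gas_rho \<gamma> q = (if \<gamma> = 1 then exp (- q\<^sup>2 / 2)
                  else (1 - (\<gamma> - 1) / 2 * q\<^sup>2) powr (1 / (\<gamma> - 1)))"

definition gas_c :: "real \<Rightarrow> real \<Rightarrow> real" where
  "gas_c \<gamma> q = sqrt (1 - (\<gamma> - 1) / 2 * q\<^sup>2)"

definition q_cav :: "real \<Rightarrow> ereal" where
  "q_cav \<gamma> = (if \<gamma> = 1 then \<infinity> else ereal (sqrt (2 / (\<gamma> - 1))))"

definition q_cr :: "real \<Rightarrow> real" where
  "q_cr \<gamma> = sqrt (2 / (\<gamma> + 1))"

definition mach :: "real \<Rightarrow> real \<Rightarrow> real" where
  "mach \<gamma> q = q / gas_c \<gamma> q"

text \<open>The speed as a function of the density: the inverse of the decreasing bijection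
  \<open>gas_rho \<gamma>\<close> from \<open>[0, q_cav)\<close> onto \<open>(0, 1]\<close>.\<close>
definition gas_q :: "real \<Rightarrow> real \<Rightarrow> real" where
  "gas_q \<gamma> r = (THE q. 0 \<le> q \<and> ereal q < q_cav \<gamma> \<and> gas_rho \<gamma> q = r)"

definition vel_u :: "real \<Rightarrow> (point \<Rightarrow> real) \<Rightarrow> (point \<Rightarrow> real) \<Rightarrow> point \<Rightarrow> real" where
  "vel_u \<gamma> \<rho> \<theta> z = gas_q \<gamma> (\<rho> z) * cos (\<theta> z)"

definition vel_v :: "real \<Rightarrow> (point \<Rightarrow> real) \<Rightarrow> (point \<Rightarrow> real) \<Rightarrow> point \<Rightarrow> real" where
  "vel_v \<gamma> \<rho> \<theta> z = gas_q \<gamma> (\<rho> z) * sin (\<theta> z)"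


section \<open>Flow domains\<close>

definition smooth_curve :: "(real \<Rightarrow> point) \<Rightarrow> bool" where
  "smooth_curve g \<longleftrightarrow> smooth_real UNIV (\<lambda>t. fst (g t)) \<and> smooth_real UNIV (\<lambda>t. snd (g t)) \<and>
     (\<forall>t\<in>{0..1}. vector_derivative g (at t) \<noteq> 0)"

text \<open>\<open>\<Gamma>1\<close> is the obstacle boundary and \<open>\<Gamma>2\<close> the far-field boundary.  The two corner points at the
  ends of the obstacle arc, where its normal need not point into the domain, are counted with
  \<open>\<Gamma>2\<close>.\<close>
definition boundary_type_a :: "point set \<Rightarrow> point set \<Rightarrow> bool" where
  "boundary_type_a \<Gamma>1 \<Gamma>2 \<longleftrightarrow>
     (\<exists>a b d y0 y1 g. a < b \<and> y0 < d \<and> y1 < d \<and>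
        smooth_curve g \<and> arc g \<and> pathstart g = (a, y0) \<and> pathfinish g = (b, y1) \<and>
        (\<forall>t\<in>{0<..<1}. a < fst (g t) \<and> fst (g t) < b \<and> snd (g t) < d) \<and>
        \<Gamma>1 = g ` {0<..<1} \<and>
        \<Gamma>2 = {a} \<times> {y0..d} \<union> {b} \<times> {y1..d} \<union> {a..b} \<times> {d})"

definition domain_type_a :: "point set \<Rightarrow> point set \<Rightarrow> point set \<Rightarrow> bool" where
  "domain_type_a \<Omega> \<Gamma>1 \<Gamma>2 \<longleftrightarrow>
     open \<Omega> \<and> connected \<Omega> \<and> bounded \<Omega> \<and> frontier \<Omega> = \<Gamma>1 \<union> \<Gamma>2 \<and> boundary_type_a \<Gamma>1 \<Gamma>2"

definition domain_type_b :: "point set \<Rightarrow> point set \<Rightarrow> point set \<Rightarrow> bool" where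
  "domain_type_b \<Omega> \<Gamma>1 \<Gamma>2 \<longleftrightarrow>
     open \<Omega> \<and> connected \<Omega> \<and> bounded \<Omega> \<and> frontier \<Omega> = \<Gamma>1 \<union> \<Gamma>2 \<and>
     (\<exists>a b c d g. a < b \<and> c < d \<and>
        smooth_curve g \<and> (\<forall>t. g (t + 1) = g t) \<and> simple_path g \<and>
        path_image g \<subseteq> {a<..<b} \<times> {c<..<d} \<and>
        \<Gamma>1 = path_image g \<and>
        \<Gamma>2 = frontier ({a<..<b} \<times> {c<..<d}) \<and>
        \<Omega> = {a<..<b} \<times> {c<..<d} - (path_image g \<union> inside (path_image g)))"

text \<open>Unit normal pointing into \<open>\<Omega>\<close> at a smooth boundary point: \<open>n\<close> is orthogonal to all limits of
  secant directions of the boundary at \<open>z\<close>, that is, to the tangent line.\<close>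
definition inward_normal :: "point set \<Rightarrow> point \<Rightarrow> point \<Rightarrow> bool" where
  "inward_normal \<Omega> z n \<longleftrightarrow> norm n = 1 \<and>
     ((\<lambda>w. ((w - z) \<bullet> n) / norm (w - z)) \<longlongrightarrow> 0) (at z within frontier \<Omega>) \<and>
     (\<exists>s0>0. \<forall>s\<in>{0<..<s0}. z + s *\<^sub>R n \<in> \<Omega>)"


section \<open>The viscous problem\<close>

text \<open>The coefficients are given as functions of the speed \<open>q \<in> [0, q_cav)\<close>; their values
  for negative \<open>q\<close> are never used and only serve to express smoothness up to \<open>q = 0\<close>.\<close>
definition viscosity_coeffs :: "real \<Rightarrow> (real \<Rightarrow> real) \<Rightarrow> (real \<Rightarrow> real) \<Rightarrow> bool" where
  "viscosity_coeffs \<gamma> \<sigma>1 \<sigma>2 \<longleftrightarrow>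
     (\<forall>\<sigma>\<in>{\<sigma>1, \<sigma>2}. smooth_real {q. ereal q < q_cav \<gamma>} \<sigma> \<and>
        (\<exists>C. \<forall>q\<ge>0. ereal q < q_cav \<gamma> \<longrightarrow> 0 < \<sigma> q \<and> \<sigma> q \<le> C)) \<and>
     (\<forall>q\<ge>sqrt 2 * q_cr \<gamma>. ereal q < q_cav \<gamma> \<longrightarrow>
        \<sigma>1 q = 1 \<and> \<sigma>2 q = (q\<^sup>2 - (gas_c \<gamma> q)\<^sup>2) / q\<^sup>2)"

text \<open>Classical solutions, in the unknowns \<open>\<rho>\<close> and \<open>\<theta>\<close>.  The differentiability requirements on the
  velocity and on the viscous fluxes only matter at stagnation points, where \<open>gas_q\<close> is not
  differentiable; elsewhere they follow from the regularity of \<open>\<rho>\<close> and \<open>\<theta>\<close>.\<close>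
definition VP_solution ::
  "real \<Rightarrow> (real \<Rightarrow> real) \<Rightarrow> (real \<Rightarrow> real) \<Rightarrow> real \<Rightarrow> real \<Rightarrow> point set \<Rightarrow> point set \<Rightarrow> point set \<Rightarrow> real
    \<Rightarrow> (point \<Rightarrow> real) \<Rightarrow> (point \<Rightarrow> real) \<Rightarrow> bool" where
  "VP_solution \<gamma> \<sigma>1 \<sigma>2 u_inf v_inf \<Omega> \<Gamma>1 \<Gamma>2 \<epsilon> \<rho> \<theta> \<longleftrightarrow>
     (let q = (\<lambda>z. gas_q \<gamma> (\<rho> z)); u = vel_u \<gamma> \<rho> \<theta>; v = vel_v \<gamma> \<rho> \<theta>;
          F1 = (\<lambda>z. \<sigma>1 (q z) *\<^sub>R grad \<theta> z); F2 = (\<lambda>z. \<sigma>2 (q z) *\<^sub>R grad \<rho> z)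
      in
      C_upto 2 \<Omega> \<Gamma>1 \<rho> \<and> C_upto 2 \<Omega> \<Gamma>1 \<theta> \<and>
      continuous_on (closure \<Omega>) \<rho> \<and> continuous_on (closure \<Omega>) \<theta> \<and>
      (\<forall>z\<in>closure \<Omega>. 0 < \<rho> z \<and> \<rho> z \<le> 1) \<and>
      u differentiable_on \<Omega> \<and> v differentiable_on \<Omega> \<and>
      F1 differentiable_on \<Omega> \<and> F2 differentiable_on \<Omega> \<and>
      (\<forall>z\<in>\<Omega>. D1 v z - D2 u z = \<epsilon> * divergence F1 z) \<and>
      (\<forall>z\<in>\<Omega>. D1 (\<lambda>p. \<rho> p * u p) z + D2 (\<lambda>p. \<rho> p * v p) z = \<epsilon> * divergence F2 z) \<and>
      (\<forall>z\<in>\<Gamma>1. \<forall>n. inward_normal \<Omega> z n \<longrightarrow>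
         bdry_grad \<Omega> \<theta> z \<bullet> n = 0 \<and>
         \<epsilon> * \<sigma>2 (q z) * (bdry_grad \<Omega> \<rho> z \<bullet> n) = - \<bar>(\<rho> z *\<^sub>R (u z, v z)) \<bullet> n\<bar>) \<and>
      (\<forall>z\<in>\<Gamma>2. u z = u_inf \<and> v z = v_inf \<and> \<theta> z = 0))"


section \<open>Entropy pairs\<close>

definition mu_function :: "real \<Rightarrow> (real \<Rightarrow> real) \<Rightarrow> bool" where
  "mu_function \<gamma> \<mu> \<longleftrightarrow>
     (\<forall>r\<in>{0<..<1}. (\<mu> has_real_derivative (gas_c \<gamma> (gas_q \<gamma> r))\<^sup>2 / (gas_q \<gamma> r)\<^sup>2) (at r))"

text \<open>The range \<open>0 < q < q_cav\<close> corresponds to densities in \<open>(0, 1)\<close>, so \<open>H(\<mu>, \<theta>)\<close> lives on the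
  open strip \<open>\<mu>((0, 1)) \<times> \<real>\<close>.\<close>
definition entropy_generator :: "real \<Rightarrow> (real \<Rightarrow> real) \<Rightarrow> (point \<Rightarrow> real) \<Rightarrow> bool" where
  "entropy_generator \<gamma> \<mu> H \<longleftrightarrow>
     C_on 3 (\<mu> ` {0<..<1} \<times> UNIV) H \<and>
     (\<forall>r\<in>{0<..<1}. \<forall>t.
        D1 (D1 H) (\<mu> r, t) + 1 / r\<^sup>2 * (1 - (mach \<gamma> (gas_q \<gamma> r))\<^sup>2) * D2 (D2 H) (\<mu> r, t) = 0)"

definition entropy_Q1 :: "real \<Rightarrow> (real \<Rightarrow> real) \<Rightarrow> (point \<Rightarrow> real) \<Rightarrow> real \<Rightarrow> real \<Rightarrow> real" where
  "entropy_Q1 \<gamma> \<mu> H r t =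
     r * gas_q \<gamma> r * D1 H (\<mu> r, t) * cos t - gas_q \<gamma> r * D2 H (\<mu> r, t) * sin t"

definition entropy_Q2 :: "real \<Rightarrow> (real \<Rightarrow> real) \<Rightarrow> (point \<Rightarrow> real) \<Rightarrow> real \<Rightarrow> real \<Rightarrow> real" where
  "entropy_Q2 \<gamma> \<mu> H r t =
     r * gas_q \<gamma> r * D1 H (\<mu> r, t) * sin t + gas_q \<gamma> r * D2 H (\<mu> r, t) * cos t"


section \<open>The space \<open>H\<^sup>-\<^sup>1\<^sub>l\<^sub>o\<^sub>c\<close>\<close>

definition test_functions :: "point set \<Rightarrow> (point \<Rightarrow> real) set" where
  "test_functions \<Omega> = {\<phi>. (\<forall>k. C_on k UNIV \<phi>) \<and>
     compact (closure {z. \<phi> z \<noteq> 0}) \<and> closure {z. \<phi> z \<noteq> 0} \<subseteq> \<Omega>}"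

definition H1_norm :: "(point \<Rightarrow> real) \<Rightarrow> real" where
  "H1_norm \<phi> = sqrt (LINT z|lborel. (\<phi> z)\<^sup>2 + (D1 \<phi> z)\<^sup>2 + (D2 \<phi> z)\<^sup>2)"

text \<open>\<open>H\<^sup>-\<^sup>1(\<Omega>)\<close> is the dual of \<open>H\<^sup>1\<^sub>0(\<Omega>)\<close>, the closure of the test functions in the \<open>H\<^sup>1\<close> norm;
  its elements are determined by their values on test functions.\<close>
definition Hm1_values :: "point set \<Rightarrow> ((point \<Rightarrow> real) \<Rightarrow> real) \<Rightarrow> real set" where
  "Hm1_values \<Omega> T = {\<bar>T \<phi>\<bar> | \<phi>. \<phi> \<in> test_functions \<Omega> \<and> H1_norm \<phi> \<le> 1}"

definition Hm1_norm :: "point set \<Rightarrow> ((point \<Rightarrow> real) \<Rightarrow> real) \<Rightarrow> real" where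
  "Hm1_norm \<Omega> T = Sup (Hm1_values \<Omega> T)"

definition compactly_inside :: "point set \<Rightarrow> point set \<Rightarrow> bool" where
  "compactly_inside U \<Omega> \<longleftrightarrow> open U \<and> compact (closure U) \<and> closure U \<subseteq> \<Omega>"

text \<open>Linear functionals on the test functions of \<open>\<Omega>\<close> whose restriction to every \<open>U\<close> compactly
  contained in \<open>\<Omega>\<close> is in \<open>H\<^sup>-\<^sup>1(U)\<close>, with the topology of the corresponding seminorms.\<close>
definition Hm1_loc :: "point set \<Rightarrow> ((point \<Rightarrow> real) \<Rightarrow> real) set" where
  "Hm1_loc \<Omega> = {T \<in> extensional (test_functions \<Omega>).
     (\<forall>\<phi>\<in>test_functions \<Omega>. \<forall>\<psi>\<in>test_functions \<Omega>. \<forall>a b.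
        T (\<lambda>z. a * \<phi> z + b * \<psi> z) = a * T \<phi> + b * T \<psi>) \<and>
     (\<forall>U. compactly_inside U \<Omega> \<longrightarrow> bdd_above (Hm1_values U T))}"

definition Hm1_loc_topology :: "point set \<Rightarrow> ((point \<Rightarrow> real) \<Rightarrow> real) topology" where
  "Hm1_loc_topology \<Omega> = topology_generated_by
     {{S \<in> Hm1_loc \<Omega>. Hm1_norm U (\<lambda>\<phi>. S \<phi> - T \<phi>) < r} | T U r.
        T \<in> Hm1_loc \<Omega> \<and> compactly_inside U \<Omega> \<and> 0 < r}"

text \<open>The distribution \<open>\<partial>\<^sub>x F1 + \<partial>\<^sub>y F2\<close> on \<open>\<Omega>\<close>.\<close>
definition distr_div ::
  "point set \<Rightarrow> (point \<Rightarrow> real) \<Rightarrow> (point \<Rightarrow> real) \<Rightarrow> (point \<Rightarrow> real) \<Rightarrow> real" where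
  "distr_div \<Omega> F1 F2 = restrict
     (\<lambda>\<phi>. - (LINT z:\<Omega>|lborel. F1 z * D1 \<phi> z + F2 z * D2 \<phi> z)) (test_functions \<Omega>)"

end

theory Submission imports Defs "HOL-Complex_Analysis.Great_Picard" begin

text \<open>On the solutions, the entropy production is \<open>\<epsilon>\<close> times a combination of the two viscous terms with
  multipliers depending on \<open>(\<rho>, \<theta>)\<close>. For a generator \<open>\<theta>\<^sup>2 / 2 + g(\<mu>)\<close> with suitable \<open>g\<close> both terms are
  dissipative; testing this balance with a squared cutoff, so that no boundary condition enters, bounds
  \<open>\<epsilon> \<bar>\<nabla>(\<rho>, \<theta>)\<bar>\<^sup>2\<close> in \<open>L\<^sup>1\<close> on compact subsets. Hence every entropy production is locally the sum of a
  sequence tending to \<open>0\<close> in \<open>H\<^sup>-\<^sup>1\<close> and one bounded in \<open>L\<^sup>1\<close>, while being the divergence of bounded fields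
  \<open>Q\<close>. Total boundedness in \<open>H\<^sup>-\<^sup>1\<close> follows by an energy argument in place of elliptic regularity:
  convolving \<open>div Q\<close> with the difference of two regularized logarithms gives a potential \<open>w\<close> that is uniformly
  small because \<open>Q\<close> is bounded, and \<open>\<integral>\<bar>\<nabla>w\<bar>\<^sup>2\<close>, a pairing of \<open>w\<close> with \<open>div Q\<close>, is therefore small.\<close>

section \<open>Calculus in the plane\<close>

text \<open>The compactness step is Murat's lemma with the integrability exponent infinity for the
  fields. In the plane a function bounded in \<open>L\<^sup>1\<close> just fails to be bounded in
  \<open>H\<^sup>-\<^sup>1\<close>, because its logarithmic potential need not be bounded. The sup
  bound on \<open>Q\<close> closes this gap: the gradient of the logarithm is integrable at its
  singularity, so the part of the kernel below scale \<open>h\<close> turns \<open>div Q\<close>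
  into a potential of size \<open>O(h)\<close>. The energy of that potential controls the distance
  in \<open>H\<^sup>-\<^sup>1\<close> between \<open>div Q\<close> and its mollification at scale
  \<open>h\<close>, and the mollifications are equicontinuous. Since the solutions are C^2 inside
  the domain, after localization all integrands are continuous with bounded support, and integration
  by parts for C^1 functions replaces weak derivatives. The coefficients degenerate at stagnation
  and at cavitation. A cutoff supported in a compact part of the domain keeps the states in one
  compact subset of the open strip \<open>states\<close>, from which all constants are drawn
  uniformly in \<open>n\<close>. The explicit numbers come from crude bounds; what matters is the
  power of \<open>h\<close>.\<close>

definition C1_on :: "point set \<Rightarrow> (point \<Rightarrow> real) \<Rightarrow> bool" where
  "C1_on S f \<longleftrightarrow> (\<forall>z\<in>S. (f has_derivative (\<lambda>h. D1 f z * fst h + D2 f z * snd h)) (at z)) \<and>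
     continuous_on S (D1 f) \<and> continuous_on S (D2 f)"

abbreviation supp :: "('a \<Rightarrow> real) \<Rightarrow> 'a set" where
  "supp f \<equiv> {z. f z \<noteq> 0}"

lemma D_eqI:
  assumes "(f has_derivative (\<lambda>h. a * fst h + b * snd h)) (at z)"
  shows "D1 f z = a" "D2 f z = b"
proof -
  have "((\<lambda>s. f (s, snd z)) has_derivative (\<lambda>h. a * fst (h, 0::real) + b * snd (h, 0::real))) (at (fst z))"
    by (rule has_derivative_compose[where g = f and f = "\<lambda>s. (s, snd z)"])
       (use assms in \<open>auto intro!: derivative_eq_intros\<close>)
  then have "((\<lambda>s. f (s, snd z)) has_real_derivative a) (at (fst z))"
    by (simp add: has_field_derivative_def)
  then show "D1 f z = a" unfolding D1_def by (rule DERIV_imp_deriv)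
  have "((\<lambda>s. f (fst z, s)) has_derivative (\<lambda>h. a * fst (0::real, h) + b * snd (0::real, h))) (at (snd z))"
    by (rule has_derivative_compose[where g = f and f = "\<lambda>s. (fst z, s)"])
       (use assms in \<open>auto intro!: derivative_eq_intros\<close>)
  then have "((\<lambda>s. f (fst z, s)) has_real_derivative b) (at (snd z))"
    by (simp add: has_field_derivative_def)
  then show "D2 f z = b" unfolding D2_def by (rule DERIV_imp_deriv)
qed

lemma C1_onI:
  assumes "\<And>z. z \<in> S \<Longrightarrow> (f has_derivative (\<lambda>h. a z * fst h + b z * snd h)) (at z)"
    and "continuous_on S a" "continuous_on S b"
  shows "C1_on S f"
proof -
  have *: "\<And>z. z \<in> S \<Longrightarrow> D1 f z = a z" "\<And>z. z \<in> S \<Longrightarrow> D2 f z = b z"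
    using D_eqI[OF assms(1)] by auto
  have "continuous_on S (D1 f)" "continuous_on S (D2 f)"
    using assms * by (metis continuous_on_cong)+
  then show ?thesis using assms(1) * by (simp add: C1_on_def)
qed

lemma C1_onD:
  assumes "C1_on S f"
  shows "z \<in> S \<Longrightarrow> (f has_derivative (\<lambda>h. D1 f z * fst h + D2 f z * snd h)) (at z)"
    "continuous_on S (D1 f)" "continuous_on S (D2 f)" "continuous_on S f"
proof -
  show "continuous_on S f"
    using assms has_derivative_continuous unfolding C1_on_def
    by (meson continuous_at_imp_continuous_on)
qed (use assms in \<open>auto simp: C1_on_def\<close>)

lemma C1_on_subset: "C1_on S f \<Longrightarrow> T \<subseteq> S \<Longrightarrow> C1_on T f"
  unfolding C1_on_def by (meson continuous_on_subset subsetD)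

lemma D_const [simp]: "D1 (\<lambda>z. c) z = 0" "D2 (\<lambda>z. c) z = 0"
  by (rule D_eqI[where a = 0 and b = 0 and f = "\<lambda>z. c"]; simp)+

lemma C1_on_const: "C1_on S (\<lambda>z. c)"
  by (rule C1_onI[where a = "\<lambda>_. 0" and b = "\<lambda>_. 0"]) auto

lemma
  shows C1_on_fst: "C1_on S fst" and C1_on_snd: "C1_on S snd"
    and D_fst: "D1 fst z = 1" "D2 fst z = 0" and D_snd: "D1 snd z = 0" "D2 snd z = 1"
proof -
  have f: "(fst has_derivative (\<lambda>h. 1 * fst h + 0 * snd h)) (at z)"
    and s: "(snd has_derivative (\<lambda>h. 0 * fst h + 1 * snd h)) (at z)" for z :: point
    by (auto intro!: derivative_eq_intros)
  show "C1_on S fst" "C1_on S snd"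
    by (rule C1_onI, rule f s, auto)+
  show "D1 fst z = 1" "D2 fst z = 0" "D1 snd z = 0" "D2 snd z = 1"
    using D_eqI[OF f] D_eqI[OF s] by auto
qed

lemma has_derivative_grad_add:
  fixes f g :: "point \<Rightarrow> real"
  assumes "(f has_derivative (\<lambda>h. a * fst h + b * snd h)) (at z)"
    and "(g has_derivative (\<lambda>h. c * fst h + d * snd h)) (at z)"
  shows "((\<lambda>z. f z + g z) has_derivative (\<lambda>h. (a + c) * fst h + (b + d) * snd h)) (at z)"
  using has_derivative_add[OF assms] by (rule has_derivative_eq_rhs) (auto simp: fun_eq_iff algebra_simps)

lemma has_derivative_grad_mult:
  fixes f g :: "point \<Rightarrow> real"
  assumes "(f has_derivative (\<lambda>h. a * fst h + b * snd h)) (at z)"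
    and "(g has_derivative (\<lambda>h. c * fst h + d * snd h)) (at z)"
  shows "((\<lambda>z. f z * g z) has_derivative
    (\<lambda>h. (f z * c + g z * a) * fst h + (f z * d + g z * b) * snd h)) (at z)"
  using has_derivative_mult[OF assms] by (rule has_derivative_eq_rhs) (auto simp: fun_eq_iff algebra_simps)

lemma has_derivative_grad_chain:
  assumes "(g has_real_derivative g') (at (f z))"
    and "(f has_derivative (\<lambda>h. a * fst h + b * snd h)) (at z)"
  shows "((\<lambda>z. g (f z)) has_derivative (\<lambda>h. (g' * a) * fst h + (g' * b) * snd h)) (at z)"
  using has_derivative_compose[OF assms(2) assms(1)[unfolded has_field_derivative_def]]
  by (rule has_derivative_eq_rhs) (auto simp: fun_eq_iff algebra_simps)

lemma has_derivative_grad_chain2: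
  fixes F :: "point \<Rightarrow> real"
  assumes "(F has_derivative (\<lambda>h. A * fst h + B * snd h)) (at (f z, g z))"
    and "(f has_derivative (\<lambda>h. a * fst h + b * snd h)) (at z)"
    and "(g has_derivative (\<lambda>h. c * fst h + d * snd h)) (at z)"
  shows "((\<lambda>z. F (f z, g z)) has_derivative
     (\<lambda>h. (A * a + B * c) * fst h + (A * b + B * d) * snd h)) (at z)"
  using has_derivative_compose[OF has_derivative_Pair[OF assms(2,3)] assms(1)]
  by (rule has_derivative_eq_rhs) (auto simp: fun_eq_iff algebra_simps)

lemma
  assumes "C1_on S f" "C1_on S g"
  shows C1_on_add: "C1_on S (\<lambda>z. f z + g z)"
    and D1_add: "z \<in> S \<Longrightarrow> D1 (\<lambda>z. f z + g z) z = D1 f z + D1 g z"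
    and D2_add: "z \<in> S \<Longrightarrow> D2 (\<lambda>z. f z + g z) z = D2 f z + D2 g z"
    and C1_on_mult: "C1_on S (\<lambda>z. f z * g z)"
    and D1_mult: "z \<in> S \<Longrightarrow> D1 (\<lambda>z. f z * g z) z = f z * D1 g z + g z * D1 f z"
    and D2_mult: "z \<in> S \<Longrightarrow> D2 (\<lambda>z. f z * g z) z = f z * D2 g z + g z * D2 f z"
proof -
  note a = has_derivative_grad_add[OF C1_onD(1)[OF assms(1)] C1_onD(1)[OF assms(2)]]
  note m = has_derivative_grad_mult[OF C1_onD(1)[OF assms(1)] C1_onD(1)[OF assms(2)]]
  note [continuous_intros] = C1_onD(2-4)[OF assms(1)] C1_onD(2-4)[OF assms(2)]
  show "C1_on S (\<lambda>z. f z + g z)" by (rule C1_onI, rule a) (auto intro!: continuous_intros)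
  show "C1_on S (\<lambda>z. f z * g z)" by (rule C1_onI, rule m) (auto intro!: continuous_intros)
  show "z \<in> S \<Longrightarrow> D1 (\<lambda>z. f z + g z) z = D1 f z + D1 g z"
    "z \<in> S \<Longrightarrow> D2 (\<lambda>z. f z + g z) z = D2 f z + D2 g z"
    by (rule D_eqI[OF a]; assumption)+
  show "z \<in> S \<Longrightarrow> D1 (\<lambda>z. f z * g z) z = f z * D1 g z + g z * D1 f z"
    "z \<in> S \<Longrightarrow> D2 (\<lambda>z. f z * g z) z = f z * D2 g z + g z * D2 f z"
    by (rule D_eqI[OF m]; assumption)+
qed

lemma
  assumes "C1_on S f"
  shows C1_on_cmult: "C1_on S (\<lambda>z. c * f z)"
    and D1_cmult: "z \<in> S \<Longrightarrow> D1 (\<lambda>z. c * f z) z = c * D1 f z"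
    and D2_cmult: "z \<in> S \<Longrightarrow> D2 (\<lambda>z. c * f z) z = c * D2 f z"
  using C1_on_mult[OF C1_on_const assms] D1_mult[OF C1_on_const assms] D2_mult[OF C1_on_const assms]
  by auto

lemma
  assumes "C1_on S f"
  shows C1_on_uminus: "C1_on S (\<lambda>z. - f z)"
    and D1_uminus: "z \<in> S \<Longrightarrow> D1 (\<lambda>z. - f z) z = - D1 f z"
    and D2_uminus: "z \<in> S \<Longrightarrow> D2 (\<lambda>z. - f z) z = - D2 f z"
  using C1_on_cmult[OF assms, of "-1"] D1_cmult[OF assms, of _ "-1"] D2_cmult[OF assms, of _ "-1"]
  by auto

lemma
  assumes "C1_on S f" "C1_on S g"
  shows C1_on_diff: "C1_on S (\<lambda>z. f z - g z)"
    and D1_diff: "z \<in> S \<Longrightarrow> D1 (\<lambda>z. f z - g z) z = D1 f z - D1 g z"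
    and D2_diff: "z \<in> S \<Longrightarrow> D2 (\<lambda>z. f z - g z) z = D2 f z - D2 g z"
  using C1_on_add[OF assms(1) C1_on_uminus[OF assms(2)]] D1_add[OF assms(1) C1_on_uminus[OF assms(2)]]
    D2_add[OF assms(1) C1_on_uminus[OF assms(2)]] D1_uminus[OF assms(2)] D2_uminus[OF assms(2)]
  by auto

lemma
  assumes "C1_on S f" and "\<And>z. z \<in> S \<Longrightarrow> (g has_real_derivative g' (f z)) (at (f z))"
    and "continuous_on (f ` S) g'"
  shows C1_on_chain: "C1_on S (\<lambda>z. g (f z))"
    and D1_chain: "z \<in> S \<Longrightarrow> D1 (\<lambda>z. g (f z)) z = g' (f z) * D1 f z"
    and D2_chain: "z \<in> S \<Longrightarrow> D2 (\<lambda>z. g (f z)) z = g' (f z) * D2 f z"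
proof -
  note c = has_derivative_grad_chain[where f = f and g = g, OF assms(2) C1_onD(1)[OF assms(1)]]
  note [continuous_intros] = C1_onD(2-4)[OF assms(1)]
  show "C1_on S (\<lambda>z. g (f z))"
    by (rule C1_onI[OF c]; (intro continuous_intros continuous_on_compose2[OF assms(3), of _ f] order_refl)?)
      assumption
  show "z \<in> S \<Longrightarrow> D1 (\<lambda>z. g (f z)) z = g' (f z) * D1 f z"
    "z \<in> S \<Longrightarrow> D2 (\<lambda>z. g (f z)) z = g' (f z) * D2 f z"
    by (rule D_eqI[OF c]; assumption)+
qed

lemma
  assumes "C1_on S f" "C1_on S g" "C1_on T F" and "\<And>z. z \<in> S \<Longrightarrow> (f z, g z) \<in> T"
  shows C1_on_chain2: "C1_on S (\<lambda>z. F (f z, g z))"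
    and D1_chain2: "z \<in> S \<Longrightarrow> D1 (\<lambda>z. F (f z, g z)) z = D1 F (f z, g z) * D1 f z + D2 F (f z, g z) * D1 g z"
    and D2_chain2: "z \<in> S \<Longrightarrow> D2 (\<lambda>z. F (f z, g z)) z = D1 F (f z, g z) * D2 f z + D2 F (f z, g z) * D2 g z"
proof -
  note c = has_derivative_grad_chain2[where f = f and g = g, OF C1_onD(1)[OF assms(3)] C1_onD(1)[OF assms(1)] C1_onD(1)[OF assms(2)], OF assms(4)]
  note [continuous_intros] = C1_onD(2-4)[OF assms(1)] C1_onD(2-4)[OF assms(2)]
  show "C1_on S (\<lambda>z. F (f z, g z))"
    by (rule C1_onI, rule c)
       (use assms(4) in \<open>auto intro!: continuous_on_add continuous_on_mult C1_onD[OF assms(1)] C1_onD[OF assms(2)]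
          continuous_on_compose2[OF C1_onD(2)[OF assms(3)], of _ "\<lambda>z. (f z, g z)"]
          continuous_on_compose2[OF C1_onD(3)[OF assms(3)], of _ "\<lambda>z. (f z, g z)"] continuous_on_Pair\<close>)
  show "z \<in> S \<Longrightarrow> D1 (\<lambda>z. F (f z, g z)) z = D1 F (f z, g z) * D1 f z + D2 F (f z, g z) * D1 g z"
    "z \<in> S \<Longrightarrow> D2 (\<lambda>z. F (f z, g z)) z = D1 F (f z, g z) * D2 f z + D2 F (f z, g z) * D2 g z"
    by (rule D_eqI[OF c]; assumption)+
qed

text \<open>With an empty boundary part, the continuous extension in \<open>C_upto\<close> coincides
  with the function itself, so the first partials are continuous on \<open>\<Omega>\<close>.
  Openness turns differentiability within \<open>\<Omega>\<close> into differentiability at the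
  point, and the linear map is read off on the two unit vectors.\<close>

lemma C1_on_C_upto:
  assumes "C_upto (Suc k) \<Omega> {} f" "open \<Omega>"
  shows "C1_on \<Omega> f"
proof -
  have cont: "C_upto j \<Omega> {} g \<Longrightarrow> continuous_on \<Omega> g" for j g
    by (cases j; clarsimp)
  have "continuous_on \<Omega> (D1 f)" "continuous_on \<Omega> (D2 f)"
    using assms(1) cont by auto
  moreover have "(f has_derivative (\<lambda>h. D1 f z * fst h + D2 f z * snd h)) (at z)" if "z \<in> \<Omega>" for z
  proof -
    have "f differentiable_on \<Omega>" using assms(1) by simp
    then have "f differentiable (at z)"
      using assms(2) that unfolding differentiable_on_def by (metis at_within_open)
    then obtain f' where f': "(f has_derivative f') (at z)" unfolding differentiable_def by blast
    then interpret bounded_linear f' by (rule has_derivative_bounded_linear)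
    have eq: "f' = (\<lambda>h. f' (1,0) * fst h + f' (0,1) * snd h)"
    proof
      fix h :: point
      have "f' h = f' (fst h *\<^sub>R (1,0) + snd h *\<^sub>R (0,1))" by simp
      also have "\<dots> = f' (1,0) * fst h + f' (0,1) * snd h" by (simp only: add scaleR) simp
      finally show "f' h = f' (1,0) * fst h + f' (0,1) * snd h" .
    qed
    have d: "(f has_derivative (\<lambda>h. f' (1,0) * fst h + f' (0,1) * snd h)) (at z)"
      by (rule has_derivative_eq_rhs[OF f' eq])
    then show ?thesis using D_eqI[OF d] by simp
  qed
  ultimately show ?thesis by (simp add: C1_on_def)
qed

text \<open>The entrance for convolutions, where differentiation under the integral sign supplies
  only the two partial derivatives.\<close>

lemma C1_UNIV_partialsI:
  assumes "\<And>x y. ((\<lambda>s. f (s, y)) has_real_derivative a (x, y)) (at x)"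
    and "\<And>x y. ((\<lambda>s. f (x, s)) has_real_derivative b (x, y)) (at y)"
    and "continuous_on UNIV a" "continuous_on UNIV b"
  shows "C1_on UNIV f" "D1 f = a" "D2 f = b"
proof -
  have d: "(f has_derivative (\<lambda>h. a z * fst h + b z * snd h)) (at z)" for z
  proof -
    obtain x y where z: "z = (x, y)" by fastforce
    have "((\<lambda>(x, y). f (x, y)) has_derivative (\<lambda>(tx, ty). a (x, y) * tx + blinfun_mult_right (b (x, y)) ty))
        (at (x, y) within UNIV \<times> UNIV)"
    proof (rule has_derivative_partialsI)
      show "((\<lambda>x. f (x, y)) has_derivative (*) (a (x, y))) (at x within UNIV)"
        using assms(1) by (simp add: has_field_derivative_def)
      show "((\<lambda>y. f (x, y)) has_derivative blinfun_apply (blinfun_mult_right (b (x, y)))) (at y within UNIV)" for x y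
        using assms(2) by (simp add: has_field_derivative_def)
      have "continuous (at (x, y)) (\<lambda>z. blinfun_mult_right (b z))"
        using assms(4) by (intro continuous_intros) (simp add: continuous_on_eq_continuous_at)
      then show "continuous (at (x, y) within UNIV \<times> UNIV) (\<lambda>(x, y). blinfun_mult_right (b (x, y)))"
        by (simp add: case_prod_unfold)
    qed auto
    then show ?thesis by (simp add: z case_prod_unfold)
  qed
  show "C1_on UNIV f" by (rule C1_onI[OF d assms(3,4)])
  show "D1 f = a" "D2 f = b" using D_eqI[OF d] by auto
qed

lemma C1_on_partials:
  assumes "C1_on S f" "(x, y) \<in> S"
  shows "((\<lambda>s. f (s, y)) has_real_derivative D1 f (x, y)) (at x)"
    "((\<lambda>s. f (x, s)) has_real_derivative D2 f (x, y)) (at y)"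
proof -
  have f: "(f has_derivative (\<lambda>h. D1 f (x, y) * fst h + D2 f (x, y) * snd h)) (at (x, y))"
    using C1_onD(1)[OF assms] .
  have "((\<lambda>s. f (s, y)) has_derivative (\<lambda>h. D1 f (x, y) * fst (h, 0::real) + D2 f (x, y) * snd (h, 0::real))) (at x)"
    by (rule has_derivative_compose[where g = f and f = "\<lambda>s. (s, y)"])
       (use f in \<open>auto intro!: derivative_eq_intros\<close>)
  then show "((\<lambda>s. f (s, y)) has_real_derivative D1 f (x, y)) (at x)"
    by (simp add: has_field_derivative_def)
  have "((\<lambda>s. f (x, s)) has_derivative (\<lambda>h. D1 f (x, y) * fst (0::real, h) + D2 f (x, y) * snd (0::real, h))) (at y)"
    by (rule has_derivative_compose[where g = f and f = "\<lambda>s. (x, s)"])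
       (use f in \<open>auto intro!: derivative_eq_intros\<close>)
  then show "((\<lambda>s. f (x, s)) has_real_derivative D2 f (x, y)) (at y)"
    by (simp add: has_field_derivative_def)
qed

lemma D_eq_0_outside:
  assumes "z \<notin> closure (supp f)"
  shows "D1 f z = 0" "D2 f z = 0"
proof -
  have zero: "f w = 0" if "w \<in> - closure (supp f)" for w
    using that closure_subset[of "supp f"] by blast
  have "((\<lambda>_. 0) has_derivative (\<lambda>h. 0 * fst h + 0 * snd h)) (at z)" by simp
  then have "(f has_derivative (\<lambda>h. 0 * fst h + 0 * snd h)) (at z)"
    by (rule has_derivative_transform_within_open[where s = "- closure (supp f)", OF _ _ _ zero[symmetric]])
      (use assms in \<open>simp_all add: open_Compl\<close>)
  note D_eqI[OF this]
  then show "D1 f z = 0" "D2 f z = 0" .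
qed

lemma supp_D_subset: "supp (D1 f) \<subseteq> closure (supp f)" "supp (D2 f) \<subseteq> closure (supp f)"
  using D_eq_0_outside by blast+

lemma bounded_supp_D:
  assumes "bounded (supp f)"
  shows "bounded (supp (D1 f))" "bounded (supp (D2 f))"
  by (rule bounded_subset[OF bounded_closure[OF assms] supp_D_subset(1)]
        bounded_subset[OF bounded_closure[OF assms] supp_D_subset(2)])+

text \<open>\<open>\<Omega>\<close> and the complement of the closed support are open sets covering
  the plane, and on the second one the function is zero. In this way functions known only in the
  domain become globally C^1 once multiplied by a cutoff.\<close>

lemma C1_on_UNIV_extend:
  assumes "C1_on \<Omega> f" "closure (supp f) \<subseteq> \<Omega>" "open \<Omega>"
  shows "C1_on UNIV f"
proof -
  let ?N = "- closure (supp f)"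
  have zero: "f w = 0" if "w \<in> ?N" for w
    using that closure_subset[of "supp f"] by blast
  have "C1_on ?N f"
  proof (rule C1_onI[where a = "\<lambda>_. 0" and b = "\<lambda>_. 0"])
    fix z assume "z \<in> ?N"
    have "((\<lambda>_. 0) has_derivative (\<lambda>h. 0 * fst h + 0 * snd h)) (at z)" by simp
    then show "(f has_derivative (\<lambda>h. 0 * fst h + 0 * snd h)) (at z)"
      by (rule has_derivative_transform_within_open[OF _ _ \<open>z \<in> ?N\<close> zero[symmetric]])
        (simp_all add: open_Compl)
  qed auto
  moreover have "\<Omega> \<union> ?N = UNIV" using assms by auto
  moreover have "open ?N" by auto
  ultimately show ?thesis
    using assms(1,3) continuous_on_open_Un[of \<Omega> ?N "D1 f"] continuous_on_open_Un[of \<Omega> ?N "D2 f"]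
    unfolding C1_on_def by auto
qed

section \<open>Integration by parts and convolution\<close>

lemma bounded_supp_mult:
  assumes "bounded (supp f)"
  shows "bounded (supp (\<lambda>z. f z * g z))" "bounded (supp (\<lambda>z. g z * f z))"
proof -
  have "supp (\<lambda>z. f z * g z) \<subseteq> supp f" "supp (\<lambda>z. g z * f z) \<subseteq> supp f" by auto
  from bounded_subset[OF assms this(1)] bounded_subset[OF assms this(2)]
  show "bounded (supp (\<lambda>z. f z * g z))" "bounded (supp (\<lambda>z. g z * f z))" .
qed

lemma bounded_supp_add:
  assumes "bounded (supp f)" "bounded (supp g)"
  shows "bounded (supp (\<lambda>z. f z + g z))"
proof -
  have "bounded (supp f \<union> supp g)" using assms by simp
  then show ?thesis by (rule bounded_subset) auto
qed

lemma bounded_suppE: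
  fixes f :: "point \<Rightarrow> real"
  assumes "bounded (supp f)"
  obtains L where "L > 0" "\<And>z. f z \<noteq> 0 \<Longrightarrow> \<bar>fst z\<bar> \<le> L \<and> \<bar>snd z\<bar> \<le> L"
proof -
  obtain L where L: "L > 0" "\<And>z. z \<in> supp f \<Longrightarrow> norm z \<le> L"
    using assms unfolding bounded_pos by metis
  show ?thesis
  proof (rule that[OF L(1)])
    fix z assume "f z \<noteq> 0"
    then have "norm z \<le> L" using L(2)[of z] by simp
    moreover have "\<bar>fst z\<bar> \<le> norm z" "\<bar>snd z\<bar> \<le> norm z"
      by (simp_all add: norm_fst_le[of "fst z" "snd z", simplified] norm_snd_le[of "snd z" "fst z", simplified])
    ultimately show "\<bar>fst z\<bar> \<le> L \<and> \<bar>snd z\<bar> \<le> L" by linarith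
  qed
qed

lemma bounded_suppI:
  fixes f :: "point \<Rightarrow> real"
  assumes "\<And>z. f z \<noteq> 0 \<Longrightarrow> \<bar>fst z\<bar> \<le> L \<and> \<bar>snd z\<bar> \<le> L"
  shows "bounded (supp f)"
proof (rule bounded_subset[OF bounded_cbox])
  show "supp f \<subseteq> cbox (-L, -L) (L, L)"
    using assms by (force simp: cbox_Pair_eq abs_le_iff)
qed

lemma integrable_Cc:
  fixes f :: "'a::euclidean_space \<Rightarrow> real"
  assumes "continuous_on UNIV f" "bounded (supp f)"
  shows "integrable lborel f"
proof -
  let ?S = "closure (supp f)"
  have "integrable lborel (\<lambda>x. indicator ?S x *\<^sub>R f x)"
    using assms by (intro borel_integrable_compact) (auto intro: continuous_on_subset)
  moreover have "(\<lambda>x. indicator ?S x *\<^sub>R f x) = f"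
    using closure_subset[of "supp f"] by (auto simp: fun_eq_iff indicator_def)
  ultimately show ?thesis by simp
qed

lemma LINT_eq_integral_cbox:
  fixes f :: "'a::euclidean_space \<Rightarrow> real"
  assumes "continuous_on UNIV f" "supp f \<subseteq> cbox a b"
  shows "(LINT x|lborel. f x) = integral (cbox a b) f"
proof -
  have "integrable lborel f"
    using assms bounded_subset[OF bounded_cbox] by (intro integrable_Cc) auto
  then have "(LINT x|lborel. f x) = integral UNIV f" by (simp add: integral_lborel)
  also have "\<dots> = integral UNIV (\<lambda>x. if x \<in> cbox a b then f x else 0)"
    by (rule arg_cong[where f = "integral UNIV"]) (use assms in \<open>auto simp: fun_eq_iff\<close>)
  also have "integral UNIV (\<lambda>x. if x \<in> cbox a b then f x else 0) = integral (cbox a b) f"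
    by (rule integral_restrict_UNIV)
  finally show ?thesis .
qed

lemma LINT_derivative_eq_0:
  assumes "\<And>s. (g has_real_derivative g' s) (at s)" "continuous_on UNIV g'"
    and "\<And>s. \<bar>s\<bar> > L \<Longrightarrow> g s = 0 \<and> g' s = 0" and "L > 0"
  shows "(LINT s|lborel. g' s) = 0"
proof -
  have "(LINT s|lborel. g' s * indicator {-L-1..L+1} s) = g (L+1) - g (-L-1)"
    using assms by (intro integral_FTC_Icc_real) (auto simp: continuous_on_eq_continuous_at)
  also have "(\<lambda>s. g' s * indicator {-L-1..L+1} s) = g'"
    using assms(3) by (force simp: fun_eq_iff indicator_def)
  also have "g (L+1) - g (-L-1) = 0" using assms(3)[of "L+1"] assms(3)[of "-L-1"] assms(4) by auto
  finally show ?thesis .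
qed

text \<open>Fubini reduces the claim to lines parallel to an axis, where the fundamental theorem of
  calculus applies. One box holding the supports of \<open>f\<close> and of both partials serves all
  lines at once.\<close>

lemma LINT_D_eq_0:
  assumes "C1_on UNIV f" "bounded (supp f)"
  shows "(LINT z|lborel. D1 f z) = 0" "(LINT z|lborel. D2 f z) = 0"
proof -
  note cont = C1_onD(2,3)[OF assms(1)]
  note bd = bounded_supp_D[OF assms(2)]
  have "bounded (supp f \<union> supp (D1 f) \<union> supp (D2 f))" using assms bd by simp
  then have "bounded (supp (\<lambda>z. \<bar>f z\<bar> + \<bar>D1 f z\<bar> + \<bar>D2 f z\<bar>))" by (rule bounded_subset) auto
  then obtain L where L: "L > 0" and "\<And>z. \<bar>f z\<bar> + \<bar>D1 f z\<bar> + \<bar>D2 f z\<bar> \<noteq> 0 \<Longrightarrow> \<bar>fst z\<bar> \<le> L \<and> \<bar>snd z\<bar> \<le> L"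
    by (rule bounded_suppE) blast
  then have "\<bar>f z\<bar> + \<bar>D1 f z\<bar> + \<bar>D2 f z\<bar> = 0" if "\<bar>fst z\<bar> > L \<or> \<bar>snd z\<bar> > L" for z
    using that by (meson not_le)
  then have z: "f z = 0 \<and> D1 f z = 0 \<and> D2 f z = 0" if "\<bar>fst z\<bar> > L \<or> \<bar>snd z\<bar> > L" for z
    using that by (smt (verit))
  have "(LINT z|lborel. D1 f z) = (LINT z|(lborel \<Otimes>\<^sub>M lborel). (case_prod (\<lambda>x y. D1 f (x, y))) z)"
    by (simp add: lborel_prod)
  also have "\<dots> = (LINT y|lborel. LINT x|lborel. D1 f (x, y))"
    using integrable_Cc[OF cont(1) bd(1)]
    by (intro lborel_pair.integral_snd[symmetric]) (simp add: lborel_prod)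
  also have "(\<lambda>y. LINT x|lborel. D1 f (x, y)) = (\<lambda>y. 0)"
  proof
    fix y
    show "(LINT x|lborel. D1 f (x, y)) = 0"
      by (rule LINT_derivative_eq_0[where g = "\<lambda>x. f (x, y)" and L = L, OF C1_on_partials(1)[OF assms(1) UNIV_I]])
        (use z L in \<open>auto intro!: continuous_on_compose2[OF cont(1)] continuous_intros\<close>)
  qed
  finally show "(LINT z|lborel. D1 f z) = 0" by simp
  have "(LINT z|lborel. D2 f z) = (LINT z|(lborel \<Otimes>\<^sub>M lborel). (case_prod (\<lambda>x y. D2 f (x, y))) z)"
    by (simp add: lborel_prod)
  also have "\<dots> = (LINT x|lborel. LINT y|lborel. D2 f (x, y))"
    using integrable_Cc[OF cont(2) bd(2)]
    by (intro lborel_pair.integral_fst[symmetric]) (simp add: lborel_prod)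
  also have "(\<lambda>x. LINT y|lborel. D2 f (x, y)) = (\<lambda>x. 0)"
  proof
    fix x
    show "(LINT y|lborel. D2 f (x, y)) = 0"
      by (rule LINT_derivative_eq_0[where g = "\<lambda>y. f (x, y)" and L = L, OF C1_on_partials(2)[OF assms(1) UNIV_I]])
        (use z L in \<open>auto intro!: continuous_on_compose2[OF cont(2)] continuous_intros\<close>)
  qed
  finally show "(LINT z|lborel. D2 f z) = 0" by simp
qed

text \<open>A bounded support of one factor suffices, because the product and both integrands
  inherit it.\<close>

lemma integration_by_parts:
  assumes "C1_on UNIV f" "C1_on UNIV g" "bounded (supp f) \<or> bounded (supp g)"
  shows "(LINT z|lborel. D1 f z * g z) = - (LINT z|lborel. f z * D1 g z)"
    and "(LINT z|lborel. D2 f z * g z) = - (LINT z|lborel. f z * D2 g z)"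
proof -
  note f = C1_onD(2-4)[OF assms(1)] and g = C1_onD(2-4)[OF assms(2)]
  have bd: "bounded (supp (\<lambda>z. F z * G z))"
    if "bounded (supp f) \<Longrightarrow> bounded (supp F)" "bounded (supp g) \<Longrightarrow> bounded (supp G)" for F G
    using assms(3) that bounded_supp_mult by blast
  have i: "integrable lborel (\<lambda>z. D1 f z * g z)" "integrable lborel (\<lambda>z. f z * D1 g z)"
    "integrable lborel (\<lambda>z. D2 f z * g z)" "integrable lborel (\<lambda>z. f z * D2 g z)"
    by (intro integrable_Cc continuous_on_mult f g bd bounded_supp_D; assumption)+
  have b: "bounded (supp (\<lambda>z. f z * g z))" using assms(3) bounded_supp_mult by blast
  note m = C1_on_mult[OF assms(1,2)]
  have "0 = (LINT z|lborel. f z * D1 g z + g z * D1 f z)"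
    using LINT_D_eq_0(1)[OF m b] by (simp add: D1_mult[OF assms(1,2)])
  then show "(LINT z|lborel. D1 f z * g z) = - (LINT z|lborel. f z * D1 g z)"
    using i by (simp add: mult.commute)
  have "0 = (LINT z|lborel. f z * D2 g z + g z * D2 f z)"
    using LINT_D_eq_0(2)[OF m b] by (simp add: D2_mult[OF assms(1,2)])
  then show "(LINT z|lborel. D2 f z * g z) = - (LINT z|lborel. f z * D2 g z)"
    using i by (simp add: mult.commute)
qed

section \<open>Convolution of continuous functions, the second of bounded support\<close>

definition conv :: "(point \<Rightarrow> real) \<Rightarrow> (point \<Rightarrow> real) \<Rightarrow> point \<Rightarrow> real" where
  "conv k f x = (LINT y|lborel. k (x - y) * f y)"

lemma continuous_conv_integrand:
  fixes k f :: "point \<Rightarrow> real"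
  assumes "continuous_on UNIV k" "continuous_on UNIV f"
  shows "continuous_on UNIV (\<lambda>y. k (x - y) * f y)"
proof -
  have "continuous_on UNIV (\<lambda>y. k (x - y))"
    by (rule continuous_on_compose2[OF assms(1)]) (auto intro!: continuous_intros)
  then show ?thesis using assms(2) by (rule continuous_on_mult)
qed

lemma continuous_conv_integrand2:
  fixes k f :: "point \<Rightarrow> real"
  assumes "continuous_on UNIV k" "continuous_on UNIV f"
  shows "continuous_on S (\<lambda>p. k (fst p - snd p) * f (snd p))"
proof -
  have "continuous_on S (\<lambda>p. k (fst p - snd p))"
    by (rule continuous_on_compose2[OF assms(1)]) (auto intro!: continuous_intros)
  moreover have "continuous_on S (\<lambda>p. f (snd p))"
    by (rule continuous_on_compose2[OF assms(2)]) (auto intro!: continuous_intros)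
  ultimately show ?thesis by (rule continuous_on_mult)
qed

lemma conv_integrable:
  fixes k f :: "point \<Rightarrow> real"
  assumes "continuous_on UNIV k" "continuous_on UNIV f" "bounded (supp f)"
  shows "integrable lborel (\<lambda>y. k (x - y) * f y)"
  by (rule integrable_Cc[OF continuous_conv_integrand[OF assms(1,2)] bounded_supp_mult(2)[OF assms(3)]])

lemma conv_add_left:
  assumes "continuous_on UNIV k" "continuous_on UNIV l" "continuous_on UNIV f" "bounded (supp f)"
  shows "conv (\<lambda>z. k z + l z) f x = conv k f x + conv l f x"
    "conv (\<lambda>z. k z - l z) f x = conv k f x - conv l f x"
  unfolding conv_def distrib_right left_diff_distrib
  by (rule Bochner_Integration.integral_add Bochner_Integration.integral_diff,
      rule conv_integrable[OF assms(1,3,4)], rule conv_integrable[OF assms(2,3,4)])+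

lemma conv_add_right:
  assumes "continuous_on UNIV k" "continuous_on UNIV f" "bounded (supp f)"
    "continuous_on UNIV g" "bounded (supp g)"
  shows "conv k (\<lambda>z. f z + g z) x = conv k f x + conv k g x"
  unfolding conv_def distrib_left
  by (rule Bochner_Integration.integral_add[OF conv_integrable[OF assms(1,2,3)] conv_integrable[OF assms(1,4,5)]])

lemma conv_eq_integral:
  assumes "continuous_on UNIV k" "continuous_on UNIV f" "supp f \<subseteq> cbox a b"
  shows "conv k f x = integral (cbox a b) (\<lambda>y. k (x - y) * f y)"
  unfolding conv_def
  by (rule LINT_eq_integral_cbox[OF continuous_conv_integrand[OF assms(1,2)]]) (use assms(3) in auto)

lemma continuous_conv:
  assumes "continuous_on UNIV k" "continuous_on UNIV f" "bounded (supp f)"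
  shows "continuous_on UNIV (conv k f)"
proof -
  obtain a b where ab: "supp f \<subseteq> cbox a b" using assms(3) bounded_subset_cbox_symmetric by blast
  have "continuous_on UNIV (\<lambda>x. integral (cbox a b) (\<lambda>y. k (x - y) * f y))"
    by (rule integral_continuous_on_param)
      (simp only: case_prod_unfold continuous_conv_integrand2[OF assms(1,2)])
  then show ?thesis by (simp add: conv_eq_integral[OF assms(1,2) ab, abs_def])
qed

text \<open>The support of \<open>f\<close> fixes one box for all arguments, so the Leibniz rule for
  a parameter integral over a compact interval applies. All derivatives fall on the kernel.\<close>

lemma
  assumes "C1_on UNIV k" "continuous_on UNIV f" "bounded (supp f)"
  shows C1_on_conv: "C1_on UNIV (conv k f)"
    and D1_conv: "D1 (conv k f) = conv (D1 k) f"
    and D2_conv: "D2 (conv k f) = conv (D2 k) f"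
proof -
  note k = C1_onD(2-4)[OF assms(1)]
  note c = continuous_on_compose2[OF k(1)] continuous_on_compose2[OF k(2)]
    continuous_on_compose2[OF k(3)] continuous_on_compose2[OF assms(2)]
  obtain a b where ab: "supp f \<subseteq> cbox a b" using assms(3) bounded_subset_cbox_symmetric by blast
  have 1: "((\<lambda>s. conv k f (s, y)) has_real_derivative conv (D1 k) f (x, y)) (at x)" for x y
    unfolding conv_eq_integral[OF k(3) assms(2) ab] conv_eq_integral[OF k(1) assms(2) ab]
  proof (rule leibniz_rule_field_derivative[where U = UNIV])
    fix s t
    have "((\<lambda>s. k (s, y - snd t)) has_real_derivative D1 k (s - fst t, y - snd t)) (at (s - fst t))"
      by (rule C1_on_partials[OF assms(1) UNIV_I])
    then have "((\<lambda>s. k (s - fst t, y - snd t)) has_real_derivative D1 k (s - fst t, y - snd t) * 1) (at s)"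
      by (rule DERIV_chain2) (auto intro!: derivative_eq_intros)
    then have "((\<lambda>s. k ((s, y) - t)) has_real_derivative D1 k ((s, y) - t)) (at s)"
      by (cases t) simp
    then show "((\<lambda>s. k ((s, y) - t) * f t) has_real_derivative D1 k ((s, y) - t) * f t) (at s)"
      by (auto intro!: derivative_eq_intros)
  qed (auto simp: case_prod_unfold intro!: integrable_continuous continuous_intros c)
  have 2: "((\<lambda>s. conv k f (x, s)) has_real_derivative conv (D2 k) f (x, y)) (at y)" for x y
    unfolding conv_eq_integral[OF k(3) assms(2) ab] conv_eq_integral[OF k(2) assms(2) ab]
  proof (rule leibniz_rule_field_derivative[where U = UNIV])
    fix s t
    have "((\<lambda>s. k (x - fst t, s)) has_real_derivative D2 k (x - fst t, s - snd t)) (at (s - snd t))"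
      by (rule C1_on_partials[OF assms(1) UNIV_I])
    then have "((\<lambda>s. k (x - fst t, s - snd t)) has_real_derivative D2 k (x - fst t, s - snd t) * 1) (at s)"
      by (rule DERIV_chain2) (auto intro!: derivative_eq_intros)
    then have "((\<lambda>s. k ((x, s) - t)) has_real_derivative D2 k ((x, s) - t)) (at s)"
      by (cases t) simp
    then show "((\<lambda>s. k ((x, s) - t) * f t) has_real_derivative D2 k ((x, s) - t) * f t) (at s)"
      by (auto intro!: derivative_eq_intros)
  qed (auto simp: case_prod_unfold intro!: integrable_continuous continuous_intros c)
  show "C1_on UNIV (conv k f)" "D1 (conv k f) = conv (D1 k) f" "D2 (conv k f) = conv (D2 k) f"
    by (rule C1_UNIV_partialsI[OF 1 2 continuous_conv[OF k(1) assms(2,3)] continuous_conv[OF k(2) assms(2,3)]])+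
qed

lemma bounded_supp_conv:
  assumes "bounded (supp k)" "bounded (supp f)"
  shows "bounded (supp (conv k f))"
proof (rule bounded_subset)
  show "bounded {a + b |a b. a \<in> supp k \<and> b \<in> supp f}"
    using bounded_plus[OF assms] by (rule bounded_subset) (force simp: set_plus_def)
  show "supp (conv k f) \<subseteq> {a + b |a b. a \<in> supp k \<and> b \<in> supp f}"
  proof (rule subsetI, rule ccontr)
    fix x assume x: "x \<in> supp (conv k f)" and n: "x \<notin> {a + b |a b. a \<in> supp k \<and> b \<in> supp f}"
    have "k (x - y) * f y = 0" for y
    proof (rule ccontr)
      assume "k (x - y) * f y \<noteq> 0"
      then have "x = (x - y) + y \<and> (x - y) \<in> supp k \<and> y \<in> supp f" by simp
      with n show False by blast
    qed
    then have "conv k f x = 0" by (simp only: conv_def) simp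
    with x show False by simp
  qed
qed

lemma has_derivative_grad_reflect:
  fixes a b :: real
  assumes "(k has_derivative (\<lambda>h. a * fst h + b * snd h)) (at (x - y))"
  shows "((\<lambda>y. k (x - y)) has_derivative (\<lambda>h. (- a) * fst h + (- b) * snd h)) (at y)"
proof -
  have "((\<lambda>y. x - y) has_derivative (\<lambda>h. - h)) (at y)" by (auto intro!: derivative_eq_intros)
  from has_derivative_compose[OF this assms] show ?thesis by (rule has_derivative_eq_rhs) (auto simp: fun_eq_iff)
qed

lemma
  assumes "C1_on UNIV k"
  shows C1_on_reflect: "C1_on UNIV (\<lambda>y. k (x - y))"
    and D1_reflect: "D1 (\<lambda>y. k (x - y)) y = - D1 k (x - y)"
    and D2_reflect: "D2 (\<lambda>y. k (x - y)) y = - D2 k (x - y)"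
proof -
  note d = has_derivative_grad_reflect[where k = k, OF C1_onD(1)[OF assms UNIV_I]]
  show "C1_on UNIV (\<lambda>y. k (x - y))"
    by (rule C1_onI, rule d) (auto intro!: continuous_intros continuous_on_compose2[OF C1_onD(2)[OF assms]]
      continuous_on_compose2[OF C1_onD(3)[OF assms]])
  show "D1 (\<lambda>y. k (x - y)) y = - D1 k (x - y)" "D2 (\<lambda>y. k (x - y)) y = - D2 k (x - y)"
    using D_eqI[OF d] .
qed

text \<open>Integration by parts contributes one minus sign and differentiating
  \<open>k (x - y)\<close> in \<open>y\<close> another, so the derivative passes from
  \<open>f\<close> to the kernel unchanged.\<close>

lemma conv_D_right:
  assumes "C1_on UNIV k" "C1_on UNIV f" "bounded (supp f)"
  shows "conv k (D1 f) = conv (D1 k) f" "conv k (D2 f) = conv (D2 k) f"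
proof -
  show "conv k (D1 f) = conv (D1 k) f"
  proof
    fix x
    have "(LINT y|lborel. D1 f y * k (x - y)) = - (LINT y|lborel. f y * D1 (\<lambda>y. k (x - y)) y)"
      by (rule integration_by_parts[OF assms(2) C1_on_reflect[OF assms(1)]]) (use assms in auto)
    then show "conv k (D1 f) x = conv (D1 k) f x"
      by (simp add: conv_def D1_reflect[OF assms(1)] mult.commute)
  qed
  show "conv k (D2 f) = conv (D2 k) f"
  proof
    fix x
    have "(LINT y|lborel. D2 f y * k (x - y)) = - (LINT y|lborel. f y * D2 (\<lambda>y. k (x - y)) y)"
      by (rule integration_by_parts[OF assms(2) C1_on_reflect[OF assms(1)]]) (use assms in auto)
    then show "conv k (D2 f) x = conv (D2 k) f x"
      by (simp add: conv_def D2_reflect[OF assms(1)] mult.commute)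
  qed
qed

text \<open>Prepares Fubini. If \<open>g\<close> has bounded support, the integrand lives on
  \<open>supp g \<times> supp f\<close>; if \<open>k\<close> has, it lives on the image of
  \<open>supp k \<times> supp f\<close> under the shear
  \<open>(u, y) \<mapsto> (u + y, y)\<close>.\<close>

lemma integrable_convolution_product:
  fixes k f g :: "point \<Rightarrow> real"
  assumes "continuous_on UNIV k" "continuous_on UNIV f" "continuous_on UNIV g"
    and "bounded (supp f)" "bounded (supp g) \<or> bounded (supp k)"
  shows "integrable (lborel \<Otimes>\<^sub>M lborel) (\<lambda>(x, y). g x * (k (x - y) * f y))"
  unfolding lborel_prod case_prod_unfold
proof (rule integrable_Cc)
  have "continuous_on UNIV (\<lambda>p::point \<times> point. g (fst p))"
    by (rule continuous_on_compose2[OF assms(3)]) (auto intro!: continuous_intros)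
  then show "continuous_on UNIV (\<lambda>p. g (fst p) * (k (fst p - snd p) * f (snd p)))"
    by (rule continuous_on_mult[OF _ continuous_conv_integrand2[OF assms(1,2)]])
  show "bounded (supp (\<lambda>p. g (fst p) * (k (fst p - snd p) * f (snd p))))"
  proof (rule disjE[OF assms(5)])
    assume "bounded (supp g)"
    then have "bounded (supp g \<times> supp f)" using assms(4) by (rule bounded_Times)
    then show ?thesis by (rule bounded_subset) auto
  next
    assume "bounded (supp k)"
    then have "bounded (supp k \<times> supp f)" using assms(4) by (rule bounded_Times)
    moreover have "bounded_linear (\<lambda>p::point \<times> point. (fst p + snd p, snd p))"
      by (intro bounded_linear_intros)
    ultimately have "bounded ((\<lambda>p. (fst p + snd p, snd p)) ` (supp k \<times> supp f))"
      by (rule bounded_linear_image)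
    then show ?thesis
    proof (rule bounded_subset, intro subsetI)
      fix p assume "p \<in> supp (\<lambda>p. g (fst p) * (k (fst p - snd p) * f (snd p)))"
      then show "p \<in> (\<lambda>p. (fst p + snd p, snd p)) ` (supp k \<times> supp f)"
        by (intro image_eqI[where x = "(fst p - snd p, snd p)"]) auto
    qed
  qed
qed

lemma conv_swap:
  assumes "continuous_on UNIV k" "\<And>z. k (- z) = k z"
    and "continuous_on UNIV f" "bounded (supp f)" "continuous_on UNIV g" "bounded (supp g)"
  shows "(LINT x|lborel. g x * conv k f x) = (LINT x|lborel. f x * conv k g x)"
proof -
  have "(LINT x|lborel. g x * conv k f x) = (LINT x|lborel. LINT y|lborel. g x * (k (x - y) * f y))"
    by (simp add: conv_def)
  also have "\<dots> = (LINT y|lborel. LINT x|lborel. g x * (k (x - y) * f y))"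
    by (rule lborel_pair.Fubini_integral[symmetric])
      (use integrable_convolution_product[of k f g] assms in auto)
  also have "\<dots> = (LINT y|lborel. LINT x|lborel. f y * (k (y - x) * g x))"
    using assms(2)[of "x - y" for x y] by (simp add: mult.assoc mult.left_commute mult.commute)
  finally show ?thesis by (simp add: conv_def)
qed

text \<open>The source of every factor \<open>4 * t\<^sup>2\<close> below: the area of a square of
  side \<open>2 * t\<close>.\<close>

lemma LINT_box_bound:
  fixes f :: "point \<Rightarrow> real"
  assumes "\<And>y. \<bar>f y\<bar> \<le> M" "\<And>y. f y \<noteq> 0 \<Longrightarrow> y \<in> cbox (a, b) (a + 2 * t, b + 2 * t)" "0 \<le> t"
    and "integrable lborel f"
  shows "\<bar>LINT y|lborel. f y\<bar> \<le> M * (4 * t\<^sup>2)"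
proof -
  let ?B = "cbox (a, b) (a + 2 * t, b + 2 * t)"
  have m: "measure lborel ?B = 4 * t\<^sup>2"
    using assms(3) by (simp add: content_Pair power2_eq_square)
  have "\<bar>LINT y|lborel. f y\<bar> \<le> (LINT y|lborel. \<bar>f y\<bar>)" by (rule integral_abs_bound)
  also have "\<dots> \<le> (LINT y|lborel. M * indicator ?B y)"
  proof (rule integral_mono)
    show "integrable lborel (\<lambda>y. M * indicator ?B y)"
      by (intro integrable_mult_right integrable_real_indicator) (auto simp: emeasure_lborel_cbox_eq)
    show "\<bar>f y\<bar> \<le> M * indicator ?B y" for y
      using assms(1)[of y] assms(2)[of y] by (auto simp: indicator_def)
  qed (use assms in auto)
  also have "\<dots> = M * (4 * t\<^sup>2)" by (simp add: m)
  finally show ?thesis .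
qed

lemma conv_bound:
  assumes "continuous_on UNIV k" "continuous_on UNIV f" "bounded (supp f)"
    and "\<And>z. \<bar>k z\<bar> \<le> c" "\<And>z. k z \<noteq> 0 \<Longrightarrow> \<bar>fst z\<bar> \<le> t \<and> \<bar>snd z\<bar> \<le> t" "0 \<le> t"
    and "\<And>z. \<bar>f z\<bar> \<le> M"
  shows "\<bar>conv k f x\<bar> \<le> c * M * (4 * t\<^sup>2)"
  unfolding conv_def
proof (rule LINT_box_bound[where a = "fst x - t" and b = "snd x - t"])
  have "0 \<le> c" using assms(4)[of 0] by linarith
  then show "\<bar>k (x - y) * f y\<bar> \<le> c * M" for y
    unfolding abs_mult using assms by (intro mult_mono) auto
  show "y \<in> cbox (fst x - t, snd x - t) (fst x - t + 2 * t, snd x - t + 2 * t)" if "k (x - y) * f y \<noteq> 0" for y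
    using assms(5)[of "x - y"] that by (cases x; cases y) (auto simp: cbox_Pair_eq abs_le_iff)
qed (use assms conv_integrable in auto)

lemma LINT_translate:
  fixes f :: "'a::euclidean_space \<Rightarrow> real"
  assumes "continuous_on UNIV f"
  shows "(LINT x|lborel. f (a + x)) = (LINT x|lborel. f x)"
proof -
  have "(LINT x|lborel. f x) = (LINT x|distr lborel borel ((+) a). f x)" by (simp add: lborel_distr_plus)
  also have "\<dots> = (LINT x|lborel. f (a + x))"
    by (rule integral_distr) (use assms borel_measurable_continuous_onI in auto)
  finally show ?thesis ..
qed

text \<open>A Young inequality by the simplest means: \<open>2 * \<bar>g x * f y\<bar>\<close> is at
  most the sum of the squares, and integrating the weight \<open>k (x - y)\<close> over the variable
  that does not occur yields the mass of \<open>k\<close>, in one of the two cases with the help of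
  evenness.\<close>

lemma conv_pairing_bound:
  assumes "continuous_on UNIV k" "bounded (supp k)" "\<And>z. k (- z) = k z" "\<And>z. 0 \<le> k z"
    and "continuous_on UNIV f" "bounded (supp f)" "continuous_on UNIV g" "bounded (supp g)"
  shows "2 * \<bar>LINT x|lborel. g x * conv k f x\<bar>
    \<le> (LINT x|lborel. k x) * ((LINT x|lborel. (g x)\<^sup>2) + (LINT x|lborel. (f x)\<^sup>2))"
proof -
  have sq: "continuous_on UNIV (\<lambda>x. (f x)\<^sup>2)" "bounded (supp (\<lambda>x. (f x)\<^sup>2))"
    "continuous_on UNIV (\<lambda>x. (g x)\<^sup>2)" "bounded (supp (\<lambda>x. (g x)\<^sup>2))"
    using assms(5-8) by (auto intro!: continuous_intros)
  let ?c = "LINT x|lborel. k x"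
  have refl: "(LINT y|lborel. k (x - y)) = ?c" for x
  proof -
    have "(LINT y|lborel. k (x - y)) = (LINT y|lborel. k (- x + y))"
      by (rule Bochner_Integration.integral_cong) (use assms(3)[of "x - y" for y] in auto)
    then show ?thesis using LINT_translate[OF assms(1), of "- x"] by simp
  qed
  have refl': "(LINT x|lborel. k (x - y)) = ?c" for y
    using LINT_translate[OF assms(1), of "- y"] by simp
  note i1 = integrable_convolution_product[OF assms(1) assms(5) assms(7) assms(6), OF disjI1, OF assms(8)]
  note i2 = integrable_convolution_product[OF assms(1) sq(1) continuous_on_const sq(2) disjI2[OF assms(2)], of 1]
  have i3: "integrable (lborel \<Otimes>\<^sub>M lborel) (\<lambda>(x, y). (g x)\<^sup>2 * k (x - y))"
  proof -
    have "bounded (supp k \<times> supp g)" using assms(2,8) by (rule bounded_Times)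
    moreover have "bounded_linear (\<lambda>p::point \<times> point. (snd p, snd p - fst p))"
      by (intro bounded_linear_intros)
    ultimately have "bounded ((\<lambda>p. (snd p, snd p - fst p)) ` (supp k \<times> supp g))"
      by (rule bounded_linear_image)
    then have "bounded (supp (\<lambda>p. (g (fst p))\<^sup>2 * k (fst p - snd p)))"
    proof (rule bounded_subset, intro subsetI)
      fix p assume "p \<in> supp (\<lambda>p. (g (fst p))\<^sup>2 * k (fst p - snd p))"
      then show "p \<in> (\<lambda>p. (snd p, snd p - fst p)) ` (supp k \<times> supp g)"
        by (intro image_eqI[where x = "(fst p - snd p, fst p)"]) auto
    qed
    moreover have "continuous_on UNIV (\<lambda>p::point \<times> point. k (fst p - snd p))"
      by (rule continuous_on_compose2[OF assms(1)]) (auto intro!: continuous_intros)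
    moreover have "continuous_on UNIV (\<lambda>p::point \<times> point. g (fst p))"
      by (rule continuous_on_compose2[OF assms(7)]) (auto intro!: continuous_intros)
    ultimately show ?thesis unfolding lborel_prod case_prod_unfold
      by (intro integrable_Cc continuous_on_mult continuous_on_power)
  qed
  have e1: "(LINT x|lborel. g x * conv k f x) = (LINT z|(lborel \<Otimes>\<^sub>M lborel). (\<lambda>(x, y). g x * (k (x - y) * f y)) z)"
    using lborel_pair.integral_fst[OF i1] by (simp add: conv_def)
  have e2: "?c * (LINT x|lborel. (f x)\<^sup>2) = (LINT z|(lborel \<Otimes>\<^sub>M lborel). (\<lambda>(x, y). 1 * (k (x - y) * (f y)\<^sup>2)) z)"
    using lborel_pair.integral_snd[OF i2] by (simp add: refl' mult.commute)
  have e3: "?c * (LINT x|lborel. (g x)\<^sup>2) = (LINT z|(lborel \<Otimes>\<^sub>M lborel). (\<lambda>(x, y). (g x)\<^sup>2 * k (x - y)) z)"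
    using lborel_pair.integral_fst[OF i3] by (simp add: refl mult.commute)
  have "2 * \<bar>LINT x|lborel. g x * conv k f x\<bar>
    \<le> 2 * (LINT z|(lborel \<Otimes>\<^sub>M lborel). \<bar>(\<lambda>(x, y). g x * (k (x - y) * f y)) z\<bar>)"
    unfolding e1 by (intro mult_left_mono integral_abs_bound) auto
  also have "\<dots> = (LINT z|(lborel \<Otimes>\<^sub>M lborel). 2 * \<bar>(\<lambda>(x, y). g x * (k (x - y) * f y)) z\<bar>)"
    by simp
  also have "\<dots> \<le> (LINT z|(lborel \<Otimes>\<^sub>M lborel). (\<lambda>(x, y). (g x)\<^sup>2 * k (x - y)) z
      + (\<lambda>(x, y). 1 * (k (x - y) * (f y)\<^sup>2)) z)"
  proof (rule integral_mono)
    fix z :: "point \<times> point"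
    obtain x y where z: "z = (x, y)" by (cases z)
    have "2 * \<bar>g x * f y\<bar> \<le> (g x)\<^sup>2 + (f y)\<^sup>2"
      using sum_squares_bound[of "\<bar>g x\<bar>" "\<bar>f y\<bar>"] by (simp add: abs_mult)
    then have "k (x - y) * (2 * \<bar>g x * f y\<bar>) \<le> k (x - y) * ((g x)\<^sup>2 + (f y)\<^sup>2)"
      using assms(4) by (rule mult_left_mono)
    then show "2 * \<bar>(\<lambda>(x, y). g x * (k (x - y) * f y)) z\<bar>
      \<le> (\<lambda>(x, y). (g x)\<^sup>2 * k (x - y)) z + (\<lambda>(x, y). 1 * (k (x - y) * (f y)\<^sup>2)) z"
      using assms(4)[of "x - y"] by (simp add: z abs_mult algebra_simps)
  qed (use i1 i2 i3 in auto)
  also have "\<dots> = ?c * ((LINT x|lborel. (g x)\<^sup>2) + (LINT x|lborel. (f x)\<^sup>2))"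
    using i2 i3 by (simp add: distrib_left e2 e3 del: mult_1)
  finally show ?thesis .
qed

section \<open>A regularized logarithmic kernel\<close>

lemma DERIV_glue:
  fixes f g :: "real \<Rightarrow> real"
  assumes f: "\<And>x. a \<le> x \<Longrightarrow> (f has_real_derivative f' x) (at x)"
    and g: "\<And>x. x \<le> a \<Longrightarrow> (g has_real_derivative g' x) (at x)"
    and eq: "f a = g a" "f' a = g' a"
  shows "((\<lambda>x. if a \<le> x then f x else g x) has_real_derivative (if a \<le> x then f' x else g' x)) (at x)"
proof -
  let ?h = "\<lambda>x. if a \<le> x then f x else g x"
  consider "x < a" | "x > a" | "x = a" by linarith
  then show ?thesis
  proof cases
    case 1
    have "(?h has_real_derivative g' x) (at x)"
      by (rule has_field_derivative_transform_within_open[OF g[of x], of "{..<a}"]) (use 1 in auto)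
    then show ?thesis using 1 by simp
  next
    case 2
    have "(?h has_real_derivative f' x) (at x)"
      by (rule has_field_derivative_transform_within_open[OF f[of x], of "{a<..}"]) (use 2 in auto)
    then show ?thesis using 2 by simp
  next
    case 3
    have "(?h has_real_derivative f' a) (at a within {a..})"
      by (rule has_field_derivative_transform_within[OF has_field_derivative_at_within[OF f[of a]], of 1]) auto
    moreover have "(?h has_real_derivative f' a) (at a within {..a})"
      by (rule has_field_derivative_transform_within[OF has_field_derivative_at_within[OF g[of a, folded eq(2)]], of 1])
        (use eq in auto)
    ultimately have "(?h has_real_derivative f' a) (at a within ({a..} \<union> {..a}))"
      unfolding has_field_derivative_iff by (rule Lim_Un)
    moreover have "{a..} \<union> {..a} = UNIV" by auto
    ultimately show ?thesis using 3 by simp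
  qed
qed

text \<open>The logarithm, continued to \<open>u < 1\<close> by its third Taylor polynomial at \<open>1\<close>.\<close>
definition lreg :: "real \<Rightarrow> real" where
  "lreg u = (if 1 \<le> u then ln u else (u - 1) - (u - 1)\<^sup>2 / 2 + (u - 1) ^ 3 / 3)"

definition lreg1 :: "real \<Rightarrow> real" where
  "lreg1 u = (if 1 \<le> u then 1 / u else 1 - (u - 1) + (u - 1)\<^sup>2)"

definition lreg2 :: "real \<Rightarrow> real" where
  "lreg2 u = (if 1 \<le> u then - 1 / u\<^sup>2 else - 1 + 2 * (u - 1))"

lemma lreg_deriv: "(lreg has_real_derivative lreg1 u) (at u)"
proof -
  have "((\<lambda>u. if 1 \<le> u then ln u else (u - 1) - (u - 1)\<^sup>2 / 2 + (u - 1) ^ 3 / 3) has_real_derivative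
    (if 1 \<le> u then 1 / u else 1 - (u - 1) + (u - 1)\<^sup>2)) (at u)" for u :: real
    by (rule DERIV_glue) (auto intro!: derivative_eq_intros simp: power2_eq_square field_simps)
  then show ?thesis by (simp add: lreg_def[abs_def] lreg1_def)
qed

lemma lreg1_deriv: "(lreg1 has_real_derivative lreg2 u) (at u)"
proof -
  have "((\<lambda>u. if 1 \<le> u then 1 / u else 1 - (u - 1) + (u - 1)\<^sup>2) has_real_derivative
    (if 1 \<le> u then - 1 / u\<^sup>2 else - 1 + 2 * (u - 1))) (at u)" for u :: real
    by (rule DERIV_glue) (auto intro!: derivative_eq_intros simp: power2_eq_square)
  then show ?thesis by (simp add: lreg1_def[abs_def] lreg2_def)
qed

lemma continuous_lreg2: "continuous_on UNIV lreg2"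
proof -
  have "continuous_on ({1..} \<union> {..1}) (\<lambda>u::real. if 1 \<le> u then - 1 / u\<^sup>2 else - 1 + 2 * (u - 1))"
    by (rule continuous_on_If) (auto intro!: continuous_intros)
  moreover have "{1..} \<union> {..1} = (UNIV :: real set)" by auto
  ultimately show ?thesis by (simp add: lreg2_def[abs_def])
qed

lemma continuous_lreg1: "continuous_on UNIV lreg1"
  by (meson DERIV_isCont continuous_at_imp_continuous_on lreg1_deriv)

definition nsq :: "point \<Rightarrow> real" where "nsq z = (fst z)\<^sup>2 + (snd z)\<^sup>2"

lemma
  shows C1_on_nsq: "C1_on UNIV (\<lambda>z. nsq z / t\<^sup>2)"
    and D1_nsq: "D1 (\<lambda>z. nsq z / t\<^sup>2) z = 2 * fst z / t\<^sup>2"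
    and D2_nsq: "D2 (\<lambda>z. nsq z / t\<^sup>2) z = 2 * snd z / t\<^sup>2"
proof -
  have d: "((\<lambda>z. nsq z / t\<^sup>2) has_derivative (\<lambda>h. (2 * fst z / t\<^sup>2) * fst h + (2 * snd z / t\<^sup>2) * snd h)) (at z)" for z
  proof (cases "t = 0")
    case False
    then show ?thesis unfolding nsq_def
      by (auto intro!: derivative_eq_intros simp: fun_eq_iff power2_eq_square field_simps)
  qed simp
  show "C1_on UNIV (\<lambda>z. nsq z / t\<^sup>2)"
    by (rule C1_onI, rule d) (auto simp: divide_inverse intro!: continuous_intros)
  show "D1 (\<lambda>z. nsq z / t\<^sup>2) z = 2 * fst z / t\<^sup>2" "D2 (\<lambda>z. nsq z / t\<^sup>2) z = 2 * snd z / t\<^sup>2"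
    using D_eqI[OF d] .
qed

text \<open>The summand \<open>2 * ln t\<close> makes the kernel equal to \<open>ln (nsq z)\<close>
  wherever \<open>nsq z \<ge> t\<^sup>2\<close>, for every positive \<open>t\<close>. Kernels of two
  scales therefore differ only inside a disc, although each of them is unbounded.\<close>

definition logker :: "real \<Rightarrow> point \<Rightarrow> real" where
  "logker t z = lreg (nsq z / t\<^sup>2) + 2 * ln t"

text \<open>This is the Laplacian of \<open>logker t\<close>. With
  \<open>u = nsq z / t\<^sup>2\<close> it equals
  \<open>4 / t\<^sup>2 * (lreg1 u + u * lreg2 u)\<close>, which vanishes for
  \<open>u \<ge> 1\<close> since the logarithm is harmonic there. For \<open>u < 1\<close> the cubic
  Taylor polynomial turns the bracket into \<open>3 * (1 - u)\<^sup>2\<close>, which is nonnegative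
  and continues by zero as a C^1 function; the quadratic polynomial would give
  \<open>2 * (1 - u)\<close>, with a kink at \<open>u = 1\<close>.\<close>

definition bump :: "real \<Rightarrow> point \<Rightarrow> real" where
  "bump t z = 12 / t\<^sup>2 * (max 0 (1 - nsq z / t\<^sup>2))\<^sup>2"

lemma
  shows C1_on_logker: "C1_on UNIV (logker t)"
    and D1_logker: "D1 (logker t) = (\<lambda>z. lreg1 (nsq z / t\<^sup>2) * (2 / t\<^sup>2 * fst z))"
    and D2_logker: "D2 (logker t) = (\<lambda>z. lreg1 (nsq z / t\<^sup>2) * (2 / t\<^sup>2 * snd z))"
proof -
  note c = C1_on_nsq[of t] lreg_deriv continuous_on_subset[OF continuous_lreg1 subset_UNIV]
  note a = C1_on_chain[OF c] C1_on_const[of UNIV "2 * ln t"]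
  show "C1_on UNIV (logker t)" using C1_on_add[OF a] by (simp add: logker_def[abs_def])
  show "D1 (logker t) = (\<lambda>z. lreg1 (nsq z / t\<^sup>2) * (2 / t\<^sup>2 * fst z))"
    using D1_add[OF a] D1_chain[OF c] by (simp add: logker_def[abs_def] D1_nsq fun_eq_iff)
  show "D2 (logker t) = (\<lambda>z. lreg1 (nsq z / t\<^sup>2) * (2 / t\<^sup>2 * snd z))"
    using D2_add[OF a] D2_chain[OF c] by (simp add: logker_def[abs_def] D2_nsq fun_eq_iff)
qed

lemma
  shows C1_on_D1_logker: "C1_on UNIV (D1 (logker t))"
    and C1_on_D2_logker: "C1_on UNIV (D2 (logker t))"
    and laplacian_logker: "t > 0 \<Longrightarrow> D1 (D1 (logker t)) z + D2 (D2 (logker t)) z = bump t z"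
proof -
  note c = C1_on_nsq[of t] lreg1_deriv continuous_on_subset[OF continuous_lreg2 subset_UNIV]
  note f = C1_on_cmult[OF C1_on_fst[of UNIV], of "2 / t\<^sup>2"] and s = C1_on_cmult[OF C1_on_snd[of UNIV], of "2 / t\<^sup>2"]
  note m1 = C1_on_chain[OF c] f and m2 = C1_on_chain[OF c] s
  show "C1_on UNIV (D1 (logker t))" using C1_on_mult[OF m1] by (simp add: D1_logker)
  show "C1_on UNIV (D2 (logker t))" using C1_on_mult[OF m2] by (simp add: D2_logker)
  assume t: "t > 0"
  let ?u = "nsq z / t\<^sup>2"
  have "D1 (D1 (logker t)) z = lreg1 ?u * (2 / t\<^sup>2) + (2 / t\<^sup>2 * fst z) * (lreg2 ?u * (2 * fst z / t\<^sup>2))"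
    unfolding D1_logker D1_mult[OF m1 UNIV_I] D1_chain[OF c UNIV_I] D1_cmult[OF C1_on_fst[of UNIV] UNIV_I]
      D_fst D1_nsq by simp
  moreover have "D2 (D2 (logker t)) z = lreg1 ?u * (2 / t\<^sup>2) + (2 / t\<^sup>2 * snd z) * (lreg2 ?u * (2 * snd z / t\<^sup>2))"
    unfolding D2_logker D2_mult[OF m2 UNIV_I] D2_chain[OF c UNIV_I] D2_cmult[OF C1_on_snd[of UNIV] UNIV_I]
      D_snd D2_nsq by simp
  ultimately have "D1 (D1 (logker t)) z + D2 (D2 (logker t)) z = 4 / t\<^sup>2 * (lreg1 ?u + lreg2 ?u * ?u)"
    using t by (simp add: nsq_def field_simps power2_eq_square)
  also have "lreg1 u + lreg2 u * u = 3 * (max 0 (1 - u))\<^sup>2" for u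
    by (auto simp: lreg1_def lreg2_def max_def power2_eq_square field_simps)
  finally show "D1 (D1 (logker t)) z + D2 (D2 (logker t)) z = bump t z" by (simp add: bump_def)
qed

lemma DERIV_max_sq: "((\<lambda>u. (max 0 (1 - u))\<^sup>2) has_real_derivative (- 2 * max 0 (1 - u))) (at u)" for u :: real
proof -
  have "((\<lambda>u. if 1 \<le> u then 0 else (1 - u)\<^sup>2) has_real_derivative (if 1 \<le> u then 0 else - 2 * (1 - u))) (at u)" for u :: real
    by (rule DERIV_glue) (auto intro!: derivative_eq_intros)
  moreover have "(\<lambda>u. (max 0 (1 - u))\<^sup>2) = (\<lambda>u::real. if 1 \<le> u then 0 else (1 - u)\<^sup>2)"
    by (auto simp: fun_eq_iff max_def)
  moreover have "- 2 * max 0 (1 - u) = (if 1 \<le> u then 0 else - 2 * (1 - u))"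
    by (auto simp: max_def)
  ultimately show ?thesis by simp
qed

lemma C1_on_bump: "C1_on UNIV (bump t)"
proof -
  have "C1_on UNIV (\<lambda>z. (max 0 (1 - nsq z / t\<^sup>2))\<^sup>2)"
    by (rule C1_on_chain[OF C1_on_nsq DERIV_max_sq]) (intro continuous_intros)
  from C1_on_cmult[OF this, of "12 / t\<^sup>2"] show ?thesis unfolding bump_def[abs_def] .
qed

lemma nsq_ge: "t > 0 \<Longrightarrow> nsq z < t\<^sup>2 \<Longrightarrow> \<bar>fst z\<bar> \<le> t \<and> \<bar>snd z\<bar> \<le> t"
proof -
  assume "t > 0" "nsq z < t\<^sup>2"
  then have "(fst z)\<^sup>2 \<le> t\<^sup>2" "(snd z)\<^sup>2 \<le> t\<^sup>2"
    unfolding nsq_def by (smt (verit) zero_le_power2)+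
  then show ?thesis using \<open>t > 0\<close> by (auto intro: power2_le_imp_le simp: abs_le_square_iff)
qed

lemma
  assumes "t > 0"
  shows bump_even: "bump t (- z) = bump t z"
    and bump_nonneg: "0 \<le> bump t z"
    and bump_le: "\<bar>bump t z\<bar> \<le> 12 / t\<^sup>2"
    and bump_supp: "bump t z \<noteq> 0 \<Longrightarrow> \<bar>fst z\<bar> \<le> t \<and> \<bar>snd z\<bar> \<le> t"
proof -
  show "bump t (- z) = bump t z" "0 \<le> bump t z" by (auto simp: bump_def nsq_def)
  have u: "0 \<le> nsq z / t\<^sup>2" by (simp add: nsq_def)
  then have "(max 0 (1 - nsq z / t\<^sup>2))\<^sup>2 \<le> 1" by (intro power_le_one) auto
  from mult_left_mono[OF this, of "12 / t\<^sup>2"] show "\<bar>bump t z\<bar> \<le> 12 / t\<^sup>2"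
    by (simp add: bump_def abs_mult)
  assume "bump t z \<noteq> 0"
  then have "nsq z / t\<^sup>2 < 1" by (auto simp: bump_def max_def split: if_splits)
  then have "nsq z < t\<^sup>2" using assms by (simp add: field_simps)
  then show "\<bar>fst z\<bar> \<le> t \<and> \<bar>snd z\<bar> \<le> t" using nsq_ge assms by blast
qed

lemma bounded_supp_bump: "t > 0 \<Longrightarrow> bounded (supp (bump t))"
  by (rule bounded_suppI[where L = t]) (use bump_supp in auto)

lemma logker_diff_outside:
  assumes "0 < s" "s \<le> h" "logker h z - logker s z \<noteq> 0"
  shows "nsq z < h\<^sup>2"
proof (rule ccontr)
  assume "\<not> nsq z < h\<^sup>2"
  then have n: "nsq z \<ge> h\<^sup>2" by simp
  moreover have "h\<^sup>2 \<ge> s\<^sup>2" using assms by (simp add: power_mono)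
  moreover have "s\<^sup>2 > 0" "h\<^sup>2 > 0" using assms by auto
  ultimately have "nsq z > 0" "nsq z \<ge> s\<^sup>2" by linarith+
  then have "nsq z / h\<^sup>2 \<ge> 1" "nsq z / s\<^sup>2 \<ge> 1" "nsq z > 0"
    using assms n by auto
  then have "logker h z = ln (nsq z)" "logker s z = ln (nsq z)"
    using assms by (simp_all add: logker_def lreg_def ln_div ln_realpow)
  then show False using assms by simp
qed

lemma bounded_supp_logker_diff:
  assumes "0 < s" "s \<le> h"
  shows "bounded (supp (\<lambda>z. logker h z - logker s z))"
  by (rule bounded_suppI[where L = h]) (use logker_diff_outside[OF assms] nsq_ge assms in auto)

text \<open>The gradient of the logarithm at distance \<open>t\<close> is of order
  \<open>1 / t\<close>, and the regularization keeps this order inside the disc. The 6 is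
  \<open>3 * 2\<close>, from \<open>lreg1 \<le> 3\<close> on \<open>[0, 1)\<close>; outside the disc
  the sharper \<open>2 / t\<close> holds.\<close>

lemma D_logker_bound:
  assumes "t > 0"
  shows "\<bar>D1 (logker t) z\<bar> \<le> 6 / t" "\<bar>D2 (logker t) z\<bar> \<le> 6 / t"
proof -
  let ?u = "nsq z / t\<^sup>2"
  have *: "\<bar>lreg1 ?u * (2 / t\<^sup>2 * x)\<bar> \<le> 6 / t" if x: "x\<^sup>2 \<le> nsq z" for x
  proof (cases "1 \<le> ?u")
    case True
    then have n: "nsq z \<ge> t\<^sup>2" using assms by (simp add: field_simps)
    then have n0: "nsq z > 0" using assms by (smt (verit) zero_less_power)
    have "lreg1 ?u * (2 / t\<^sup>2 * x) = 2 * x / nsq z" using True assms by (simp add: lreg1_def field_simps)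
    moreover have "\<bar>x\<bar> * t \<le> nsq z"
    proof (rule power2_le_imp_le)
      have "(\<bar>x\<bar> * t)\<^sup>2 = x\<^sup>2 * t\<^sup>2" by (simp add: power_mult_distrib)
      also have "\<dots> \<le> nsq z * nsq z" using x n n0 by (intro mult_mono) auto
      finally show "(\<bar>x\<bar> * t)\<^sup>2 \<le> (nsq z)\<^sup>2" by (simp add: power2_eq_square)
    qed (use n0 in auto)
    then have "\<bar>2 * x / nsq z\<bar> \<le> 2 / t" using n0 assms by (simp add: field_simps abs_mult)
    moreover have "2 / t \<le> 6 / t" using assms by (simp add: divide_right_mono)
    ultimately show ?thesis by simp
  next
    case False
    then have "nsq z \<le> t\<^sup>2" using assms by (simp add: field_simps)
    then have "x\<^sup>2 \<le> t\<^sup>2" using x by simp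
    then have xt: "\<bar>x\<bar> \<le> t" using assms by (simp add: abs_le_square_iff[symmetric])
    have u: "0 \<le> ?u" "?u < 1" using False by (auto simp: nsq_def)
    have "0 \<le> lreg1 u \<and> lreg1 u \<le> 3" if "0 \<le> u" "u < 1" for u
    proof -
      have "lreg1 u = 3 - 3 * u + u * u" using that by (simp add: lreg1_def power2_eq_square algebra_simps)
      then show ?thesis using that mult_left_le[of u u] zero_le_square[of u] by linarith
    qed
    then have "0 \<le> lreg1 ?u" "lreg1 ?u \<le> 3" using u by auto
    then have "\<bar>lreg1 ?u * (2 / t\<^sup>2 * x)\<bar> \<le> 3 * (2 / t\<^sup>2 * t)"
      unfolding abs_mult using xt assms by (intro mult_mono) auto
    also have "\<dots> = 6 / t" using assms by (simp add: power2_eq_square)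
    finally show ?thesis .
  qed
  show "\<bar>D1 (logker t) z\<bar> \<le> 6 / t" "\<bar>D2 (logker t) z\<bar> \<le> 6 / t"
    unfolding D1_logker D2_logker by (rule *, simp add: nsq_def)+
qed

abbreviation "bump_mass \<equiv> LINT z|lborel. bump 1 z"

text \<open>Two bumps differ by the Laplacian of a function of bounded support, whose integral is
  zero; this takes the place of a change of variables.\<close>

lemma bump_mass:
  assumes "t > 0"
  shows "(LINT z|lborel. bump t z) = bump_mass"
proof -
  have *: "(LINT z|lborel. bump h z) = (LINT z|lborel. bump s z)" if "0 < s" "s \<le> h" for s h
  proof -
    let ?G = "\<lambda>z. logker h z - logker s z"
    note b = bounded_supp_logker_diff[OF that]
    note c = C1_on_diff[OF C1_on_D1_logker C1_on_D1_logker, of h s]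
      C1_on_diff[OF C1_on_D2_logker C1_on_D2_logker, of h s]
    have e: "D1 ?G = (\<lambda>z. D1 (logker h) z - D1 (logker s) z)" "D2 ?G = (\<lambda>z. D2 (logker h) z - D2 (logker s) z)"
      by (auto simp: fun_eq_iff D1_diff[OF C1_on_logker C1_on_logker] D2_diff[OF C1_on_logker C1_on_logker])
    note c' = c[folded e]
    have i: "integrable lborel (D1 (D1 ?G))" "integrable lborel (D2 (D2 ?G))"
      by (rule integrable_Cc[OF C1_onD(2)[OF c'(1)] bounded_supp_D(1)[OF bounded_supp_D(1)[OF b]]]
        integrable_Cc[OF C1_onD(3)[OF c'(2)] bounded_supp_D(2)[OF bounded_supp_D(2)[OF b]]])+
    note z = LINT_D_eq_0(1)[OF c'(1) bounded_supp_D(1)[OF b]] LINT_D_eq_0(2)[OF c'(2) bounded_supp_D(2)[OF b]]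
    have "bump h z - bump s z = D1 (D1 ?G) z + D2 (D2 ?G) z" for z
      using laplacian_logker[of h z] laplacian_logker[of s z] that
      by (simp add: e D1_diff[OF C1_on_D1_logker C1_on_D1_logker] D2_diff[OF C1_on_D2_logker C1_on_D2_logker])
    then have "(LINT z|lborel. bump h z - bump s z) = 0" using i z by simp
    moreover have "integrable lborel (bump h)" "integrable lborel (bump s)"
      using that by (auto intro!: integrable_Cc C1_onD[OF C1_on_bump] bounded_supp_bump)
    ultimately show ?thesis by simp
  qed
  show ?thesis using *[of 1 t] *[of t 1] assms by (cases "1 \<le> t") auto
qed

text \<open>The exact value is 4 times pi. The upper bound is the maximum 12 times the area 4 of a
  square around the unit disc; the lower one uses \<open>bump 1 \<ge> 3\<close> on the concentric
  square of side 1, where \<open>nsq \<le> 1/2\<close>.\<close>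

lemma bump_mass_bounds: "bump_mass > 0" "bump_mass \<le> 48"
proof -
  have i: "integrable lborel (bump 1)"
    by (auto intro!: integrable_Cc C1_onD[OF C1_on_bump] bounded_supp_bump)
  have "\<bar>bump_mass\<bar> \<le> 12 / 1\<^sup>2 * (4 * 1\<^sup>2)"
    by (rule LINT_box_bound[where a = "-1" and b = "-1", OF bump_le[OF zero_less_one] _ _ i])
      (use bump_supp[OF zero_less_one] in \<open>force simp: cbox_Pair_eq abs_le_iff\<close>)+
  then show "bump_mass \<le> 48" by simp
  let ?B = "cbox (-1/2, -1/2) (1/2, 1/2) :: point set"
  have "(LINT z|lborel. 3 * indicator ?B z) \<le> bump_mass"
  proof (rule integral_mono[OF _ i])
    show "integrable lborel (\<lambda>z. 3 * indicator ?B z :: real)"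
      by (intro integrable_mult_right integrable_real_indicator) (auto simp: emeasure_lborel_cbox_eq)
    show "3 * indicator ?B z \<le> bump 1 z" for z
    proof (cases "z \<in> ?B")
      case True
      then have "\<bar>fst z\<bar> \<le> 1/2" "\<bar>snd z\<bar> \<le> 1/2" by (auto simp: cbox_Pair_eq)
      then have "(fst z)\<^sup>2 \<le> (1/2)\<^sup>2" "(snd z)\<^sup>2 \<le> (1/2)\<^sup>2"
        using power2_abs power_mono abs_ge_zero by metis+
      then have "1/2 \<le> max 0 (1 - nsq z)" by (auto simp: nsq_def power2_eq_square)
      then have "(1/2)\<^sup>2 \<le> (max 0 (1 - nsq z))\<^sup>2" by (rule power_mono) auto
      then show ?thesis using True by (simp add: bump_def power2_eq_square)
    qed (use bump_nonneg[OF zero_less_one] in auto)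
  qed
  moreover have "(LINT z|lborel. 3 * indicator ?B z) = (3::real)"
    by (simp add: content_Pair)
  ultimately show "bump_mass > 0" by linarith
qed

section \<open>Cauchy-Schwarz inequality and approximate identities\<close>

lemma quadratic_nonneg_discriminant:
  fixes A B C :: real
  assumes "\<And>l. 0 \<le> A - 2 * l * B + l\<^sup>2 * C" "0 \<le> C"
  shows "B\<^sup>2 \<le> A * C"
proof (cases "C = 0")
  case True
  have "B = 0"
  proof (rule ccontr)
    assume "B \<noteq> 0"
    \<comment> \<open>With \<open>C = 0\<close> this value of \<open>l\<close> makes the nonnegative
      expression equal to -1.\<close>
    then show False using assms(1)[of "(A + 1) / (2 * B)"] True by (simp add: field_simps)
  qed
  then show ?thesis using assms(1)[of 0] True by simp
next
  case False
  then have "0 < C" using assms by simp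
  moreover have "0 \<le> A - B\<^sup>2 / C"
    using assms(1)[of "B / C"] \<open>0 < C\<close> by (simp add: power2_eq_square field_simps)
  ultimately show ?thesis by (simp add: field_simps)
qed

lemma Cauchy_Schwarz_pair:
  fixes f1 f2 g1 g2 :: "point \<Rightarrow> real"
  assumes "continuous_on UNIV f1" "continuous_on UNIV f2" "continuous_on UNIV g1" "continuous_on UNIV g2"
    and "bounded (supp f1)" "bounded (supp f2)" "bounded (supp g1)" "bounded (supp g2)"
  shows "\<bar>LINT z|lborel. f1 z * g1 z + f2 z * g2 z\<bar>
    \<le> sqrt (LINT z|lborel. (f1 z)\<^sup>2 + (f2 z)\<^sup>2) * sqrt (LINT z|lborel. (g1 z)\<^sup>2 + (g2 z)\<^sup>2)"
proof -
  let ?A = "LINT z|lborel. (f1 z)\<^sup>2 + (f2 z)\<^sup>2" and ?C = "LINT z|lborel. (g1 z)\<^sup>2 + (g2 z)\<^sup>2"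
    and ?B = "LINT z|lborel. f1 z * g1 z + f2 z * g2 z"
  have m: "integrable lborel (\<lambda>z. f z * g z)"
    if "continuous_on UNIV f" "continuous_on UNIV g" "bounded (supp f)" for f g :: "point \<Rightarrow> real"
    by (rule integrable_Cc[OF continuous_on_mult[OF that(1,2)] bounded_supp_mult(1)[OF that(3)]])
  have i: "integrable lborel (\<lambda>z. (f1 z)\<^sup>2 + (f2 z)\<^sup>2)" "integrable lborel (\<lambda>z. (g1 z)\<^sup>2 + (g2 z)\<^sup>2)"
    "integrable lborel (\<lambda>z. f1 z * g1 z + f2 z * g2 z)"
    using m assms by (simp_all add: power2_eq_square)
  have "0 \<le> ?A - 2 * l * ?B + l\<^sup>2 * ?C" for l
  proof -
    have "0 \<le> (LINT z|lborel. (f1 z - l * g1 z)\<^sup>2 + (f2 z - l * g2 z)\<^sup>2)" by simp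
    also have "(\<lambda>z. (f1 z - l * g1 z)\<^sup>2 + (f2 z - l * g2 z)\<^sup>2) =
      (\<lambda>z. ((f1 z)\<^sup>2 + (f2 z)\<^sup>2) - 2 * l * (f1 z * g1 z + f2 z * g2 z) + l\<^sup>2 * ((g1 z)\<^sup>2 + (g2 z)\<^sup>2))"
      by (simp add: fun_eq_iff power2_eq_square algebra_simps)
    also have "(LINT z|lborel. ((f1 z)\<^sup>2 + (f2 z)\<^sup>2) - 2 * l * (f1 z * g1 z + f2 z * g2 z) + l\<^sup>2 * ((g1 z)\<^sup>2 + (g2 z)\<^sup>2))
      = ?A - 2 * l * ?B + l\<^sup>2 * ?C"
      using i by (simp only: Bochner_Integration.integral_add Bochner_Integration.integral_diff
        integrable_mult_right integrable_diff integral_mult_right_zero Bochner_Integration.integrable_diff)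
    finally show ?thesis .
  qed
  then have "?B\<^sup>2 \<le> ?A * ?C" by (rule quadratic_nonneg_discriminant) simp
  then show ?thesis
    unfolding real_sqrt_mult[symmetric] real_sqrt_abs[symmetric] by (rule real_sqrt_le_mono)
qed

lemma uniformly_continuous_Cc:
  fixes f :: "point \<Rightarrow> real"
  assumes "continuous_on UNIV f" "bounded (supp f)" "e > 0"
  obtains d where "d > 0" "\<And>x y. dist x y < d \<Longrightarrow> \<bar>f x - f y\<bar> < e"
proof -
  obtain R where R: "\<And>z. z \<in> supp f \<Longrightarrow> norm z \<le> R" "R > 0"
    using assms(2) unfolding bounded_pos by metis
  let ?K = "cball (0::point) (R + 1)"
  have "uniformly_continuous_on ?K f"
    by (rule compact_uniformly_continuous[OF continuous_on_subset[OF assms(1)]]) auto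
  then obtain d where d: "d > 0" "\<And>x y. x \<in> ?K \<Longrightarrow> y \<in> ?K \<Longrightarrow> dist y x < d \<Longrightarrow> dist (f y) (f x) < e"
    unfolding uniformly_continuous_on_def using assms(3) by metis
  show ?thesis
  proof (rule that[of "min d 1"])
    fix x y :: point assume xy: "dist x y < min d 1"
    show "\<bar>f x - f y\<bar> < e"
    proof (cases "f x = 0 \<and> f y = 0")
      case False
      then have "norm x \<le> R \<or> norm y \<le> R" using R(1)[of x] R(1)[of y] by auto
      moreover have "\<bar>norm x - norm y\<bar> \<le> dist x y" unfolding dist_norm by (rule norm_triangle_ineq3)
      ultimately have "x \<in> ?K" "y \<in> ?K" using xy by auto
      then show ?thesis using d(2)[of y x] xy by (simp add: dist_real_def)
    qed (use assms in auto)
  qed (use d in auto)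
qed

text \<open>The bumps are not normalized, so the limit carries the factor \<open>bump_mass\<close>.
  The constant 48 is the sup bound \<open>12 / s\<^sup>2\<close> times the area
  \<open>4 * s\<^sup>2\<close> of the square containing the support.\<close>

lemma conv_bump_approx:
  assumes "continuous_on UNIV f" "bounded (supp f)" "e > 0"
  obtains d where "d > 0" "\<And>s x. 0 < s \<Longrightarrow> s < d \<Longrightarrow> \<bar>conv (bump s) f x - bump_mass * f x\<bar> \<le> 48 * e"
proof -
  obtain d where d: "d > 0" "\<And>x y. dist x y < d \<Longrightarrow> \<bar>f x - f y\<bar> < e"
    using uniformly_continuous_Cc[OF assms] by metis
  show ?thesis
  proof (rule that[of "d / 2"])
    fix s :: real and x assume s: "0 < s" "s < d / 2"
    note k = C1_onD(4)[OF C1_on_bump[of s]]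
    have k': "continuous_on UNIV (\<lambda>y. bump s (x - y))"
      by (rule continuous_on_compose2[OF k]) (auto intro!: continuous_intros)
    have box: "y \<in> cbox (fst x - s, snd x - s) (fst x - s + 2 * s, snd x - s + 2 * s)"
      if "bump s (x - y) \<noteq> 0" for y
      using bump_supp[OF s(1) that] by (cases x; cases y) (auto simp: cbox_Pair_eq abs_le_iff)
    have "supp (\<lambda>y. bump s (x - y)) \<subseteq> cbox (fst x - s, snd x - s) (fst x - s + 2 * s, snd x - s + 2 * s)"
      using box by blast
    then have bd: "bounded (supp (\<lambda>y. bump s (x - y)))" by (rule bounded_subset[OF bounded_cbox])
    have i: "integrable lborel (\<lambda>y. bump s (x - y))" by (rule integrable_Cc[OF k' bd])
    have i2: "integrable lborel (\<lambda>y. bump s (x - y) * f y)" by (rule conv_integrable[OF k assms(1,2)])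
    have "(LINT y|lborel. bump s (x - y)) = (LINT y|lborel. bump s (- x + y))"
      by (rule Bochner_Integration.integral_cong) (use bump_even[OF s(1), of "x - y" for y] in auto)
    also have "\<dots> = bump_mass" using LINT_translate[OF k, of "- x"] bump_mass[OF s(1)] by simp
    finally have m: "(LINT y|lborel. bump s (x - y)) = bump_mass" .
    have "conv (bump s) f x - bump_mass * f x = (LINT y|lborel. bump s (x - y) * f y - bump s (x - y) * f x)"
      using i i2 by (simp add: conv_def m)
    also have "\<bar>\<dots>\<bar> \<le> (12 / s\<^sup>2 * e) * (4 * s\<^sup>2)"
    proof (rule LINT_box_bound[where a = "fst x - s" and b = "snd x - s"])
      fix y
      show "\<bar>bump s (x - y) * f y - bump s (x - y) * f x\<bar> \<le> 12 / s\<^sup>2 * e"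
      proof (cases "bump s (x - y) = 0")
        case False
        from bump_supp[OF s(1) this] have "\<bar>fst x - fst y\<bar> \<le> s" "\<bar>snd x - snd y\<bar> \<le> s" by auto
        moreover have "dist y x \<le> \<bar>fst y - fst x\<bar> + \<bar>snd y - snd x\<bar>"
          unfolding dist_norm using norm_Pair_le[of "fst y - fst x" "snd y - snd x"]
          by (simp add: minus_prod_def)
        ultimately have "dist y x < d" using s by (simp add: abs_minus_commute)
        then have "\<bar>f y - f x\<bar> \<le> e" using d(2)[of y x] by simp
        then have "\<bar>bump s (x - y)\<bar> * \<bar>f y - f x\<bar> \<le> 12 / s\<^sup>2 * e"
          by (intro mult_mono bump_le[OF s(1)]) auto
        then show ?thesis by (simp add: abs_mult[symmetric] right_diff_distrib)
      qed (use assms(3) in simp)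
      show "y \<in> cbox (fst x - s, snd x - s) (fst x - s + 2 * s, snd x - s + 2 * s)"
        if "bump s (x - y) * f y - bump s (x - y) * f x \<noteq> 0"
        using that by (intro box) auto
    qed (use s i i2 in auto)
    also have "\<dots> = 48 * e" using s by (simp add: field_simps)
    finally show "\<bar>conv (bump s) f x - bump_mass * f x\<bar> \<le> 48 * e" .
  qed (use d in auto)
qed

text \<open>One dyadic layer of the truncated logarithm. The derivatives are moved from the fields
  onto the kernel, so only the sup norms of the fields enter. The gradient of the layer is at most
  \<open>6 / t + 12 / t\<close> on a square of area \<open>4 * t\<^sup>2\<close>; two components
  give \<open>2 * 18 * 4 = 144\<close>, and one power of \<open>t\<close> survives.\<close>

lemma conv_logker_diff_bound:
  assumes Q: "C1_on UNIV Q1" "C1_on UNIV Q2" "bounded (supp Q1)" "bounded (supp Q2)"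
    and M: "\<And>z. \<bar>Q1 z\<bar> \<le> M" "\<And>z. \<bar>Q2 z\<bar> \<le> M" and t: "0 < t"
  shows "\<bar>conv (\<lambda>z. logker t z - logker (t / 2) z) (\<lambda>z. D1 Q1 z + D2 Q2 z) x\<bar> \<le> 144 * M * t"
proof -
  let ?g = "\<lambda>z. logker t z - logker (t / 2) z"
  note g = C1_on_diff[OF C1_on_logker C1_on_logker, of t "t / 2"]
  have e: "D1 ?g z = D1 (logker t) z - D1 (logker (t/2)) z" "D2 ?g z = D2 (logker t) z - D2 (logker (t/2)) z" for z
    by (auto simp: D1_diff[OF C1_on_logker C1_on_logker] D2_diff[OF C1_on_logker C1_on_logker])
  have b: "\<bar>D1 ?g z\<bar> \<le> 18 / t" "\<bar>D2 ?g z\<bar> \<le> 18 / t" for z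
  proof -
    have "0 < t / 2" using t by simp
    note d = D_logker_bound[OF t, of z] D_logker_bound[OF this, of z]
    have "6 / t + 6 / (t / 2) = 18 / t" using t by (simp add: field_simps)
    moreover have "\<bar>D1 ?g z\<bar> \<le> 6 / t + 6 / (t / 2)"
      unfolding e by (rule order_trans[OF abs_triangle_ineq4 add_mono[OF d(1) d(3)]])
    moreover have "\<bar>D2 ?g z\<bar> \<le> 6 / t + 6 / (t / 2)"
      unfolding e by (rule order_trans[OF abs_triangle_ineq4 add_mono[OF d(2) d(4)]])
    ultimately show "\<bar>D1 ?g z\<bar> \<le> 18 / t" "\<bar>D2 ?g z\<bar> \<le> 18 / t" by simp_all
  qed
  have out: "D1 ?g z = 0 \<and> D2 ?g z = 0" if "\<not> (\<bar>fst z\<bar> \<le> t \<and> \<bar>snd z\<bar> \<le> t)" for z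
  proof -
    have "supp ?g \<subseteq> cbox (-t, -t) (t, t)"
    proof
      fix w assume "w \<in> supp ?g"
      then have "nsq w < t\<^sup>2" using logker_diff_outside[of "t / 2" t w] t by auto
      then show "w \<in> cbox (-t, -t) (t, t)"
        using nsq_ge[OF t, of w] by (cases w) (auto simp: cbox_Pair_eq)
    qed
    then have "closure (supp ?g) \<subseteq> cbox (-t, -t) (t, t)" by (rule closure_minimal) auto
    moreover have "z \<notin> cbox (-t, -t) (t, t)" using that by (cases z) (auto simp: cbox_Pair_eq abs_le_iff)
    ultimately have "z \<notin> closure (supp ?g)" by blast
    from D_eq_0_outside[OF this] show ?thesis by simp
  qed
  have "conv ?g (\<lambda>z. D1 Q1 z + D2 Q2 z) x = conv ?g (D1 Q1) x + conv ?g (D2 Q2) x"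
    by (rule conv_add_right[OF C1_onD(4)[OF g] C1_onD(2)[OF Q(1)] bounded_supp_D(1)[OF Q(3)]
      C1_onD(3)[OF Q(2)] bounded_supp_D(2)[OF Q(4)]])
  also have "\<dots> = conv (D1 ?g) Q1 x + conv (D2 ?g) Q2 x"
    by (simp add: conv_D_right[OF g Q(1,3)] conv_D_right[OF g Q(2,4)])
  also have "\<bar>\<dots>\<bar> \<le> 18 / t * M * (4 * t\<^sup>2) + 18 / t * M * (4 * t\<^sup>2)"
  proof (rule order_trans[OF abs_triangle_ineq], rule add_mono)
    show "\<bar>conv (D1 ?g) Q1 x\<bar> \<le> 18 / t * M * (4 * t\<^sup>2)"
      by (rule conv_bound[OF C1_onD(2)[OF g] C1_onD(4)[OF Q(1)] Q(3) b(1) _ less_imp_le[OF t] M(1)])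
        (use out in blast)
    show "\<bar>conv (D2 ?g) Q2 x\<bar> \<le> 18 / t * M * (4 * t\<^sup>2)"
      by (rule conv_bound[OF C1_onD(3)[OF g] C1_onD(4)[OF Q(2)] Q(4) b(2) _ less_imp_le[OF t] M(2)])
        (use out in blast)
  qed
  also have "\<dots> = 144 * M * t" using t by (simp add: field_simps power2_eq_square)
  finally show ?thesis .
qed

text \<open>Telescoping over the scales \<open>h / 2 ^ j\<close> produces a geometric series with
  sum at most \<open>2 * 144 * M * h\<close>. The bound is independent of \<open>J\<close>, which is
  what lets the inner scale tend to zero.\<close>

lemma conv_logker_bound:
  assumes Q: "C1_on UNIV Q1" "C1_on UNIV Q2" "bounded (supp Q1)" "bounded (supp Q2)"
    and M: "\<And>z. \<bar>Q1 z\<bar> \<le> M" "\<And>z. \<bar>Q2 z\<bar> \<le> M" and h: "0 < h"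
  shows "\<bar>conv (\<lambda>z. logker h z - logker (h / 2 ^ J) z) (\<lambda>z. D1 Q1 z + D2 Q2 z) x\<bar> \<le> 288 * M * h"
proof -
  let ?T = "\<lambda>z. D1 Q1 z + D2 Q2 z"
  have M0: "0 \<le> M" using M(1)[of 0] by linarith
  have T: "continuous_on UNIV ?T" "bounded (supp ?T)"
    by (intro continuous_on_add C1_onD(2,3) Q bounded_supp_add bounded_supp_D)+
  note k = C1_onD(4)[OF C1_on_diff[OF C1_on_logker C1_on_logker]]
  \<comment> \<open>The factor \<open>1 - 1 / 2 ^ J\<close> is the exact partial sum of the series
    and makes the induction close.\<close>
  have "\<bar>conv (\<lambda>z. logker h z - logker (h / 2 ^ J) z) ?T x\<bar> \<le> 288 * M * h * (1 - 1 / 2 ^ J)"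
  proof (induction J)
    case 0
    then show ?case by (simp add: conv_def)
  next
    case (Suc J)
    let ?t = "h / 2 ^ J"
    have "conv (\<lambda>z. logker h z - logker (h / 2 ^ Suc J) z) ?T x =
      conv (\<lambda>z. (logker h z - logker ?t z) + (logker ?t z - logker (?t / 2) z)) ?T x"
      by (simp add: field_simps)
    also have "\<dots> = conv (\<lambda>z. logker h z - logker ?t z) ?T x + conv (\<lambda>z. logker ?t z - logker (?t / 2) z) ?T x"
      by (rule conv_add_left(1)[OF k k T])
    also have "\<bar>\<dots>\<bar> \<le> 288 * M * h * (1 - 1 / 2 ^ J) + 144 * M * ?t"
      using Suc conv_logker_diff_bound[OF Q M, of ?t x] h by (intro order_trans[OF abs_triangle_ineq] add_mono) auto
    also have "\<dots> = 288 * M * h * (1 - 1 / 2 ^ Suc J)" by (simp add: field_simps)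
    finally show ?case .
  qed
  also have "\<dots> \<le> 288 * M * h * 1" using M0 h by (intro mult_left_mono) auto
  finally show ?thesis by simp
qed

lemma conv_cmult_right: "conv k (\<lambda>z. c * f z) x = c * conv k f x"
  unfolding conv_def mult.left_commute[of _ c] by (rule integral_mult_right_zero)

text \<open>The parts of the source are treated differently. Against \<open>b\<close> the even bump
  is moved onto \<open>w\<close>, and only the sup norm of \<open>w\<close> is spent. Against
  \<open>P1\<close> and \<open>P2\<close> a derivative goes onto \<open>w\<close>, and its gradient
  is left with the coefficient 1/4, small enough to be absorbed later.\<close>

lemma bump_div_pairing:
  assumes w: "C1_on UNIV w" "bounded (supp w)" and P: "C1_on UNIV P1" "C1_on UNIV P2" "bounded (supp P1)" "bounded (supp P2)"
    and b: "continuous_on UNIV b" "bounded (supp b)" and W: "\<And>z. \<bar>w z\<bar> \<le> W" and t: "0 < t"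
  shows "\<bar>LINT z|lborel. w z * conv (bump t) (\<lambda>z. D1 P1 z + D2 P2 z + b z) z\<bar>
    \<le> 48 * W * (LINT z|lborel. \<bar>b z\<bar>) + (1/4) * (LINT z|lborel. (D1 w z)\<^sup>2 + (D2 w z)\<^sup>2)
      + 2304 * (LINT z|lborel. (P1 z)\<^sup>2 + (P2 z)\<^sup>2)"
proof -
  let ?k = "bump t"
  note kC1 = C1_on_bump[of t] and kc = C1_onD(4)[OF C1_on_bump[of t]] and kb = bounded_supp_bump[OF t]
  note dP1 = C1_onD(2)[OF P(1)] bounded_supp_D(1)[OF P(3)] and dP2 = C1_onD(3)[OF P(2)] bounded_supp_D(2)[OF P(4)]
  have one: "\<bar>LINT z|lborel. g z * conv ?k p z\<bar> \<le> (1/4) * (LINT z|lborel. (g z)\<^sup>2) + 2304 * (LINT z|lborel. (p z)\<^sup>2)"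
    if g: "continuous_on UNIV g" "bounded (supp g)" and p: "continuous_on UNIV p" "bounded (supp p)" for g p
  proof -
    \<comment> \<open>The weight 96 unbalances the two squares: division by \<open>2 * 96\<close>
      gives the coefficients \<open>48 / 192 = 1/4\<close> and
      \<open>48 * 96\<^sup>2 / 192 = 2304\<close>.\<close>
    have p': "continuous_on UNIV (\<lambda>z. 96 * p z)" "bounded (supp (\<lambda>z. 96 * p z))"
      using p by (auto intro!: continuous_intros)
    have "2 * \<bar>LINT z|lborel. g z * conv ?k (\<lambda>z. 96 * p z) z\<bar>
      \<le> (LINT z|lborel. ?k z) * ((LINT z|lborel. (g z)\<^sup>2) + (LINT z|lborel. (96 * p z)\<^sup>2))"
      by (rule conv_pairing_bound[OF kc kb bump_even[OF t] bump_nonneg[OF t] p' g])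
    also have "\<dots> \<le> 48 * ((LINT z|lborel. (g z)\<^sup>2) + (LINT z|lborel. (96 * p z)\<^sup>2))"
      unfolding bump_mass[OF t] by (intro mult_right_mono bump_mass_bounds(2)) simp
    also have "(\<lambda>z. g z * conv ?k (\<lambda>z. 96 * p z) z) = (\<lambda>z. 96 * (g z * conv ?k p z))"
      by (simp add: conv_cmult_right fun_eq_iff)
    finally show ?thesis by (simp add: power_mult_distrib)
  qed
  have c1: "continuous_on UNIV (conv ?k (D1 P1))" "continuous_on UNIV (conv ?k (D2 P2))" "continuous_on UNIV (conv ?k b)"
    by (intro continuous_conv[OF kc] dP1 dP2 b)+
  note wc = C1_onD(4)[OF w(1)]
  have iw: "integrable lborel (\<lambda>z. w z * f z)" if "continuous_on UNIV f" for f
    by (rule integrable_Cc[OF continuous_on_mult[OF wc that] bounded_supp_mult(1)[OF w(2)]])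
  have s: "conv ?k (\<lambda>z. D1 P1 z + D2 P2 z + b z) z = conv ?k (D1 P1) z + conv ?k (D2 P2) z + conv ?k b z" for z
    using conv_add_right[OF kc continuous_on_add[OF dP1(1) dP2(1)] bounded_supp_add[OF dP1(2) dP2(2)] b]
      conv_add_right[OF kc dP1 dP2] by simp
  have "(LINT z|lborel. w z * conv ?k (\<lambda>z. D1 P1 z + D2 P2 z + b z) z) =
     (LINT z|lborel. w z * conv ?k (D1 P1) z) + (LINT z|lborel. w z * conv ?k (D2 P2) z) + (LINT z|lborel. w z * conv ?k b z)"
    unfolding s distrib_left
    using iw[OF c1(1)] iw[OF c1(2)] iw[OF c1(3)] by simp
  moreover have "\<bar>LINT z|lborel. w z * conv ?k b z\<bar> \<le> 48 * W * (LINT z|lborel. \<bar>b z\<bar>)"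
  proof -
    have W0: "0 \<le> W" using W[of 0] by linarith
    have "(LINT z|lborel. w z * conv ?k b z) = (LINT z|lborel. b z * conv ?k w z)"
      by (rule conv_swap[OF kc bump_even[OF t] b wc w(2)])
    also have "\<bar>\<dots>\<bar> \<le> (LINT z|lborel. \<bar>b z * conv ?k w z\<bar>)" by (rule integral_abs_bound)
    also have "\<dots> \<le> (LINT z|lborel. 48 * W * \<bar>b z\<bar>)"
    proof (rule integral_mono)
      have "\<bar>conv ?k w z\<bar> \<le> 12 / t\<^sup>2 * W * (4 * t\<^sup>2)" for z
        by (rule conv_bound[OF kc wc w(2) bump_le[OF t] bump_supp[OF t] less_imp_le[OF t] W])
      then have "\<bar>conv ?k w z\<bar> \<le> 48 * W" for z using t by (simp add: field_simps)
      then show "\<bar>b z * conv ?k w z\<bar> \<le> 48 * W * \<bar>b z\<bar>" for z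
        unfolding abs_mult by (simp add: mult.commute[of "\<bar>b z\<bar>"] mult_right_mono)
      show "integrable lborel (\<lambda>z. \<bar>b z * conv ?k w z\<bar>)"
        by (intro integrable_abs integrable_Cc continuous_on_mult b continuous_conv[OF kc wc w(2)] bounded_supp_mult(1))
      show "integrable lborel (\<lambda>z. 48 * W * \<bar>b z\<bar>)"
        by (intro integrable_mult_right integrable_abs integrable_Cc b)
    qed
    finally show ?thesis by simp
  qed
  moreover have "\<bar>LINT z|lborel. w z * conv ?k (D1 P1) z\<bar>
    \<le> (1/4) * (LINT z|lborel. (D1 w z)\<^sup>2) + 2304 * (LINT z|lborel. (P1 z)\<^sup>2)"
  proof -
    note pc = C1_onD(4)[OF P(1)]
    have "conv ?k (D1 P1) = D1 (conv ?k P1)"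
      by (simp add: conv_D_right(1)[OF kC1 P(1,3)] D1_conv[OF kC1 pc P(3)])
    then have "(LINT z|lborel. w z * conv ?k (D1 P1) z) = - (LINT z|lborel. D1 w z * conv ?k P1 z)"
      using integration_by_parts(1)[OF w(1) C1_on_conv[OF kC1 pc P(3)] disjI1[OF w(2)]] by simp
    then show ?thesis using one[OF C1_onD(2)[OF w(1)] bounded_supp_D(1)[OF w(2)] pc P(3)] by simp
  qed
  moreover have "\<bar>LINT z|lborel. w z * conv ?k (D2 P2) z\<bar>
    \<le> (1/4) * (LINT z|lborel. (D2 w z)\<^sup>2) + 2304 * (LINT z|lborel. (P2 z)\<^sup>2)"
  proof -
    note pc = C1_onD(4)[OF P(2)]
    have "conv ?k (D2 P2) = D2 (conv ?k P2)"
      by (simp add: conv_D_right(2)[OF kC1 P(2,4)] D2_conv[OF kC1 pc P(4)])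
    then have "(LINT z|lborel. w z * conv ?k (D2 P2) z) = - (LINT z|lborel. D2 w z * conv ?k P2 z)"
      using integration_by_parts(2)[OF w(1) C1_on_conv[OF kC1 pc P(4)] disjI1[OF w(2)]] by simp
    then show ?thesis using one[OF C1_onD(3)[OF w(1)] bounded_supp_D(2)[OF w(2)] pc P(4)] by simp
  qed
  moreover have sq: "integrable lborel (\<lambda>z. (f z)\<^sup>2)" if "continuous_on UNIV f" "bounded (supp f)" for f :: "point \<Rightarrow> real"
    unfolding power2_eq_square by (intro integrable_Cc continuous_on_mult bounded_supp_mult(1) that)
  have "(LINT z|lborel. (D1 w z)\<^sup>2 + (D2 w z)\<^sup>2) = (LINT z|lborel. (D1 w z)\<^sup>2) + (LINT z|lborel. (D2 w z)\<^sup>2)"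
    by (rule Bochner_Integration.integral_add[OF sq[OF C1_onD(2)[OF w(1)] bounded_supp_D(1)[OF w(2)]]
      sq[OF C1_onD(3)[OF w(1)] bounded_supp_D(2)[OF w(2)]]])
  moreover have "(LINT z|lborel. (P1 z)\<^sup>2 + (P2 z)\<^sup>2) = (LINT z|lborel. (P1 z)\<^sup>2) + (LINT z|lborel. (P2 z)\<^sup>2)"
    by (rule Bochner_Integration.integral_add[OF sq[OF C1_onD(4)[OF P(1)] P(3)] sq[OF C1_onD(4)[OF P(2)] P(4)]])
  ultimately show ?thesis by (simp add: distrib_left)
qed

text \<open>The left-hand side pairs \<open>\<phi>\<close> with the Laplacian of \<open>w = conv (logker h - logker s) (div Q)\<close>, \<open>s \<rightarrow> 0\<close>.
  Since \<open>w\<close> is small in the supremum norm, its energy is controlled by the \<open>L\<^sup>1\<close> norm of \<open>b\<close>.\<close>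
lemma divergence_mollification_bound:
  assumes Q: "C1_on UNIV Q1" "C1_on UNIV Q2" "bounded (supp Q1)" "bounded (supp Q2)"
    and P: "C1_on UNIV P1" "C1_on UNIV P2" "bounded (supp P1)" "bounded (supp P2)"
    and b: "continuous_on UNIV b" "bounded (supp b)"
    and div: "\<And>z. D1 Q1 z + D2 Q2 z = D1 P1 z + D2 P2 z + b z"
    and M: "\<And>z. \<bar>Q1 z\<bar> \<le> M" "\<And>z. \<bar>Q2 z\<bar> \<le> M" and h: "0 < h"
    and \<phi>: "C1_on UNIV \<phi>" "bounded (supp \<phi>)"
  shows "\<bar>bump_mass * (LINT z|lborel. (D1 Q1 z + D2 Q2 z) * \<phi> z)
      - (LINT z|lborel. conv (bump h) (\<lambda>z. D1 Q1 z + D2 Q2 z) z * \<phi> z)\<bar>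
    \<le> sqrt (55296 * M * h * (LINT z|lborel. \<bar>b z\<bar>) + 9216 * (LINT z|lborel. (P1 z)\<^sup>2 + (P2 z)\<^sup>2))
      * sqrt (LINT z|lborel. (D1 \<phi> z)\<^sup>2 + (D2 \<phi> z)\<^sup>2)"
    (is "\<bar>bump_mass * ?I - ?Ih\<bar> \<le> ?R")
proof -
  define T where "T = (\<lambda>z. D1 Q1 z + D2 Q2 z)"
  have T: "continuous_on UNIV T" "bounded (supp T)"
    unfolding T_def by (intro continuous_on_add C1_onD(2,3) Q bounded_supp_add bounded_supp_D)+
  have kc: "continuous_on UNIV (bump t)" for t by (rule C1_onD(4)[OF C1_on_bump])
  note \<phi>c = C1_onD(4)[OF \<phi>(1)]
  have i\<phi>: "integrable lborel (\<lambda>z. f z * \<phi> z)" if "continuous_on UNIV f" for f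
    by (rule integrable_Cc[OF continuous_on_mult[OF that \<phi>c] bounded_supp_mult(2)[OF \<phi>(2)]])
  \<comment> \<open>The scale \<open>s\<close> has the form \<open>h / 2 ^ J\<close> so that the
    dyadic bound on the potential applies. Letting \<open>s\<close> tend to zero then replaces the
    finer mollification by \<open>bump_mass\<close> times the divergence itself.\<close>
  have main: "\<bar>(LINT z|lborel. conv (bump s) T z * \<phi> z) - (LINT z|lborel. conv (bump h) T z * \<phi> z)\<bar> \<le> ?R"
    if s: "s = h / 2 ^ J" for s J
  proof -
    have s0: "0 < s" "s \<le> h"
      using h mult_left_mono[of 1 "2 ^ J" h] by (simp_all add: s divide_le_eq)
    let ?G = "\<lambda>z. logker h z - logker s z"
    have G: "C1_on UNIV ?G" by (rule C1_on_diff[OF C1_on_logker C1_on_logker])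
    have e: "D1 ?G = (\<lambda>z. D1 (logker h) z - D1 (logker s) z)" "D2 ?G = (\<lambda>z. D2 (logker h) z - D2 (logker s) z)"
      by (auto simp: fun_eq_iff D1_diff[OF C1_on_logker C1_on_logker] D2_diff[OF C1_on_logker C1_on_logker])
    have G2: "C1_on UNIV (D1 ?G)" "C1_on UNIV (D2 ?G)"
      unfolding e by (rule C1_on_diff[OF C1_on_D1_logker C1_on_D1_logker] C1_on_diff[OF C1_on_D2_logker C1_on_D2_logker])+
    have Lap: "D1 (D1 ?G) z + D2 (D2 ?G) z = bump h z - bump s z" for z
      using laplacian_logker[of h z] laplacian_logker[of s z] h s0
      by (simp add: e D1_diff[OF C1_on_D1_logker C1_on_D1_logker] D2_diff[OF C1_on_D2_logker C1_on_D2_logker])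
    define w where "w = conv ?G T"
    have w: "C1_on UNIV w" "D1 w = conv (D1 ?G) T" "D2 w = conv (D2 ?G) T"
      unfolding w_def by (rule C1_on_conv[OF G T] D1_conv[OF G T] D2_conv[OF G T])+
    have wb: "bounded (supp w)"
      unfolding w_def by (rule bounded_supp_conv[OF bounded_supp_logker_diff[OF s0] T(2)])
    have w2: "C1_on UNIV (D1 w)" "C1_on UNIV (D2 w)"
      unfolding w by (rule C1_on_conv[OF G2(1) T] C1_on_conv[OF G2(2) T])+
    have Lw: "D1 (D1 w) z + D2 (D2 w) z = conv (bump h) T z - conv (bump s) T z" for z
    proof -
      have "D1 (D1 w) z + D2 (D2 w) z = conv (D1 (D1 ?G)) T z + conv (D2 (D2 ?G)) T z"
        by (simp add: w(2,3) D1_conv[OF G2(1) T] D2_conv[OF G2(2) T])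
      also have "\<dots> = conv (\<lambda>z. D1 (D1 ?G) z + D2 (D2 ?G) z) T z"
        by (rule conv_add_left(1)[OF C1_onD(2)[OF G2(1)] C1_onD(3)[OF G2(2)] T, symmetric])
      also have "\<dots> = conv (bump h) T z - conv (bump s) T z"
        unfolding Lap by (rule conv_add_left(2)[OF kc kc T])
      finally show ?thesis .
    qed
    have W: "\<bar>w z\<bar> \<le> 288 * M * h" for z
      unfolding w_def T_def s by (rule conv_logker_bound[OF Q M h])
    have Teq: "T = (\<lambda>z. D1 P1 z + D2 P2 z + b z)" by (simp add: T_def div)
    let ?X = "LINT z|lborel. (D1 w z)\<^sup>2 + (D2 w z)\<^sup>2"
    \<comment> \<open>Green's formula for \<open>w\<close>, whose Laplacian is the difference of the
      two mollifications. It serves twice: with \<open>g = w\<close> for the energy, and with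
      \<open>g = \<phi>\<close> for the quantity to be bounded.\<close>
    have ibp: "(LINT z|lborel. D1 w z * D1 g z + D2 w z * D2 g z)
      = (LINT z|lborel. conv (bump s) T z * g z) - (LINT z|lborel. conv (bump h) T z * g z)"
      if g: "C1_on UNIV g" "bounded (supp g)" for g
    proof -
      have ig: "integrable lborel (\<lambda>z. f z * g z)" if "continuous_on UNIV f" for f
        by (rule integrable_Cc[OF continuous_on_mult[OF that C1_onD(4)[OF g(1)]] bounded_supp_mult(2)[OF g(2)]])
      have i1: "integrable lborel (\<lambda>z. D1 w z * D1 g z)" "integrable lborel (\<lambda>z. D2 w z * D2 g z)"
        by (rule integrable_Cc[OF continuous_on_mult[OF C1_onD(2)[OF w(1)] C1_onD(2)[OF g(1)]] bounded_supp_mult(1)[OF bounded_supp_D(1)[OF wb]]]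
          integrable_Cc[OF continuous_on_mult[OF C1_onD(3)[OF w(1)] C1_onD(3)[OF g(1)]] bounded_supp_mult(1)[OF bounded_supp_D(2)[OF wb]]])+
      have "(LINT z|lborel. D1 w z * D1 g z + D2 w z * D2 g z)
        = - (LINT z|lborel. D1 (D1 w) z * g z) - (LINT z|lborel. D2 (D2 w) z * g z)"
        using integration_by_parts(1)[OF w2(1) g(1) disjI2[OF g(2)]] integration_by_parts(2)[OF w2(2) g(1) disjI2[OF g(2)]] i1
        by simp
      also have "\<dots> = - (LINT z|lborel. D1 (D1 w) z * g z + D2 (D2 w) z * g z)"
        using ig[OF C1_onD(2)[OF w2(1)]] ig[OF C1_onD(3)[OF w2(2)]] by simp
      also have "\<dots> = - (LINT z|lborel. conv (bump h) T z * g z - conv (bump s) T z * g z)"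
        unfolding distrib_right[symmetric] Lw left_diff_distrib ..
      also have "\<dots> = (LINT z|lborel. conv (bump s) T z * g z) - (LINT z|lborel. conv (bump h) T z * g z)"
        using ig[OF continuous_conv[OF kc T]] by simp
      finally show ?thesis .
    qed
    have X1: "?X = (LINT z|lborel. conv (bump s) T z * w z) - (LINT z|lborel. conv (bump h) T z * w z)"
      using ibp[OF w(1) wb] by (simp add: power2_eq_square)
    have X2: "\<bar>LINT z|lborel. conv (bump t) T z * w z\<bar> \<le> 48 * (288 * M * h) * (LINT z|lborel. \<bar>b z\<bar>)
      + (1/4) * ?X + 2304 * (LINT z|lborel. (P1 z)\<^sup>2 + (P2 z)\<^sup>2)" if "0 < t" for t
      using bump_div_pairing[OF w(1) wb P b W that] unfolding Teq[symmetric] by (simp add: mult.commute)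
    \<comment> \<open>\<open>?X\<close> is a difference of two pairings with \<open>w\<close>, each
      at most \<open>?X / 4\<close> plus data. Half of \<open>?X\<close> is absorbed, and the data
      appear with the factor 4: \<open>4 * 13824 = 55296\<close> and
      \<open>4 * 2304 = 9216\<close>.\<close>
    have X: "?X \<le> 55296 * M * h * (LINT z|lborel. \<bar>b z\<bar>) + 9216 * (LINT z|lborel. (P1 z)\<^sup>2 + (P2 z)\<^sup>2)"
    proof -
      let ?b = "M * h * (LINT z|lborel. \<bar>b z\<bar>)"
      have "48 * (288 * M * h) * (LINT z|lborel. \<bar>b z\<bar>) = 13824 * ?b"
        "55296 * M * h * (LINT z|lborel. \<bar>b z\<bar>) = 55296 * ?b" by simp_all
      then show ?thesis using X1 X2[OF s0(1)] X2[OF h] by linarith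
    qed
    have "\<bar>(LINT z|lborel. conv (bump s) T z * \<phi> z) - (LINT z|lborel. conv (bump h) T z * \<phi> z)\<bar>
      = \<bar>LINT z|lborel. D1 w z * D1 \<phi> z + D2 w z * D2 \<phi> z\<bar>" by (simp only: ibp[OF \<phi>])
    also have "\<dots> \<le> sqrt ?X * sqrt (LINT z|lborel. (D1 \<phi> z)\<^sup>2 + (D2 \<phi> z)\<^sup>2)"
      by (rule Cauchy_Schwarz_pair[OF C1_onD(2,3)[OF w(1)] C1_onD(2,3)[OF \<phi>(1)] bounded_supp_D[OF wb] bounded_supp_D[OF \<phi>(2)]])
    also have "\<dots> \<le> ?R"
      using X by (intro mult_right_mono) auto
    finally show ?thesis .
  qed
  have "\<bar>bump_mass * ?I - ?Ih\<bar> \<le> ?R + e" if e: "e > 0" for e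
  proof -
    let ?A = "LINT z|lborel. \<bar>\<phi> z\<bar>"
    have ia: "integrable lborel (\<lambda>z. \<bar>\<phi> z\<bar>)" by (intro integrable_abs integrable_Cc \<phi>c \<phi>)
    have A0: "0 \<le> ?A" by simp
    \<comment> \<open>The added 1 keeps the denominator positive when \<open>\<phi>\<close>
      vanishes, and 48 cancels the constant of the approximate identity.\<close>
    define e' where "e' = e / (?A + 1) / 48"
    have A1: "0 < ?A + 1" using A0 by linarith
    have e'0: "e' > 0" unfolding e'_def by (intro divide_pos_pos e A1) simp
    obtain d where d: "d > 0" "\<And>s x. 0 < s \<Longrightarrow> s < d \<Longrightarrow> \<bar>conv (bump s) T x - bump_mass * T x\<bar> \<le> 48 * e'"
      using conv_bump_approx[OF T e'0] by metis
    obtain J where J: "h / 2 ^ J < d"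
    proof -
      obtain J where "(1/2) ^ J < d / h" using real_arch_pow_inv[of "d / h" "1/2"] d(1) h by auto
      then show ?thesis using h that[of J] by (simp add: field_simps power_divide)
    qed
    define s where "s = h / 2 ^ J"
    have s0: "0 < s" "s < d" using h J by (auto simp: s_def)
    have "\<bar>bump_mass * ?I - (LINT z|lborel. conv (bump s) T z * \<phi> z)\<bar>
      = \<bar>LINT z|lborel. bump_mass * (T z * \<phi> z) - conv (bump s) T z * \<phi> z\<bar>"
      using i\<phi>[OF T(1)] i\<phi>[OF continuous_conv[OF kc T, of s]] by (simp add: T_def)
    also have "\<dots> \<le> (LINT z|lborel. \<bar>bump_mass * (T z * \<phi> z) - conv (bump s) T z * \<phi> z\<bar>)"
      by (rule integral_abs_bound)
    also have "\<dots> \<le> (LINT z|lborel. 48 * e' * \<bar>\<phi> z\<bar>)"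
    proof (rule integral_mono)
      show "integrable lborel (\<lambda>z. \<bar>bump_mass * (T z * \<phi> z) - conv (bump s) T z * \<phi> z\<bar>)"
        using i\<phi>[OF T(1)] i\<phi>[OF continuous_conv[OF kc T, of s]] by simp
      show "integrable lborel (\<lambda>z. 48 * e' * \<bar>\<phi> z\<bar>)" using ia by simp
      fix z
      have "bump_mass * (T z * \<phi> z) - conv (bump s) T z * \<phi> z = (bump_mass * T z - conv (bump s) T z) * \<phi> z"
        by (simp add: algebra_simps)
      then show "\<bar>bump_mass * (T z * \<phi> z) - conv (bump s) T z * \<phi> z\<bar> \<le> 48 * e' * \<bar>\<phi> z\<bar>"
        using d(2)[OF s0, of z] by (simp add: abs_mult abs_minus_commute mult_right_mono)
    qed
    also have "\<dots> = e * (?A / (?A + 1))"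
    proof -
      have c: "48 * (x / 48) = x" for x :: real by simp
      have e48: "48 * e' = e / (?A + 1)" unfolding e'_def by (rule c)
      have "(LINT z|lborel. 48 * e' * \<bar>\<phi> z\<bar>) = 48 * e' * ?A" by (rule integral_mult_right_zero)
      also have "\<dots> = e * (?A / (?A + 1))" unfolding e48 by (simp only: times_divide_eq_left times_divide_eq_right)
      finally show ?thesis .
    qed
    also have "\<dots> \<le> e * 1"
    proof (rule mult_left_mono)
      show "?A / (?A + 1) \<le> 1" using A1 by (subst divide_le_eq_1_pos) linarith+
    qed (use e in simp)
    finally show ?thesis using main[OF s_def] by (simp add: T_def[symmetric])
  qed
  then show ?thesis by (rule field_le_epsilon)
qed

section \<open>The local negative Sobolev space\<close>

lemma C_on_continuous: "C_on k \<Omega> f \<Longrightarrow> continuous_on \<Omega> f"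
  by (cases k; clarsimp)

lemma C_upto_lincomb:
  assumes "C_on k UNIV \<phi>" "C_on k UNIV \<psi>"
  shows "C_on k UNIV (\<lambda>z. a * \<phi> z + b * \<psi> z)"
  using assms
proof (induction k arbitrary: \<phi> \<psi>)
  case 0
  then have "continuous_on UNIV \<phi>" "continuous_on UNIV \<psi>" using C_on_continuous by blast+
  then have "continuous_on UNIV (\<lambda>z. a * \<phi> z + b * \<psi> z)" by (intro continuous_intros)
  then show ?case by auto
next
  case (Suc k)
  note c = C1_on_C_upto[OF Suc.prems(1) open_UNIV] C1_on_C_upto[OF Suc.prems(2) open_UNIV]
  note l = C1_on_cmult[OF c(1), of a] C1_on_cmult[OF c(2), of b]
  have "D1 (\<lambda>z. a * \<phi> z + b * \<psi> z) = (\<lambda>z. a * D1 \<phi> z + b * D1 \<psi> z)"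
    "D2 (\<lambda>z. a * \<phi> z + b * \<psi> z) = (\<lambda>z. a * D2 \<phi> z + b * D2 \<psi> z)"
    using D1_add[OF l] D2_add[OF l] D1_cmult[OF c(1)] D1_cmult[OF c(2)] D2_cmult[OF c(1)] D2_cmult[OF c(2)]
    by auto
  moreover have "continuous_on UNIV (\<lambda>z. a * \<phi> z + b * \<psi> z)"
    by (rule C1_onD(4)[OF C1_on_add[OF l]])
  moreover have "(\<lambda>z. a * \<phi> z + b * \<psi> z) differentiable_on UNIV"
    using C1_onD(1)[OF C1_on_add[OF l]] unfolding differentiable_on_def differentiable_def by blast
  moreover have "C_on k UNIV (D1 \<phi>)" "C_on k UNIV (D2 \<phi>)" "C_on k UNIV (D1 \<psi>)" "C_on k UNIV (D2 \<psi>)"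
    using Suc.prems by auto
  ultimately show ?case using Suc.IH by auto
qed

lemma test_functionsD:
  assumes "\<phi> \<in> test_functions \<Omega>"
  shows "C1_on UNIV \<phi>" "bounded (supp \<phi>)" "closure (supp \<phi>) \<subseteq> \<Omega>" "compact (closure (supp \<phi>))"
proof -
  have "C_on (Suc 0) UNIV \<phi>" using assms unfolding test_functions_def by blast
  then show "C1_on UNIV \<phi>" by (rule C1_on_C_upto) auto
  show "closure (supp \<phi>) \<subseteq> \<Omega>" "compact (closure (supp \<phi>))"
    using assms unfolding test_functions_def by auto
  then show "bounded (supp \<phi>)"
    using bounded_subset[OF compact_imp_bounded closure_subset] by blast
qed

lemma test_functions_mono: "U \<subseteq> V \<Longrightarrow> test_functions U \<subseteq> test_functions V"
  unfolding test_functions_def by blast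

lemma test_functions_lincomb:
  assumes "\<phi> \<in> test_functions \<Omega>" "\<psi> \<in> test_functions \<Omega>"
  shows "(\<lambda>z. a * \<phi> z + b * \<psi> z) \<in> test_functions \<Omega>"
proof -
  let ?f = "\<lambda>z. a * \<phi> z + b * \<psi> z"
  have sub: "supp ?f \<subseteq> supp \<phi> \<union> supp \<psi>" by auto
  have "bounded (supp \<phi> \<union> supp \<psi>)" using test_functionsD(2)[OF assms(1)] test_functionsD(2)[OF assms(2)] by simp
  then have "compact (closure (supp ?f))" using bounded_subset[OF _ sub] by simp
  moreover have "closure (supp ?f) \<subseteq> \<Omega>"
    using closure_mono[OF sub] test_functionsD(3)[OF assms(1)] test_functionsD(3)[OF assms(2)]
    unfolding closure_Un by (meson Un_least order_trans)
  moreover have "C_on k UNIV ?f" for k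
    using assms C_upto_lincomb unfolding test_functions_def by blast
  ultimately show ?thesis unfolding test_functions_def by blast
qed

lemma zero_in_test_functions: "(\<lambda>z. 0) \<in> test_functions \<Omega>"
proof -
  have "C_on k UNIV (\<lambda>z. 0)" for k
  proof (induction k)
    case (Suc k)
    have "D1 (\<lambda>z. 0) = (\<lambda>z. 0)" "D2 (\<lambda>z. 0) = (\<lambda>z. 0)" by (auto simp: fun_eq_iff)
    then show ?case using Suc by (auto intro: continuous_on_const)
  qed (auto intro: continuous_on_const)
  then show ?thesis by (auto simp: test_functions_def)
qed

lemma H1_norm_zero: "H1_norm (\<lambda>z. 0) = 0"
  by (simp add: H1_norm_def)

lemma H1_norm_le_1D:
  assumes "C1_on UNIV \<phi>" "bounded (supp \<phi>)" "H1_norm \<phi> \<le> 1"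
  shows "(LINT z|lborel. (\<phi> z)\<^sup>2) \<le> 1" "(LINT z|lborel. (D1 \<phi> z)\<^sup>2 + (D2 \<phi> z)\<^sup>2) \<le> 1"
proof -
  have sq: "integrable lborel (\<lambda>z. (f z)\<^sup>2)" if "continuous_on UNIV f" "bounded (supp f)" for f :: "point \<Rightarrow> real"
    unfolding power2_eq_square by (intro integrable_Cc continuous_on_mult bounded_supp_mult(1) that)
  note i = sq[OF C1_onD(4)[OF assms(1)] assms(2)] sq[OF C1_onD(2)[OF assms(1)] bounded_supp_D(1)[OF assms(2)]]
    sq[OF C1_onD(3)[OF assms(1)] bounded_supp_D(2)[OF assms(2)]]
  have "(LINT z|lborel. (\<phi> z)\<^sup>2 + (D1 \<phi> z)\<^sup>2 + (D2 \<phi> z)\<^sup>2) \<le> 1"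
    using assms(3) by (simp add: H1_norm_def)
  then have "(LINT z|lborel. (\<phi> z)\<^sup>2) + (LINT z|lborel. (D1 \<phi> z)\<^sup>2) + (LINT z|lborel. (D2 \<phi> z)\<^sup>2) \<le> 1"
    using i by simp
  moreover have "(LINT z|lborel. (D1 \<phi> z)\<^sup>2 + (D2 \<phi> z)\<^sup>2) = (LINT z|lborel. (D1 \<phi> z)\<^sup>2) + (LINT z|lborel. (D2 \<phi> z)\<^sup>2)"
    using i by simp
  moreover have "0 \<le> (LINT z|lborel. (\<phi> z)\<^sup>2)" "0 \<le> (LINT z|lborel. (D1 \<phi> z)\<^sup>2)" "0 \<le> (LINT z|lborel. (D2 \<phi> z)\<^sup>2)"
    by simp_all
  ultimately show "(LINT z|lborel. (\<phi> z)\<^sup>2) \<le> 1" "(LINT z|lborel. (D1 \<phi> z)\<^sup>2 + (D2 \<phi> z)\<^sup>2) \<le> 1"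
    by linarith+
qed

section \<open>Unit balls of test functions and the dual seminorms\<close>

abbreviation unit_tests :: "point set \<Rightarrow> (point \<Rightarrow> real) set" where
  "unit_tests U \<equiv> {\<phi> \<in> test_functions U. H1_norm \<phi> \<le> 1}"

lemma zero_in_unit_tests: "(\<lambda>z. 0) \<in> unit_tests U"
  by (simp add: zero_in_test_functions H1_norm_zero)

lemma Hm1_values_eq: "Hm1_values U T = (\<lambda>\<phi>. \<bar>T \<phi>\<bar>) ` unit_tests U"
  by (auto simp: Hm1_values_def)

lemma Hm1_norm_le:
  assumes "\<And>\<phi>. \<phi> \<in> unit_tests U \<Longrightarrow> \<bar>T \<phi>\<bar> \<le> r"
  shows "Hm1_norm U T \<le> r"
  unfolding Hm1_norm_def Hm1_values_eq
  by (rule cSup_least) (use assms zero_in_unit_tests in blast)+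

text \<open>A real supremum dominates the values only once they are known to be bounded, so
  boundedness is carried along as a hypothesis. The opposite estimate asks for a nonempty set of
  values instead, and the zero test function supplies an element.\<close>

lemma Hm1_norm_ge:
  assumes "bdd_above (Hm1_values U T)" "\<phi> \<in> unit_tests U"
  shows "\<bar>T \<phi>\<bar> \<le> Hm1_norm U T"
  unfolding Hm1_norm_def by (rule cSup_upper[OF _ assms(1)]) (use assms(2) Hm1_values_eq in auto)

lemma bdd_above_Hm1_valuesI:
  assumes "\<And>\<phi>. \<phi> \<in> unit_tests U \<Longrightarrow> \<bar>T \<phi>\<bar> \<le> r"
  shows "bdd_above (Hm1_values U T)"
  unfolding Hm1_values_eq using assms by (intro bdd_aboveI2) blast

lemma bdd_above_Hm1_values_diff:
  assumes "bdd_above (Hm1_values U S)" "bdd_above (Hm1_values U T)"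
  shows "bdd_above (Hm1_values U (\<lambda>\<phi>. S \<phi> - T \<phi>))"
proof (rule bdd_above_Hm1_valuesI)
  fix \<phi> assume "\<phi> \<in> unit_tests U"
  from Hm1_norm_ge[OF assms(1) this] Hm1_norm_ge[OF assms(2) this]
  show "\<bar>S \<phi> - T \<phi>\<bar> \<le> Hm1_norm U S + Hm1_norm U T" by linarith
qed

lemma Hm1_locD:
  assumes "T \<in> Hm1_loc \<Omega>"
  shows "compactly_inside U \<Omega> \<Longrightarrow> bdd_above (Hm1_values U T)"
    and "\<phi> \<in> test_functions \<Omega> \<Longrightarrow> \<psi> \<in> test_functions \<Omega> \<Longrightarrow>
      T (\<lambda>z. a * \<phi> z + b * \<psi> z) = a * T \<phi> + b * T \<psi>"
    and "T \<in> extensional (test_functions \<Omega>)"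
  using assms by (simp_all add: Hm1_loc_def)

text \<open>On the pointwise closure of a sequence that is totally bounded in each seminorm, the topology of
  \<open>H\<^sup>-\<^sup>1\<^sub>l\<^sub>o\<^sub>c\<close> coincides with the compact topology of pointwise convergence.\<close>
lemma compactin_Hm1_loc_closure:
  fixes T :: "nat \<Rightarrow> (point \<Rightarrow> real) \<Rightarrow> real"
  assumes T: "\<And>n. T n \<in> Hm1_loc \<Omega>"
    and bdd: "\<And>\<phi>. \<phi> \<in> test_functions \<Omega> \<Longrightarrow> \<exists>N. \<forall>n. \<bar>T n \<phi>\<bar> \<le> N"
    and tb: "\<And>U r. compactly_inside U \<Omega> \<Longrightarrow> 0 < r \<Longrightarrow>
      \<exists>I. finite I \<and> (\<forall>n. \<exists>m\<in>I. \<forall>\<phi>\<in>unit_tests U. \<bar>T n \<phi> - T m \<phi>\<bar> \<le> r)"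
  shows "\<exists>K. compactin (Hm1_loc_topology \<Omega>) K \<and> (\<forall>n. T n \<in> K)"
proof -
  let ?V = "test_functions \<Omega>"
  define X where "X = product_topology (\<lambda>_. euclideanreal) ?V"
  obtain N where N: "\<And>\<phi> n. \<phi> \<in> ?V \<Longrightarrow> \<bar>T n \<phi>\<bar> \<le> N \<phi>" using bdd by metis
  have topX: "topspace X = extensional ?V" by (simp add: X_def PiE_def)
  have TX: "T n \<in> topspace X" for n unfolding topX by (rule Hm1_locD(3)[OF T])
  \<comment> \<open>Pointwise bounds place the whole sequence in a product of compact intervals,
    compact by Tychonoff's theorem.\<close>
  define P where "P = (\<Pi>\<^sub>E \<phi>\<in>?V. {- N \<phi> .. N \<phi>})"
  have compP: "compactin X P" unfolding X_def P_def compactin_PiE by simp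
  have "Hausdorff_space X" by (simp add: X_def Hausdorff_space_product_topology)
  then have closedP: "closedin X P" using compP compactin_imp_closedin by blast
  define K where "K = X closure_of (range T)"
  have KP: "K \<subseteq> P"
    unfolding K_def
  proof (rule closure_of_minimal[OF _ closedP])
    have "T n \<in> P" for n
      using TX[of n] N[of _ n] unfolding P_def topX PiE_def Pi_def by (simp add: abs_le_iff) (metis minus_le_iff)
    then show "range T \<subseteq> P" by blast
  qed
  have compK: "compactin X K" by (rule closed_compactin[OF compP KP]) (simp add: K_def)
  have TK: "T n \<in> K" for n
    unfolding K_def using closure_of_subset[of "range T" X] TX by blast
  have evalc: "continuous_map X euclideanreal (\<lambda>S. S \<phi>)" if "\<phi> \<in> ?V" for \<phi>
    unfolding X_def by (rule continuous_map_product_projection[OF that])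
  have approx: "\<exists>n. \<forall>\<phi>\<in>F. \<bar>T n \<phi> - S \<phi>\<bar> < e" if S: "S \<in> K" and F: "finite F" "F \<subseteq> ?V" and e: "e > 0" for S F e
  proof -
    let ?W = "topspace X \<inter> (\<Inter>\<phi>\<in>F. {R \<in> topspace X. R \<phi> \<in> ball (S \<phi>) e})"
    have "openin X ?W"
    proof (cases "F = {}")
      case False
      have "openin X {R \<in> topspace X. R \<phi> \<in> ball (S \<phi>) e}" if "\<phi> \<in> F" for \<phi>
        by (rule openin_continuous_map_preimage[OF evalc]) (use that F in auto)
      then show ?thesis using F False by (intro openin_Int openin_Inter) auto
    qed simp
    moreover have "S \<in> ?W" using S e unfolding K_def in_closure_of by auto
    ultimately obtain n where "T n \<in> ?W" using S unfolding K_def in_closure_of by blast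
    then show ?thesis by (intro exI[of _ n]) (auto simp: dist_real_def abs_minus_commute)
  qed
  \<comment> \<open>Total boundedness passes to the pointwise closure. If \<open>S\<close> were
    farther than \<open>r\<close> from every member of the finite net, finitely many test functions
    would witness it, and some \<open>T n\<close> close to \<open>S\<close> on just these would
    violate the net property.\<close>
  have near: "\<exists>I. finite I \<and> (\<forall>S\<in>K. \<exists>m\<in>I. \<forall>\<phi>\<in>unit_tests U. \<bar>S \<phi> - T m \<phi>\<bar> \<le> r)"
    if U: "compactly_inside U \<Omega>" and r: "0 < r" for U r
  proof -
    have UV: "unit_tests U \<subseteq> ?V"
      using U closure_subset test_functions_mono unfolding compactly_inside_def by blast
    obtain I where I: "finite I" "\<And>n. \<exists>m\<in>I. \<forall>\<phi>\<in>unit_tests U. \<bar>T n \<phi> - T m \<phi>\<bar> \<le> r" using tb[OF U r] by blast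
    have "\<exists>m\<in>I. \<forall>\<phi>\<in>unit_tests U. \<bar>S \<phi> - T m \<phi>\<bar> \<le> r" if S: "S \<in> K" for S
    proof (rule ccontr)
      assume "\<not> ?thesis"
      then have "\<forall>m\<in>I. \<exists>\<phi>. \<phi> \<in> unit_tests U \<and> \<bar>S \<phi> - T m \<phi>\<bar> > r" by (meson not_le)
      then obtain f where f: "\<And>m. m \<in> I \<Longrightarrow> f m \<in> unit_tests U" "\<And>m. m \<in> I \<Longrightarrow> \<bar>S (f m) - T m (f m)\<bar> > r"
        by metis
      have I0: "I \<noteq> {}" using I(2) by blast
      \<comment> \<open>The smallest excess over \<open>r\<close> among the finitely many witnesses;
        agreement of \<open>T n\<close> and \<open>S\<close> to within \<open>e\<close> there is
        enough for the contradiction.\<close>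
      define e where "e = Min ((\<lambda>m. \<bar>S (f m) - T m (f m)\<bar> - r) ` I)"
      have e: "e > 0" unfolding e_def using I(1) I0 f(2) by (subst Min_gr_iff) auto
      obtain n where n: "\<And>m. m \<in> I \<Longrightarrow> \<bar>T n (f m) - S (f m)\<bar> < e"
        using approx[OF S, of "f ` I" e] I(1) f(1) UV e by blast
      obtain m where m: "m \<in> I" "\<And>\<phi>. \<phi> \<in> unit_tests U \<Longrightarrow> \<bar>T n \<phi> - T m \<phi>\<bar> \<le> r" using I(2) by blast
      have "e \<le> \<bar>S (f m) - T m (f m)\<bar> - r" unfolding e_def using I(1) m(1) by (intro Min_le) auto
      then show False using n[OF m(1)] m(2)[OF f(1)[OF m(1)]] by linarith
    qed
    then show ?thesis using I(1) by blast
  qed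
  have KH: "K \<subseteq> Hm1_loc \<Omega>"
  proof
    fix S assume S: "S \<in> K"
    have "S \<in> extensional ?V" using S KP by (auto simp: P_def PiE_def)
    \<comment> \<open>Linearity is a condition on three test functions at a time, so it survives
      pointwise limits.\<close>
    moreover have "S (\<lambda>z. a * \<phi> z + b * \<psi> z) = a * S \<phi> + b * S \<psi>"
      if pp: "\<phi> \<in> ?V" "\<psi> \<in> ?V" for \<phi> \<psi> a b
    proof -
      let ?\<chi> = "\<lambda>z. a * \<phi> z + b * \<psi> z"
      have "\<bar>S ?\<chi> - (a * S \<phi> + b * S \<psi>)\<bar> \<le> 0 + e" if e: "e > 0" for e
      proof -
        let ?d = "e / (1 + \<bar>a\<bar> + \<bar>b\<bar>)"
        have d: "?d > 0" using e by (intro divide_pos_pos) auto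
        have "{\<phi>, \<psi>, ?\<chi>} \<subseteq> ?V"
          using pp test_functions_lincomb[OF pp] by (simp only: insert_subset empty_subsetI simp_thms)
        from approx[OF S _ this d] obtain n where n: "\<forall>\<eta>\<in>{\<phi>, \<psi>, ?\<chi>}. \<bar>T n \<eta> - S \<eta>\<bar> < ?d"
          by (meson finite.emptyI finite.insertI)
        have lin: "T n ?\<chi> = a * T n \<phi> + b * T n \<psi>"
          by (rule Hm1_locD(2)[OF T pp])
        have eq: "S ?\<chi> - (a * S \<phi> + b * S \<psi>) = - (T n ?\<chi> - S ?\<chi>) + a * (T n \<phi> - S \<phi>) + b * (T n \<psi> - S \<psi>)"
          unfolding lin by (simp add: algebra_simps)
        have "\<bar>S ?\<chi> - (a * S \<phi> + b * S \<psi>)\<bar>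
          \<le> \<bar>T n ?\<chi> - S ?\<chi>\<bar> + \<bar>a\<bar> * \<bar>T n \<phi> - S \<phi>\<bar> + \<bar>b\<bar> * \<bar>T n \<psi> - S \<psi>\<bar>"
          unfolding eq abs_mult[symmetric] by (intro order_trans[OF abs_triangle_ineq] add_mono) simp_all
        also have "\<dots> \<le> ?d + \<bar>a\<bar> * ?d + \<bar>b\<bar> * ?d"
        proof -
          have "\<bar>T n \<phi> - S \<phi>\<bar> \<le> ?d" "\<bar>T n \<psi> - S \<psi>\<bar> \<le> ?d" "\<bar>T n ?\<chi> - S ?\<chi>\<bar> \<le> ?d"
            by (rule less_imp_le[OF bspec[OF n insertI1]] less_imp_le[OF bspec[OF n insertI2[OF insertI1]]]
              less_imp_le[OF bspec[OF n insertI2[OF insertI2[OF singletonI]]]])+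
          from add_mono[OF add_mono[OF this(3) mult_left_mono[OF this(1) abs_ge_zero[of a]]]
              mult_left_mono[OF this(2) abs_ge_zero[of b]]]
          show ?thesis .
        qed
        also have "\<dots> = (1 + \<bar>a\<bar> + \<bar>b\<bar>) * ?d" by (simp only: distrib_right mult_1)
        also have "\<dots> = e"
        proof -
          have "1 + \<bar>a\<bar> + \<bar>b\<bar> \<noteq> 0" by linarith
          then show ?thesis unfolding times_divide_eq_right by (rule nonzero_mult_div_cancel_left)
        qed
        finally show ?thesis by simp
      qed
      then have "\<bar>S ?\<chi> - (a * S \<phi> + b * S \<psi>)\<bar> \<le> 0" by (rule field_le_epsilon)
      then show ?thesis by simp
    qed
    moreover have "bdd_above (Hm1_values U S)" if U: "compactly_inside U \<Omega>" for U
    proof -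
      obtain m where m: "\<And>\<phi>. \<phi> \<in> unit_tests U \<Longrightarrow> \<bar>S \<phi> - T m \<phi>\<bar> \<le> 1"
        using near[OF U zero_less_one] S by blast
      have b: "bdd_above (Hm1_values U (T m))" by (rule Hm1_locD(1)[OF T U])
      show ?thesis
      proof (rule bdd_above_Hm1_valuesI)
        fix \<phi> assume "\<phi> \<in> unit_tests U"
        from m[OF this] Hm1_norm_ge[OF b this] show "\<bar>S \<phi>\<bar> \<le> 1 + Hm1_norm U (T m)" by linarith
      qed
    qed
    ultimately show "S \<in> Hm1_loc \<Omega>" by (simp add: Hm1_loc_def)
  qed
  let ?B = "{{S \<in> Hm1_loc \<Omega>. Hm1_norm U (\<lambda>\<phi>. S \<phi> - T \<phi>) < r} | T U r.
        T \<in> Hm1_loc \<Omega> \<and> compactly_inside U \<Omega> \<and> 0 < r}"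
  have topK: "topspace (subtopology X K) = K" using KP compactin_subset_topspace[OF compK] by auto
  \<comment> \<open>With the identity continuous from the pointwise topology on \<open>K\<close> to
    the seminorm topology, compactness of \<open>K\<close> is transported. Only subbasic sets have
    to be pulled back.\<close>
  have "continuous_map (subtopology X K) (Hm1_loc_topology \<Omega>) id"
    unfolding Hm1_loc_topology_def
  proof (rule continuous_on_generated_topo)
    fix G assume "G \<in> ?B"
    then obtain T0 U r0 where G: "G = {S \<in> Hm1_loc \<Omega>. Hm1_norm U (\<lambda>\<phi>. S \<phi> - T0 \<phi>) < r0}"
      and T0: "T0 \<in> Hm1_loc \<Omega>" and U: "compactly_inside U \<Omega>" and r0: "0 < r0" by blast
    have UV: "unit_tests U \<subseteq> ?V"
      using U closure_subset test_functions_mono unfolding compactly_inside_def by blast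
    show "openin (subtopology X K) (id -` G \<inter> topspace (subtopology X K))"
      unfolding topK
    proof (subst openin_subopen, intro ballI)
      fix S0 assume S0: "S0 \<in> id -` G \<inter> K"
      define r where "r = (r0 - Hm1_norm U (\<lambda>\<phi>. S0 \<phi> - T0 \<phi>)) / 4"
      have r: "r > 0" using S0 by (simp add: G r_def)
      obtain I where I: "finite I" "\<And>S. S \<in> K \<Longrightarrow> \<exists>m\<in>I. \<forall>\<phi>\<in>unit_tests U. \<bar>S \<phi> - T m \<phi>\<bar> \<le> r"
        using near[OF U r] by blast
      \<comment> \<open>Each net point in \<open>J\<close> is kept away from \<open>S0\<close> by
        one test function. The pointwise open conditions in \<open>?W\<close> forbid all of these
        net points, so the one close to a given \<open>S\<close> in \<open>?W\<close> is also within
        \<open>r\<close> of \<open>S0\<close>, and \<open>S\<close> is within \<open>2 * r\<close>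
        of \<open>S0\<close>, less than the gap to \<open>r0\<close>.\<close>
      define J where "J = {m \<in> I. \<exists>\<phi>\<in>unit_tests U. \<bar>S0 \<phi> - T m \<phi>\<bar> > r}"
      have finJ: "finite J" using I(1) by (simp add: J_def)
      have "\<forall>m\<in>J. \<exists>\<phi>\<in>unit_tests U. \<bar>S0 \<phi> - T m \<phi>\<bar> > r" unfolding J_def by simp
      from bchoice[OF this[unfolded Bex_def]]
      obtain f where f: "\<And>m. m \<in> J \<Longrightarrow> f m \<in> unit_tests U" "\<And>m. m \<in> J \<Longrightarrow> \<bar>S0 (f m) - T m (f m)\<bar> > r"
        by blast
      let ?W = "topspace X \<inter> (\<Inter>m\<in>J. {S \<in> topspace X. S (f m) \<in> {x. \<bar>x - T m (f m)\<bar> > r}})"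
      have "openin X ?W"
      proof (cases "J = {}")
        case False
        have "openin X {S \<in> topspace X. S (f m) \<in> {x. \<bar>x - T m (f m)\<bar> > r}}" if "m \<in> J" for m
        proof (rule openin_continuous_map_preimage[OF evalc])
          show "f m \<in> ?V" using f(1)[OF that] UV by blast
          have "open {x. r < \<bar>x - T m (f m)\<bar>}" by (intro open_Collect_less continuous_intros)
          then show "openin euclideanreal {x. \<bar>x - T m (f m)\<bar> > r}" by simp
        qed
        then show ?thesis using finJ False by (intro openin_Int openin_Inter) auto
      qed simp
      then have "openin (subtopology X K) (?W \<inter> K)" by (rule openin_subtopology_Int)
      moreover have "S0 \<in> ?W \<inter> K" using S0 f(2) topK by auto
      moreover have "?W \<inter> K \<subseteq> id -` G \<inter> K"
      proof
        fix S assume S: "S \<in> ?W \<inter> K"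
        obtain m where m: "m \<in> I" "\<And>\<phi>. \<phi> \<in> unit_tests U \<Longrightarrow> \<bar>S \<phi> - T m \<phi>\<bar> \<le> r" using I(2)[of S] S by blast
        have "m \<notin> J"
        proof
          assume "m \<in> J"
          then have "\<bar>S (f m) - T m (f m)\<bar> > r" using S by blast
          with m(2)[OF f(1)[OF \<open>m \<in> J\<close>]] show False by linarith
        qed
        have m0: "\<bar>S0 \<phi> - T m \<phi>\<bar> \<le> r" if "\<phi> \<in> unit_tests U" for \<phi>
        proof (rule ccontr)
          assume "\<not> \<bar>S0 \<phi> - T m \<phi>\<bar> \<le> r"
          then have "\<bar>S0 \<phi> - T m \<phi>\<bar> > r" by (rule not_le_imp_less)
          then have "m \<in> J" unfolding J_def by (intro CollectI conjI m(1) bexI[OF _ that])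
          with \<open>m \<notin> J\<close> show False ..
        qed
        have "S0 \<in> Hm1_loc \<Omega>" using S0 KH by auto
        have b: "bdd_above (Hm1_values U (\<lambda>\<phi>. S0 \<phi> - T0 \<phi>))"
          by (rule bdd_above_Hm1_values_diff[OF Hm1_locD(1)[OF \<open>S0 \<in> Hm1_loc \<Omega>\<close> U] Hm1_locD(1)[OF T0 U]])
        have "Hm1_norm U (\<lambda>\<phi>. S \<phi> - T0 \<phi>) \<le> 2 * r + Hm1_norm U (\<lambda>\<phi>. S0 \<phi> - T0 \<phi>)"
        proof (rule Hm1_norm_le)
          fix \<phi> assume \<phi>: "\<phi> \<in> unit_tests U"
          from m(2)[OF \<phi>] m0[OF \<phi>] Hm1_norm_ge[OF b \<phi>]
          show "\<bar>S \<phi> - T0 \<phi>\<bar> \<le> 2 * r + Hm1_norm U (\<lambda>\<phi>. S0 \<phi> - T0 \<phi>)" by linarith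
        qed
        also have "\<dots> < r0"
        proof -
          have "2 * ((a - x) / 4) + x < a" if "0 < (a - x) / 4" for a x :: real
            using that by (simp add: field_simps)
          from this[OF r[unfolded r_def]] show ?thesis unfolding r_def .
        qed
        finally show "S \<in> id -` G \<inter> K" using S KH by (auto simp: G)
      qed
      ultimately show "\<exists>W. openin (subtopology X K) W \<and> S0 \<in> W \<and> W \<subseteq> id -` G \<inter> K" by blast
    qed
  next
    show "id ` topspace (subtopology X K) \<subseteq> \<Union> ?B"
    proof
      fix S assume "S \<in> id ` topspace (subtopology X K)"
      then have S: "S \<in> Hm1_loc \<Omega>" using topK KH by auto
      \<comment> \<open>The carrier of a generated topology is the union of its subbasis. The ball
        around \<open>S\<close> itself, with \<open>U\<close> empty, shows that every functional is
        covered.\<close>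
      have "Hm1_norm {} (\<lambda>\<phi>. S \<phi> - S \<phi>) \<le> 1 / 2" by (rule Hm1_norm_le) simp
      then have 1: "S \<in> {R \<in> Hm1_loc \<Omega>. Hm1_norm {} (\<lambda>\<phi>. R \<phi> - S \<phi>) < 1}" using S by simp
      have 2: "compactly_inside {} \<Omega>" by (simp add: compactly_inside_def)
      have "{R \<in> Hm1_loc \<Omega>. Hm1_norm {} (\<lambda>\<phi>. R \<phi> - S \<phi>) < 1} \<in> ?B"
        by (rule CollectI, rule exI[of _ S], rule exI[of _ "{}"], rule exI[of _ 1],
            rule conjI[OF refl conjI[OF S conjI[OF 2 zero_less_one]]])
      from UnionI[OF this 1] show "S \<in> \<Union> ?B" .
    qed
  qed
  moreover have "compactin (subtopology X K) K" using compK by simp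
  ultimately have "compactin (Hm1_loc_topology \<Omega>) (id ` K)" by (rule image_compactin[rotated])
  then show ?thesis using TK by auto
qed

section \<open>Total boundedness of divergences\<close>

text \<open>If there were no finite net, members could be picked one after another at sup distance
  more than \<open>e\<close> from all earlier picks. The theorem of Arzela and Ascoli would extract
  a uniformly convergent subsequence of the picks, two members of which are closer than
  that.\<close>

lemma Arzela_Ascoli_net:
  fixes F :: "nat \<Rightarrow> point \<Rightarrow> real"
  assumes "compact S" "\<And>n x. x \<in> S \<Longrightarrow> \<bar>F n x\<bar> \<le> M"
    and equi: "\<And>e. 0 < e \<Longrightarrow> \<exists>d>0. \<forall>n x y. dist x y < d \<longrightarrow> \<bar>F n x - F n y\<bar> < e"
    and e: "0 < e"
  shows "\<exists>I. finite I \<and> (\<forall>n. \<exists>m\<in>I. \<forall>x\<in>S. \<bar>F n x - F m x\<bar> \<le> e)"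
proof (rule ccontr)
  assume no: "\<not> ?thesis"
  define far where "far = (\<lambda>n m. \<exists>x\<in>S. \<bar>F n x - F m x\<bar> > e)"
  have ex: "\<exists>n. \<forall>m\<in>I. far n m" if "finite I" for I
    using no that unfolding far_def by (meson not_le)
  define pick where "pick = (\<lambda>I. SOME n. \<forall>m\<in>I. far n m)"
  have pick: "far (pick I) m" if "finite I" "m \<in> I" for I m
    using someI_ex[OF ex[OF that(1)]] that(2) unfolding pick_def by blast
  \<comment> \<open>\<open>A k\<close> holds the first \<open>k\<close> picks, and
    \<open>s k\<close> is the pick made against it.\<close>
  define A where "A = rec_nat {} (\<lambda>_ I. insert (pick I) I)"
  have A0: "A 0 = {}" and AS: "\<And>k. A (Suc k) = insert (pick (A k)) (A k)" by (simp_all add: A_def)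
  have finA: "finite (A k)" for k by (induction k) (simp_all add: A0 AS)
  have inA: "pick (A j) \<in> A k" if "j < k" for j k
    using that by (induction k) (auto simp: AS less_Suc_eq)
  define s where "s = (\<lambda>k. pick (A k))"
  have far: "far (s k) (s j)" if "j < k" for j k
    unfolding s_def by (rule pick[OF finA inA[OF that]])
  obtain g k where k: "strict_mono (k :: nat \<Rightarrow> nat)"
    and lim: "\<And>e. 0 < e \<Longrightarrow> \<exists>N. \<forall>n x. n \<ge> N \<and> x \<in> S \<longrightarrow> norm (F (s (k n)) x - g x) < e"
  proof (rule Arzela_Ascoli[OF assms(1), of "\<lambda>n. F (s n)" M])
    show "norm (F (s n) x) \<le> M" if "x \<in> S" for n x using assms(2)[OF that] by simp
    show "\<exists>d>0. \<forall>n y. y \<in> S \<and> norm (x - y) < d \<longrightarrow> norm (F (s n) x - F (s n) y) < e"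
      if xe: "x \<in> S" "0 < e" for x e
    proof -
      obtain d where "d > 0" "\<And>n x y. dist x y < d \<Longrightarrow> \<bar>F n x - F n y\<bar> < e" using equi[OF xe(2)] by (elim exE conjE) blast
      then show ?thesis by (intro exI[of _ d] conjI allI impI) (auto simp only: dist_norm real_norm_def)
    qed
  qed (use that in blast)
  obtain N where N: "\<And>n x. n \<ge> N \<Longrightarrow> x \<in> S \<Longrightarrow> norm (F (s (k n)) x - g x) < e / 2"
    using lim[of "e / 2"] e by auto
  have "k N < k (Suc N)" using k by (simp add: strict_mono_Suc_iff)
  from far[OF this] obtain x where x: "x \<in> S" "\<bar>F (s (k (Suc N))) x - F (s (k N)) x\<bar> > e"
    unfolding far_def by blast
  have "\<bar>F (s (k (Suc N))) x - g x\<bar> < e / 2" "\<bar>F (s (k N)) x - g x\<bar> < e / 2"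
    using N[OF _ x(1), of "Suc N"] N[OF order_refl x(1)] by simp_all
  then show False using x(2) by linarith
qed

lemma bounded_Cc:
  fixes f :: "point \<Rightarrow> real"
  assumes "continuous_on UNIV f" "bounded (supp f)"
  obtains B where "\<And>z. \<bar>f z\<bar> \<le> B" "0 \<le> B"
proof -
  have "compact (f ` closure (supp f))"
    by (rule compact_continuous_image[OF continuous_on_subset[OF assms(1)]]) (use assms(2) in auto)
  then have "bounded (f ` closure (supp f))" by (rule compact_imp_bounded)
  then obtain B where B: "B > 0" "\<forall>y\<in>f ` closure (supp f). norm y \<le> B" unfolding bounded_pos by (elim exE conjE)
  have "\<bar>f z\<bar> \<le> B" for z
  proof (cases "f z = 0")
    case False
    then have "f z \<in> f ` closure (supp f)" using closure_subset[of "supp f"] by blast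
    then have "norm (f z) \<le> B" by (rule bspec[OF B(2)])
    then show ?thesis by simp
  qed (use B in simp)
  then show ?thesis using that[of B] B by simp
qed

text \<open>The modulus of continuity comes from the kernel alone; the sequence enters only through
  its common sup bound and its common support box.\<close>

lemma conv_equicontinuous:
  fixes f :: "nat \<Rightarrow> point \<Rightarrow> real"
  assumes k: "continuous_on UNIV k" "bounded (supp k)" and L: "0 < L" and M: "0 \<le> M" and e: "0 < e"
    and f: "\<And>n. continuous_on UNIV (f n)" "\<And>n z. \<bar>f n z\<bar> \<le> M"
      "\<And>n z. f n z \<noteq> 0 \<Longrightarrow> \<bar>fst z\<bar> \<le> L \<and> \<bar>snd z\<bar> \<le> L"
  shows "\<exists>d>0. \<forall>n x y. dist x y < d \<longrightarrow> \<bar>conv k (f n) x - conv k (f n) y\<bar> < e"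
proof -
  define e' where "e' = e / (M * (4 * L\<^sup>2) + 1)"
  have pos: "M * (4 * L\<^sup>2) + 1 > 0" using M by (intro add_nonneg_pos) auto
  have e': "e' > 0" unfolding e'_def using e pos by (rule divide_pos_pos)
  obtain d where d: "d > 0" "\<And>x y. dist x y < d \<Longrightarrow> \<bar>k x - k y\<bar> < e'"
    using uniformly_continuous_Cc[OF k e'] by metis
  show ?thesis
  proof (intro exI[of _ d] conjI d(1) allI impI)
    fix n and x y :: point assume xy: "dist x y < d"
    let ?f = "f n"
    have fb: "bounded (supp ?f)" by (rule bounded_suppI[where L = L]) (rule f(3))
    note i = conv_integrable[OF k(1) f(1) fb]
    have "\<bar>conv k ?f x - conv k ?f y\<bar> = \<bar>LINT z|lborel. k (x - z) * ?f z - k (y - z) * ?f z\<bar>"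
      unfolding conv_def by (simp add: Bochner_Integration.integral_diff[OF i i])
    also have "\<dots> \<le> (e' * M) * (4 * L\<^sup>2)"
    proof (rule LINT_box_bound[where a = "- L" and b = "- L"])
      fix z
      have "dist (x - z) (y - z) < d" using xy by (simp add: dist_norm)
      then have "\<bar>k (x - z) - k (y - z)\<bar> * \<bar>?f z\<bar> \<le> e' * M"
        using mult_mono[OF less_imp_le[OF d(2)] f(2)] e' by simp
      then show "\<bar>k (x - z) * ?f z - k (y - z) * ?f z\<bar> \<le> e' * M"
        by (simp add: abs_mult[symmetric] left_diff_distrib)
      show "z \<in> cbox (- L, - L) (- L + 2 * L, - L + 2 * L)" if "k (x - z) * ?f z - k (y - z) * ?f z \<noteq> 0"
      proof -
        have "?f z \<noteq> 0" using that by auto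
        from f(3)[OF this] show ?thesis by (cases z) (auto simp: cbox_Pair_eq)
      qed
    qed (use L i in auto)
    also have "\<dots> = e' * (M * (4 * L\<^sup>2))" by simp
    also have "\<dots> < e' * (M * (4 * L\<^sup>2) + 1)" using e' by simp
    also have "\<dots> = e" unfolding e'_def using pos by simp
    finally show "\<bar>conv k ?f x - conv k ?f y\<bar> < e" .
  qed
qed

text \<open>The elementary \<open>\<bar>x\<bar> \<le> (1 + x\<^sup>2) / 2\<close>, integrated over
  \<open>closure U\<close>, takes the place of the Cauchy-Schwarz inequality; the unit ball
  condition bounds the integral of \<open>\<phi>\<^sup>2\<close> by 1.\<close>

lemma unit_tests_pairing:
  assumes "\<phi> \<in> unit_tests U" "compact (closure U)" and g: "continuous_on UNIV g" "0 \<le> e"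
    and le: "\<And>z. z \<in> closure U \<Longrightarrow> \<bar>g z\<bar> \<le> e"
  shows "\<bar>LINT z|lborel. g z * \<phi> z\<bar> \<le> e * ((measure lborel (closure U) + 1) / 2)"
proof -
  have \<phi>: "\<phi> \<in> test_functions U" "H1_norm \<phi> \<le> 1" using assms(1) by auto
  note t = test_functionsD[OF \<phi>(1)]
  note c = C1_onD(4)[OF t(1)]
  have i2: "integrable lborel (\<lambda>z. (\<phi> z)\<^sup>2)"
    unfolding power2_eq_square by (intro integrable_Cc continuous_on_mult bounded_supp_mult(1) c t)
  have ind: "integrable lborel (\<lambda>z. indicator (closure U) z :: real)"
    by (rule integrable_real_indicator[OF _ emeasure_compact_finite[OF assms(2)]]) simp
  have "\<bar>LINT z|lborel. g z * \<phi> z\<bar> \<le> (LINT z|lborel. \<bar>g z * \<phi> z\<bar>)" by (rule integral_abs_bound)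
  also have "\<dots> \<le> (LINT z|lborel. (e / 2) * (indicator (closure U) z + (\<phi> z)\<^sup>2))"
  proof (rule integral_mono)
    show "integrable lborel (\<lambda>z. \<bar>g z * \<phi> z\<bar>)"
      by (intro integrable_abs integrable_Cc continuous_on_mult bounded_supp_mult(2) c t g)
    show "integrable lborel (\<lambda>z. (e / 2) * (indicator (closure U) z + (\<phi> z)\<^sup>2))"
      by (intro integrable_mult_right Bochner_Integration.integrable_add ind i2)
    show "\<bar>g z * \<phi> z\<bar> \<le> (e / 2) * (indicator (closure U) z + (\<phi> z)\<^sup>2)" for z
    proof (cases "\<phi> z = 0")
      case True
      then show ?thesis using g(2) by simp
    next
      case False
      then have z: "z \<in> closure U" using t(3) closure_subset[of "supp \<phi>"] closure_subset[of U] by blast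
      have "\<bar>g z * \<phi> z\<bar> \<le> e * \<bar>\<phi> z\<bar>" unfolding abs_mult by (rule mult_right_mono[OF le[OF z]]) simp
      also have "\<bar>\<phi> z\<bar> \<le> (1 + (\<phi> z)\<^sup>2) / 2" using sum_squares_bound[of 1 "\<bar>\<phi> z\<bar>"] by simp
      then have "e * \<bar>\<phi> z\<bar> \<le> e * ((1 + (\<phi> z)\<^sup>2) / 2)" using g(2) by (rule mult_left_mono)
      finally show ?thesis using z by simp
    qed
  qed
  also have "\<dots> = (e / 2) * (measure lborel (closure U) + (LINT z|lborel. (\<phi> z)\<^sup>2))"
    using ind i2 by simp
  also have "\<dots> \<le> (e / 2) * (measure lborel (closure U) + 1)"
    using H1_norm_le_1D(1)[OF t(1,2) \<phi>(2)] g(2) by (intro mult_left_mono add_left_mono) auto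
  finally show ?thesis by simp
qed

text \<open>At a fixed scale \<open>h\<close> the mollified divergences are convolutions of bounded
  fields with the gradient of one kernel, hence have a finite net in the sup norm. The mollification
  error is uniformly small: the part due to \<open>b\<close> by the choice of \<open>h\<close>, the
  part due to \<open>P1\<close> and \<open>P2\<close> for all large \<open>n\<close>. The finitely
  many remaining indices join the net themselves.\<close>

lemma divergence_totally_bounded:
  fixes Q1 Q2 P1 P2 b :: "nat \<Rightarrow> point \<Rightarrow> real"
  assumes U: "compact (closure U)"
    and Q: "\<And>n. C1_on UNIV (Q1 n)" "\<And>n. C1_on UNIV (Q2 n)"
    and P: "\<And>n. C1_on UNIV (P1 n)" "\<And>n. C1_on UNIV (P2 n)" "\<And>n. bounded (supp (P1 n))" "\<And>n. bounded (supp (P2 n))"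
    and b: "\<And>n. continuous_on UNIV (b n)" "\<And>n. bounded (supp (b n))"
    and supp: "\<And>n z. Q1 n z \<noteq> 0 \<or> Q2 n z \<noteq> 0 \<Longrightarrow> \<bar>fst z\<bar> \<le> L \<and> \<bar>snd z\<bar> \<le> L" and L: "0 < L"
    and div: "\<And>n z. D1 (Q1 n) z + D2 (Q2 n) z = D1 (P1 n) z + D2 (P2 n) z + b n z"
    and M: "\<And>n z. \<bar>Q1 n z\<bar> \<le> M" "\<And>n z. \<bar>Q2 n z\<bar> \<le> M"
    and C: "\<And>n. (LINT z|lborel. \<bar>b n z\<bar>) \<le> C"
    and \<delta>: "\<And>n. (LINT z|lborel. (P1 n z)\<^sup>2 + (P2 n z)\<^sup>2) \<le> \<delta> n" "\<delta> \<longlonglongrightarrow> 0"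
    and r: "0 < r"
  shows "\<exists>I. finite I \<and> (\<forall>n. \<exists>m\<in>I. \<forall>\<phi>\<in>unit_tests U.
    \<bar>(LINT z|lborel. (D1 (Q1 n) z + D2 (Q2 n) z) * \<phi> z) - (LINT z|lborel. (D1 (Q1 m) z + D2 (Q2 m) z) * \<phi> z)\<bar> \<le> r)"
proof -
  define T where "T = (\<lambda>n z. D1 (Q1 n) z + D2 (Q2 n) z)"
  have Qb: "bounded (supp (Q1 n))" "bounded (supp (Q2 n))" for n
    by (rule bounded_suppI[where L = L]; use supp in blast)+
  have T: "continuous_on UNIV (T n)" "bounded (supp (T n))" for n
    unfolding T_def by (intro continuous_on_add C1_onD(2,3) Q bounded_supp_add bounded_supp_D Qb)+
  have M0: "0 \<le> M" using M(1)[of 0 0] by linarith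
  have "0 \<le> (LINT z|lborel. \<bar>b 0 z\<bar>)" by simp
  then have C0: "0 \<le> C" using C[of 0] by linarith
  \<comment> \<open>Two mollification errors \<open>r'\<close> and a net error
    \<open>bump_mass * r / 2\<close> add up to \<open>bump_mass * r\<close>.\<close>
  define r' where "r' = bump_mass * r / 4"
  have r': "r' > 0" unfolding r'_def using bump_mass_bounds(1) r by simp
  \<comment> \<open>Half of \<open>r'\<^sup>2\<close> is reserved for the \<open>L\<^sup>1\<close>
    term and half for the vanishing fields. The 1 in the denominator covers the case
    \<open>M * C = 0\<close>.\<close>
  define h where "h = r'\<^sup>2 / 2 / (55296 * M * C + 1)"
  have MC: "55296 * M * C + 1 > 0" using M0 C0 by (intro add_nonneg_pos mult_nonneg_nonneg) auto
  have h: "h > 0" unfolding h_def using r' MC by (intro divide_pos_pos) auto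
  have hb: "55296 * M * h * C \<le> r'\<^sup>2 / 2"
  proof -
    have "55296 * M * h * C \<le> (55296 * M * C + 1) * h" using h by (simp add: algebra_simps)
    also have "\<dots> = r'\<^sup>2 / 2"
    proof -
      have "a * (x / a) = x" if "0 < a" for a x :: real using that by simp
      from this[OF MC] show ?thesis unfolding h_def .
    qed
    finally show ?thesis .
  qed
  have "\<forall>\<^sub>F n in sequentially. \<delta> n < r'\<^sup>2 / 2 / 9216"
    by (rule order_tendstoD(2)[OF \<delta>(2)]) (use r' in simp)
  then obtain N where N: "\<And>n. n \<ge> N \<Longrightarrow> \<delta> n < r'\<^sup>2 / 2 / 9216" unfolding eventually_sequentially by blast
  define g where "g = (\<lambda>n. conv (bump h) (T n))"
  have gc: "continuous_on UNIV (g n)" for n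
    unfolding g_def by (rule continuous_conv[OF C1_onD(4)[OF C1_on_bump] T])
  have approx: "\<bar>bump_mass * (LINT z|lborel. T n z * \<phi> z) - (LINT z|lborel. g n z * \<phi> z)\<bar> \<le> r'"
    if n: "n \<ge> N" and \<phi>: "\<phi> \<in> unit_tests U" for n \<phi>
  proof -
    have \<phi>': "\<phi> \<in> test_functions U" "H1_norm \<phi> \<le> 1" using \<phi> by auto
    note t = test_functionsD[OF \<phi>'(1)]
    let ?N = "55296 * M * h * (LINT z|lborel. \<bar>b n z\<bar>) + 9216 * (LINT z|lborel. (P1 n z)\<^sup>2 + (P2 n z)\<^sup>2)"
    have "55296 * M * h * (LINT z|lborel. \<bar>b n z\<bar>) \<le> 55296 * M * h * C"
      using C M0 h by (intro mult_left_mono) auto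
    moreover have "9216 * (LINT z|lborel. (P1 n z)\<^sup>2 + (P2 n z)\<^sup>2) \<le> r'\<^sup>2 / 2" using \<delta>(1)[of n] N[OF n] by simp
    ultimately have "?N \<le> r'\<^sup>2" using hb by linarith
    then have 1: "sqrt ?N \<le> r'" using r' real_le_lsqrt by force
    have 2: "sqrt (LINT z|lborel. (D1 \<phi> z)\<^sup>2 + (D2 \<phi> z)\<^sup>2) \<le> 1"
      using H1_norm_le_1D(2)[OF t(1,2) \<phi>'(2)] by simp
    have "\<bar>bump_mass * (LINT z|lborel. T n z * \<phi> z) - (LINT z|lborel. g n z * \<phi> z)\<bar>
      \<le> sqrt ?N * sqrt (LINT z|lborel. (D1 \<phi> z)\<^sup>2 + (D2 \<phi> z)\<^sup>2)"
      unfolding g_def T_def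
      by (rule divergence_mollification_bound[OF Q(1) Q(2) Qb P(1) P(2) P(3) P(4) b(1) b(2) div M(1) M(2) h t(1,2)])
    also have "\<dots> \<le> r' * 1" using 1 2 r' by (intro mult_mono) auto
    finally show ?thesis by simp
  qed
  let ?S = "closure U"
  have gsplit: "g n x = conv (D1 (bump h)) (Q1 n) x + conv (D2 (bump h)) (Q2 n) x" for n x
  proof -
    have "g n x = conv (bump h) (D1 (Q1 n)) x + conv (bump h) (D2 (Q2 n)) x"
      unfolding g_def T_def
      by (rule conv_add_right[OF C1_onD(4)[OF C1_on_bump] C1_onD(2)[OF Q(1)] bounded_supp_D(1)[OF Qb(1)]
        C1_onD(3)[OF Q(2)] bounded_supp_D(2)[OF Qb(2)]])
    then show ?thesis by (simp add: conv_D_right[OF C1_on_bump Q(1) Qb(1)] conv_D_right[OF C1_on_bump Q(2) Qb(2)])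
  qed
  note k1 = C1_onD(2)[OF C1_on_bump[of h]] bounded_supp_D(1)[OF bounded_supp_bump[OF h]]
  note k2 = C1_onD(3)[OF C1_on_bump[of h]] bounded_supp_D(2)[OF bounded_supp_bump[OF h]]
  obtain B1 where B1: "\<And>z. \<bar>D1 (bump h) z\<bar> \<le> B1" using bounded_Cc[OF k1] by metis
  obtain B2 where B2: "\<And>z. \<bar>D2 (bump h) z\<bar> \<le> B2" using bounded_Cc[OF k2] by metis
  have kb: "\<bar>conv k q x\<bar> \<le> B * M * (4 * L\<^sup>2)"
    if k: "continuous_on UNIV k" "\<And>z. \<bar>k z\<bar> \<le> B"
      and q: "continuous_on UNIV q" "bounded (supp q)" "\<And>z. \<bar>q z\<bar> \<le> M" "\<And>z. q z \<noteq> 0 \<Longrightarrow> \<bar>fst z\<bar> \<le> L \<and> \<bar>snd z\<bar> \<le> L"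
    for k q B x
    unfolding conv_def
  proof (rule LINT_box_bound[where a = "- L" and b = "- L"])
    have "0 \<le> B" using k(2)[of 0] by linarith
    then show "\<bar>k (x - z) * q z\<bar> \<le> B * M" for z unfolding abs_mult by (intro mult_mono k q) auto
    show "z \<in> cbox (- L, - L) (- L + 2 * L, - L + 2 * L)" if "k (x - z) * q z \<noteq> 0" for z
      using that q(4)[of z] by (cases z) (auto simp: cbox_Pair_eq abs_le_iff)
  qed (use L conv_integrable[OF k(1) q(1,2)] in auto)
  have gb: "\<bar>g n x\<bar> \<le> B1 * M * (4 * L\<^sup>2) + B2 * M * (4 * L\<^sup>2)" for n x
    unfolding gsplit
    using kb[OF k1(1) B1 C1_onD(4)[OF Q(1)] Qb(1) M(1), of n x] kb[OF k2(1) B2 C1_onD(4)[OF Q(2)] Qb(2) M(2), of n x] supp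
    by (intro order_trans[OF abs_triangle_ineq] add_mono) blast+
  have ge: "\<exists>d>0. \<forall>n x y. dist x y < d \<longrightarrow> \<bar>g n x - g n y\<bar> < e" if e: "0 < e" for e
  proof -
    have e2: "0 < e / 2" using e by simp
    have supp1: "Q1 n z \<noteq> 0 \<Longrightarrow> \<bar>fst z\<bar> \<le> L \<and> \<bar>snd z\<bar> \<le> L"
      and supp2: "Q2 n z \<noteq> 0 \<Longrightarrow> \<bar>fst z\<bar> \<le> L \<and> \<bar>snd z\<bar> \<le> L" for n z
      using supp[of n z] by simp_all
    have "\<exists>d>0. \<forall>n x y. dist x y < d \<longrightarrow> \<bar>conv (D1 (bump h)) (Q1 n) x - conv (D1 (bump h)) (Q1 n) y\<bar> < e / 2"
      by (rule conv_equicontinuous[OF k1 L M0 e2]) (rule C1_onD(4)[OF Q(1)], rule M(1), erule supp1)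
    then obtain d1 where d1: "d1 > 0"
      "\<forall>n x y. dist x y < d1 \<longrightarrow> \<bar>conv (D1 (bump h)) (Q1 n) x - conv (D1 (bump h)) (Q1 n) y\<bar> < e / 2"
      by (elim exE conjE)
    have "\<exists>d>0. \<forall>n x y. dist x y < d \<longrightarrow> \<bar>conv (D2 (bump h)) (Q2 n) x - conv (D2 (bump h)) (Q2 n) y\<bar> < e / 2"
      by (rule conv_equicontinuous[OF k2 L M0 e2]) (rule C1_onD(4)[OF Q(2)], rule M(2), erule supp2)
    then obtain d2 where d2: "d2 > 0"
      "\<forall>n x y. dist x y < d2 \<longrightarrow> \<bar>conv (D2 (bump h)) (Q2 n) x - conv (D2 (bump h)) (Q2 n) y\<bar> < e / 2"
      by (elim exE conjE)
    show ?thesis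
    proof (intro exI[of _ "min d1 d2"] conjI allI impI)
      fix n and x y :: point assume "dist x y < min d1 d2"
      then show "\<bar>g n x - g n y\<bar> < e" unfolding gsplit 
        using d1(2)[rule_format, of x y n] d2(2)[rule_format, of x y n] by linarith
    qed (use d1 d2 in auto)
  qed
  define e where "e = bump_mass * r / (measure lborel ?S + 1)"
  have mS: "measure lborel ?S + 1 > 0" by (simp add: add_nonneg_pos)
  have e0: "e > 0" unfolding e_def using mS bump_mass_bounds(1) r by (intro divide_pos_pos mult_pos_pos)
  have "\<exists>I. finite I \<and> (\<forall>n. \<exists>m\<in>I. \<forall>x\<in>?S. \<bar>g (N + n) x - g (N + m) x\<bar> \<le> e)"
  proof (rule Arzela_Ascoli_net[OF U gb _ e0])
    fix e' :: real assume "0 < e'"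
    from ge[OF this] obtain d where "d > 0" "\<forall>n x y. dist x y < d \<longrightarrow> \<bar>g n x - g n y\<bar> < e'" by (elim exE conjE)
    then show "\<exists>d>0. \<forall>n x y. dist x y < d \<longrightarrow> \<bar>g (N + n) x - g (N + n) y\<bar> < e'" by (intro exI[of _ d]) simp
  qed
  then obtain I where I: "finite I" "\<And>n. \<exists>m\<in>I. \<forall>x\<in>?S. \<bar>g (N + n) x - g (N + m) x\<bar> \<le> e" by (elim exE conjE) simp
  have main: "\<exists>m\<in>{..<N} \<union> (+) N ` I. \<forall>\<phi>\<in>unit_tests U.
    \<bar>(LINT z|lborel. T n z * \<phi> z) - (LINT z|lborel. T m z * \<phi> z)\<bar> \<le> r" for n
  proof (cases "n < N")
    case True
    then show ?thesis using r by (intro bexI[of _ n]) auto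
  next
    case False
    then have n: "n \<ge> N" "N + (n - N) = n" by auto
    obtain m where m: "m \<in> I" "\<And>x. x \<in> ?S \<Longrightarrow> \<bar>g n x - g (N + m) x\<bar> \<le> e" using I(2)[of "n - N"] unfolding n(2) by blast
    have "\<bar>(LINT z|lborel. T n z * \<phi> z) - (LINT z|lborel. T (N + m) z * \<phi> z)\<bar> \<le> r" if \<phi>: "\<phi> \<in> unit_tests U" for \<phi>
    proof -
      have \<phi>': "\<phi> \<in> test_functions U" using \<phi> by auto
      note t = test_functionsD[OF \<phi>']
      have i: "integrable lborel (\<lambda>z. g n z * \<phi> z)" for n
        by (rule integrable_Cc[OF continuous_on_mult[OF gc C1_onD(4)[OF t(1)]] bounded_supp_mult(2)[OF t(2)]])
      have "\<bar>LINT z|lborel. (g n z - g (N + m) z) * \<phi> z\<bar> \<le> e * ((measure lborel ?S + 1) / 2)"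
        by (rule unit_tests_pairing[OF \<phi> U _ less_imp_le[OF e0] m(2)]) (intro continuous_on_diff gc)
      also have "\<dots> = bump_mass * r / 2" unfolding e_def using mS by simp
      finally have "\<bar>(LINT z|lborel. g n z * \<phi> z) - (LINT z|lborel. g (N + m) z * \<phi> z)\<bar> \<le> bump_mass * r / 2"
        unfolding left_diff_distrib Bochner_Integration.integral_diff[OF i i] .
      then have "\<bar>bump_mass * (LINT z|lborel. T n z * \<phi> z) - bump_mass * (LINT z|lborel. T (N + m) z * \<phi> z)\<bar> \<le> bump_mass * r"
        using approx[OF n(1) \<phi>] approx[OF le_add1 \<phi>, of m] unfolding r'_def by linarith
      then have "bump_mass * \<bar>(LINT z|lborel. T n z * \<phi> z) - (LINT z|lborel. T (N + m) z * \<phi> z)\<bar> \<le> bump_mass * r"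
        using bump_mass_bounds(1) by (simp add: right_diff_distrib[symmetric] abs_mult)
      then show ?thesis using bump_mass_bounds(1) by simp
    qed
    then show ?thesis using m(1) by (intro bexI[of _ "N + m"]) auto
  qed
  show ?thesis
    by (rule exI[of _ "{..<N} \<union> (+) N ` I"]) (use main I(1) in \<open>auto simp: T_def\<close>)
qed

text \<open>The fields matter only on \<open>U\<close>, since the test function and its derivatives
  vanish elsewhere. They may be replaced by C^1 continuations to the plane, for which integration by
  parts gives the classical divergence.\<close>

lemma distr_div_eq:
  assumes U: "U \<subseteq> \<Omega>" and \<phi>: "\<phi> \<in> test_functions U"
    and Q: "C1_on UNIV Q1" "C1_on UNIV Q2" "\<And>z. z \<in> U \<Longrightarrow> Q1 z = F1 z \<and> Q2 z = F2 z"
  shows "distr_div \<Omega> F1 F2 \<phi> = (LINT z|lborel. (D1 Q1 z + D2 Q2 z) * \<phi> z)"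
proof -
  note t = test_functionsD[OF \<phi>]
  have \<phi>\<Omega>: "\<phi> \<in> test_functions \<Omega>" using \<phi> test_functions_mono[OF U] by blast
  have i: "integrable lborel (\<lambda>z. D1 Q1 z * \<phi> z)" "integrable lborel (\<lambda>z. D2 Q2 z * \<phi> z)"
    "integrable lborel (\<lambda>z. Q1 z * D1 \<phi> z)" "integrable lborel (\<lambda>z. Q2 z * D2 \<phi> z)"
    by (rule integrable_Cc[OF continuous_on_mult[OF _ _] bounded_supp_mult(2)[OF t(2)]]
          integrable_Cc[OF continuous_on_mult[OF _ _] bounded_supp_mult(2)[OF bounded_supp_D(1)[OF t(2)]]]
          integrable_Cc[OF continuous_on_mult[OF _ _] bounded_supp_mult(2)[OF bounded_supp_D(2)[OF t(2)]]];
        rule C1_onD(2-4)[OF Q(1)] C1_onD(2-4)[OF Q(2)] C1_onD(2-4)[OF t(1)])+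
  have "(LINT z:\<Omega>|lborel. F1 z * D1 \<phi> z + F2 z * D2 \<phi> z) = (LINT z|lborel. Q1 z * D1 \<phi> z + Q2 z * D2 \<phi> z)"
    unfolding set_lebesgue_integral_def
  proof (rule Bochner_Integration.integral_cong[OF refl])
    fix z :: point
    show "indicator \<Omega> z *\<^sub>R (F1 z * D1 \<phi> z + F2 z * D2 \<phi> z) = Q1 z * D1 \<phi> z + Q2 z * D2 \<phi> z"
    proof (cases "z \<in> U")
      case True
      then show ?thesis using Q(3) U by (auto simp: indicator_def)
    next
      case False
      then have "z \<notin> closure (supp \<phi>)" using t(3) by blast
      from D_eq_0_outside[OF this] show ?thesis by simp
    qed
  qed
  also have "\<dots> = (LINT z|lborel. Q1 z * D1 \<phi> z) + (LINT z|lborel. Q2 z * D2 \<phi> z)"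
    using i by simp
  also have "\<dots> = - (LINT z|lborel. D1 Q1 z * \<phi> z) - (LINT z|lborel. D2 Q2 z * \<phi> z)"
    using integration_by_parts(1)[OF Q(1) t(1) disjI2[OF t(2)]] integration_by_parts(2)[OF Q(2) t(1) disjI2[OF t(2)]]
    by simp
  also have "\<dots> = - (LINT z|lborel. (D1 Q1 z + D2 Q2 z) * \<phi> z)"
    using i by (simp add: distrib_right)
  finally show ?thesis using \<phi>\<Omega> by (simp add: distr_div_def)
qed

text \<open>The second difference over a square of side \<open>h\<close> is evaluated by the mean
  value theorem in both orders. The result is used to identify the multipliers of a general entropy
  pair.\<close>

lemma mixed_partials_eq:
  assumes S: "open S" and f: "C1_on S f" "C1_on S (D1 f)" "C1_on S (D2 f)" and z: "z \<in> S"
  shows "D2 (D1 f) z = D1 (D2 f) z"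
proof -
  obtain x y where xy: "z = (x, y)" by (cases z)
  obtain r where r: "r > 0" "ball z r \<subseteq> S" using S z open_contains_ball by blast
  have near: "dist (s, t) z < c" if "\<bar>s - x\<bar> \<le> h" "\<bar>t - y\<bar> \<le> h" "2 * h < c" for s t h c
  proof -
    have "dist (s, t) z \<le> \<bar>s - x\<bar> + \<bar>t - y\<bar>"
      unfolding xy dist_norm using norm_Pair_le[of "s - x" "t - y"] by simp
    then show ?thesis using that by linarith
  qed
  have "\<bar>D2 (D1 f) z - D1 (D2 f) z\<bar> \<le> 0 + e" if e: "e > 0" for e
  proof -
    have "isCont (D2 (D1 f)) z" "isCont (D1 (D2 f)) z"
      using C1_onD(3)[OF f(2)] C1_onD(2)[OF f(3)] S z continuous_on_eq_continuous_at by blast+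
    then obtain d1 d2 where d: "d1 > 0" "\<And>w. dist w z < d1 \<Longrightarrow> dist (D2 (D1 f) w) (D2 (D1 f) z) < e / 2"
      "d2 > 0" "\<And>w. dist w z < d2 \<Longrightarrow> dist (D1 (D2 f) w) (D1 (D2 f) z) < e / 2"
      unfolding continuous_at_eps_delta using half_gt_zero[OF e] by metis
    define h where "h = min r (min d1 d2) / 3"
    have h: "h > 0" "2 * h < r" "2 * h < d1" "2 * h < d2" using r(1) d(1,3) by (auto simp: h_def)
    have inS: "(s, t) \<in> S" if "\<bar>s - x\<bar> \<le> h" "\<bar>t - y\<bar> \<le> h" for s t
      using near[OF that h(2)] r(2) by (auto simp: dist_commute subset_iff)
    let ?\<Delta> = "f (x + h, y + h) - f (x + h, y) - f (x, y + h) + f (x, y)"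
    have "\<exists>\<xi>>x. \<xi> < x + h \<and> (f (x + h, y + h) - f (x + h, y)) - (f (x, y + h) - f (x, y))
        = (x + h - x) * (D1 f (\<xi>, y + h) - D1 f (\<xi>, y))"
      by (rule MVT2) (use h inS in \<open>auto intro!: derivative_intros C1_on_partials[OF f(1)]\<close>)
    then obtain \<xi> where \<xi>: "x < \<xi>" "\<xi> < x + h" "?\<Delta> = h * (D1 f (\<xi>, y + h) - D1 f (\<xi>, y))" by auto
    have "\<exists>\<eta>>y. \<eta> < y + h \<and> D1 f (\<xi>, y + h) - D1 f (\<xi>, y) = (y + h - y) * D2 (D1 f) (\<xi>, \<eta>)"
      by (rule MVT2) (use h inS \<xi> in \<open>auto intro!: C1_on_partials[OF f(2)]\<close>)
    then obtain \<eta> where \<eta>: "y < \<eta>" "\<eta> < y + h" "?\<Delta> = h * (h * D2 (D1 f) (\<xi>, \<eta>))" using \<xi>(3) by auto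
    have "\<exists>\<eta>'>y. \<eta>' < y + h \<and> (f (x + h, y + h) - f (x, y + h)) - (f (x + h, y) - f (x, y))
        = (y + h - y) * (D2 f (x + h, \<eta>') - D2 f (x, \<eta>'))"
      by (rule MVT2) (use h inS in \<open>auto intro!: derivative_intros C1_on_partials[OF f(1)]\<close>)
    then obtain \<eta>' where \<eta>': "y < \<eta>'" "\<eta>' < y + h" "?\<Delta> = h * (D2 f (x + h, \<eta>') - D2 f (x, \<eta>'))" by auto
    have "\<exists>\<xi>'>x. \<xi>' < x + h \<and> D2 f (x + h, \<eta>') - D2 f (x, \<eta>') = (x + h - x) * D1 (D2 f) (\<xi>', \<eta>')"
      by (rule MVT2) (use h inS \<eta>' in \<open>auto intro!: C1_on_partials[OF f(3)]\<close>)
    then obtain \<xi>' where \<xi>': "x < \<xi>'" "\<xi>' < x + h" "?\<Delta> = h * (h * D1 (D2 f) (\<xi>', \<eta>'))" using \<eta>'(3) by auto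
    have "D2 (D1 f) (\<xi>, \<eta>) = D1 (D2 f) (\<xi>', \<eta>')" using \<eta>(3) \<xi>'(3) h(1) by simp
    moreover have "dist (D2 (D1 f) (\<xi>, \<eta>)) (D2 (D1 f) z) < e / 2"
      by (rule d(2), rule near[OF _ _ h(3)]) (use \<xi> \<eta> in auto)
    moreover have "dist (D1 (D2 f) (\<xi>', \<eta>')) (D1 (D2 f) z) < e / 2"
      by (rule d(4), rule near[OF _ _ h(4)]) (use \<xi>' \<eta>' in auto)
    ultimately show ?thesis unfolding dist_real_def by linarith
  qed
  then have "\<bar>D2 (D1 f) z - D1 (D2 f) z\<bar> \<le> 0" by (rule field_le_epsilon)
  then show ?thesis by simp
qed

section \<open>Gas law and entropy pairs\<close>

text \<open>Bernoulli's law solved for \<open>q\<^sup>2\<close>, an explicit formula in place of the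
  definite description behind \<open>gas_q\<close>.\<close>

definition speed_sq :: "real \<Rightarrow> real \<Rightarrow> real" where
  "speed_sq \<gamma> r = (if \<gamma> = 1 then - 2 * ln r else 2 / (\<gamma> - 1) * (1 - r powr (\<gamma> - 1)))"

lemma gas_rho_inverse:
  assumes "1 \<le> \<gamma>" "0 \<le> q" "ereal q < q_cav \<gamma>"
  shows "0 < gas_rho \<gamma> q" "speed_sq \<gamma> (gas_rho \<gamma> q) = q\<^sup>2"
    and "0 < 1 - (\<gamma> - 1) / 2 * q\<^sup>2"
proof -
  have "0 < gas_rho \<gamma> q \<and> speed_sq \<gamma> (gas_rho \<gamma> q) = q\<^sup>2 \<and> 0 < 1 - (\<gamma> - 1) / 2 * q\<^sup>2"
  proof (cases "\<gamma> = 1")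
    case True
    then show ?thesis by (simp add: gas_rho_def speed_sq_def)
  next
    case False
    then have g: "\<gamma> > 1" using assms by simp
    have "q < sqrt (2 / (\<gamma> - 1))" using assms False by (simp add: q_cav_def)
    then have "q\<^sup>2 < (sqrt (2 / (\<gamma> - 1)))\<^sup>2" using assms by (intro power_strict_mono) auto
    then have "q\<^sup>2 < 2 / (\<gamma> - 1)" using g by simp
    then have pos: "0 < 1 - (\<gamma> - 1) / 2 * q\<^sup>2" using g by (simp add: field_simps)
    then show ?thesis using g False by (simp add: gas_rho_def speed_sq_def powr_powr)
  qed
  then show "0 < gas_rho \<gamma> q" "speed_sq \<gamma> (gas_rho \<gamma> q) = q\<^sup>2" "0 < 1 - (\<gamma> - 1) / 2 * q\<^sup>2" by auto
qed

lemma speed_sq_inverse: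
  assumes "1 \<le> \<gamma>" "0 < r" "r \<le> 1"
  shows "0 \<le> speed_sq \<gamma> r" "ereal (sqrt (speed_sq \<gamma> r)) < q_cav \<gamma>" "gas_rho \<gamma> (sqrt (speed_sq \<gamma> r)) = r"
    and "1 - (\<gamma> - 1) / 2 * speed_sq \<gamma> r = r powr (\<gamma> - 1)" "r < 1 \<Longrightarrow> 0 < speed_sq \<gamma> r"
proof -
  have "0 \<le> speed_sq \<gamma> r \<and> ereal (sqrt (speed_sq \<gamma> r)) < q_cav \<gamma> \<and> gas_rho \<gamma> (sqrt (speed_sq \<gamma> r)) = r
    \<and> 1 - (\<gamma> - 1) / 2 * speed_sq \<gamma> r = r powr (\<gamma> - 1) \<and> (r < 1 \<longrightarrow> 0 < speed_sq \<gamma> r)"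
  proof (cases "\<gamma> = 1")
    case True
    then show ?thesis using assms by (simp add: speed_sq_def q_cav_def gas_rho_def)
  next
    case False
    then have g: "\<gamma> > 1" using assms by simp
    have p: "0 < r powr (\<gamma> - 1)" using assms by simp
    have le: "r powr (\<gamma> - 1) \<le> 1" using assms g powr_mono2[of "\<gamma> - 1" r 1] by simp
    have lt: "r powr (\<gamma> - 1) < 1" if "r < 1" using that assms g powr_less_mono2[of "\<gamma> - 1" r 1] by simp
    have s: "speed_sq \<gamma> r = 2 / (\<gamma> - 1) * (1 - r powr (\<gamma> - 1))" using False by (simp add: speed_sq_def)
    have nn: "0 \<le> speed_sq \<gamma> r" unfolding s using g le by (intro mult_nonneg_nonneg) auto
    have "speed_sq \<gamma> r < 2 / (\<gamma> - 1)" unfolding s using g p by (simp add: field_simps)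
    then have "ereal (sqrt (speed_sq \<gamma> r)) < q_cav \<gamma>" using False by (simp add: q_cav_def)
    moreover have c: "1 - (\<gamma> - 1) / 2 * speed_sq \<gamma> r = r powr (\<gamma> - 1)" unfolding s using g by (simp add: field_simps)
    moreover have "gas_rho \<gamma> (sqrt (speed_sq \<gamma> r)) = r"
      using False g nn c assms by (simp add: gas_rho_def powr_powr)
    moreover have "0 < speed_sq \<gamma> r" if "r < 1" unfolding s using g lt[OF that] by (intro mult_pos_pos) auto
    ultimately show ?thesis using nn by blast
  qed
  then show "0 \<le> speed_sq \<gamma> r" "ereal (sqrt (speed_sq \<gamma> r)) < q_cav \<gamma>" "gas_rho \<gamma> (sqrt (speed_sq \<gamma> r)) = r"
    "1 - (\<gamma> - 1) / 2 * speed_sq \<gamma> r = r powr (\<gamma> - 1)" "r < 1 \<Longrightarrow> 0 < speed_sq \<gamma> r" by auto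
qed

lemma gas_q_eq:
  assumes "1 \<le> \<gamma>" "0 < r" "r \<le> 1"
  shows "gas_q \<gamma> r = sqrt (speed_sq \<gamma> r)"
  unfolding gas_q_def
proof (rule the_equality)
  show "0 \<le> sqrt (speed_sq \<gamma> r) \<and> ereal (sqrt (speed_sq \<gamma> r)) < q_cav \<gamma> \<and> gas_rho \<gamma> (sqrt (speed_sq \<gamma> r)) = r"
    using speed_sq_inverse[OF assms] by simp
next
  fix q assume "0 \<le> q \<and> ereal q < q_cav \<gamma> \<and> gas_rho \<gamma> q = r"
  then show "q = sqrt (speed_sq \<gamma> r)" using gas_rho_inverse(2)[OF assms(1), of q] by auto
qed

lemma gas_q_props:
  assumes "1 \<le> \<gamma>" "0 < r" "r \<le> 1"
  shows "0 \<le> gas_q \<gamma> r" "ereal (gas_q \<gamma> r) < q_cav \<gamma>" "gas_rho \<gamma> (gas_q \<gamma> r) = r"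
    and "(gas_c \<gamma> (gas_q \<gamma> r))\<^sup>2 = r powr (\<gamma> - 1)" "r < 1 \<Longrightarrow> 0 < gas_q \<gamma> r"
proof -
  note s = speed_sq_inverse[OF assms]
  show "0 \<le> gas_q \<gamma> r" "ereal (gas_q \<gamma> r) < q_cav \<gamma>" "gas_rho \<gamma> (gas_q \<gamma> r) = r" "r < 1 \<Longrightarrow> 0 < gas_q \<gamma> r"
    using s by (simp_all add: gas_q_eq[OF assms])
  have "(gas_q \<gamma> r)\<^sup>2 = speed_sq \<gamma> r" using s(1) by (simp add: gas_q_eq[OF assms])
  then have "gas_c \<gamma> (gas_q \<gamma> r) = sqrt (r powr (\<gamma> - 1))" using s(4) by (simp add: gas_c_def)
  then show "(gas_c \<gamma> (gas_q \<gamma> r))\<^sup>2 = r powr (\<gamma> - 1)" by simp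
qed

text \<open>Bernoulli's law \<open>dq/d\<rho> = - c\<^sup>2 / (\<rho> q)\<close>, with \<open>c\<^sup>2 = \<rho> powr (\<gamma> - 1)\<close>.\<close>
definition gas_q' :: "real \<Rightarrow> real \<Rightarrow> real" where
  "gas_q' \<gamma> r = - (r powr (\<gamma> - 1)) / (r * gas_q \<gamma> r)"

lemma gas_q_deriv:
  assumes "1 \<le> \<gamma>" "r \<in> {0<..<1}"
  shows "(gas_q \<gamma> has_real_derivative gas_q' \<gamma> r) (at r)"
proof -
  have r: "0 < r" "r < 1" "r \<le> 1" using assms by auto
  note s = speed_sq_inverse[OF assms(1) r(1,3)]
  have "(speed_sq \<gamma> has_real_derivative - 2 * (r powr (\<gamma> - 1)) / r) (at r)"
  proof (cases "\<gamma> = 1")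
    case True
    have "((\<lambda>r. - 2 * ln r) has_real_derivative - 2 * (r powr (\<gamma> - 1)) / r) (at r)"
      using r True by (auto intro!: derivative_eq_intros)
    then show ?thesis using True by (simp add: speed_sq_def[abs_def])
  next
    case False
    have "((\<lambda>r. 2 / (\<gamma> - 1) * (1 - r powr (\<gamma> - 1))) has_real_derivative
        2 / (\<gamma> - 1) * (0 - (\<gamma> - 1) * r powr (\<gamma> - 1 - 1))) (at r)"
      by (intro DERIV_cmult DERIV_diff DERIV_const has_real_derivative_powr r(1))
    moreover have "2 / (\<gamma> - 1) * (0 - (\<gamma> - 1) * r powr (\<gamma> - 1 - 1)) = - 2 * (r powr (\<gamma> - 1)) / r"
    proof -
      have e: "r powr (\<gamma> - 1 - 1) = r powr (\<gamma> - 1) / r" using r powr_diff[of r "\<gamma> - 1" 1] by simp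
      show ?thesis unfolding e using r False by (simp add: field_simps)
    qed
    ultimately have "((\<lambda>r. 2 / (\<gamma> - 1) * (1 - r powr (\<gamma> - 1))) has_real_derivative - 2 * (r powr (\<gamma> - 1)) / r) (at r)"
      by simp
    then show ?thesis using False by (simp add: speed_sq_def[abs_def])
  qed
  then have "((\<lambda>r. sqrt (speed_sq \<gamma> r)) has_real_derivative
      (inverse (sqrt (speed_sq \<gamma> r)) / 2) * (- 2 * (r powr (\<gamma> - 1)) / r)) (at r)"
    by (rule DERIV_chain2[rotated]) (rule DERIV_real_sqrt[OF s(5)[OF r(2)]])
  then have "((\<lambda>r. sqrt (speed_sq \<gamma> r)) has_real_derivative gas_q' \<gamma> r) (at r)"
    by (simp add: gas_q'_def gas_q_eq[OF assms(1) r(1,3)] field_simps)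
  then show ?thesis
    by (rule has_field_derivative_transform_within_open[of _ _ _ "{0<..<1}"])
      (use assms gas_q_eq[OF assms(1)] in auto)
qed

lemma continuous_gas_q: "1 \<le> \<gamma> \<Longrightarrow> continuous_on {0<..<1} (gas_q \<gamma>)"
  by (meson DERIV_isCont continuous_at_imp_continuous_on gas_q_deriv)

lemma continuous_gas_q': "1 \<le> \<gamma> \<Longrightarrow> continuous_on {0<..<1} (gas_q' \<gamma>)"
  unfolding gas_q'_def[abs_def]
  using gas_q_props(5) by (intro continuous_intros continuous_gas_q) (force simp: less_imp_le)+

lemma gas_rho_antimono:
  assumes "1 \<le> \<gamma>" "0 \<le> p" "p \<le> q" "ereal q < q_cav \<gamma>"
  shows "gas_rho \<gamma> q \<le> gas_rho \<gamma> p"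
proof -
  have pq: "p\<^sup>2 \<le> q\<^sup>2" using assms by (intro power_mono) auto
  show ?thesis
  proof (cases "\<gamma> = 1")
    case True
    then show ?thesis using pq by (simp add: gas_rho_def)
  next
    case False
    have "(\<gamma> - 1) / 2 * p\<^sup>2 \<le> (\<gamma> - 1) / 2 * q\<^sup>2" using pq assms by (intro mult_left_mono) auto
    then show ?thesis
      using False assms gas_rho_inverse(3)[OF assms(1) _ assms(4)] by (simp add: gas_rho_def powr_mono2)
  qed
qed

lemma gas_rho_less_1:
  assumes "1 \<le> \<gamma>" "0 < q" "ereal q < q_cav \<gamma>"
  shows "gas_rho \<gamma> q < 1"
proof (cases "\<gamma> = 1")
  case True
  then show ?thesis using assms by (simp add: gas_rho_def)
next
  case False
  have "(1 - (\<gamma> - 1) / 2 * q\<^sup>2) powr (1 / (\<gamma> - 1)) < 1 powr (1 / (\<gamma> - 1))"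
    using False assms gas_rho_inverse(3)[OF assms(1) _ assms(3)] by (intro powr_less_mono2) auto
  then show ?thesis using False by (simp add: gas_rho_def)
qed

text \<open>The states \<open>(\<rho>, \<theta>)\<close> with \<open>0 < q < q_cav\<close>.\<close>
abbreviation states :: "point set" where "states \<equiv> {0<..<1} \<times> UNIV"

lemma
  assumes "\<forall>r\<in>{0<..<1}. (g has_real_derivative g' r) (at r)" "continuous_on {0<..<1} g'"
  shows C1_on_states_fst: "C1_on states (\<lambda>w. g (fst w))"
    and D1_states_fst: "w \<in> states \<Longrightarrow> D1 (\<lambda>w. g (fst w)) w = g' (fst w)"
    and D2_states_fst: "w \<in> states \<Longrightarrow> D2 (\<lambda>w. g (fst w)) w = 0"
proof -
  have d: "w \<in> states \<Longrightarrow> (g has_real_derivative g' (fst w)) (at (fst w))" for w :: point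
    by (rule assms(1)[rule_format]) (auto simp: mem_Times_iff)
  have c: "continuous_on (fst ` states) g'" by (rule continuous_on_subset[OF assms(2)]) auto
  note x = C1_on_chain[OF C1_on_fst d c] D1_chain[OF C1_on_fst d c] D2_chain[OF C1_on_fst d c]
  show "C1_on states (\<lambda>w. g (fst w))" by (rule x(1))
  show "w \<in> states \<Longrightarrow> D1 (\<lambda>w. g (fst w)) w = g' (fst w)" "w \<in> states \<Longrightarrow> D2 (\<lambda>w. g (fst w)) w = 0"
    using x(2,3)[of w] by (simp_all add: D_fst)
qed

lemma
  shows C1_on_cos: "C1_on S (\<lambda>w. cos (snd w))" and C1_on_sin: "C1_on S (\<lambda>w. sin (snd w))"
    and D_cos: "w \<in> S \<Longrightarrow> D1 (\<lambda>w. cos (snd w)) w = 0" "w \<in> S \<Longrightarrow> D2 (\<lambda>w. cos (snd w)) w = - sin (snd w)"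
    and D_sin: "w \<in> S \<Longrightarrow> D1 (\<lambda>w. sin (snd w)) w = 0" "w \<in> S \<Longrightarrow> D2 (\<lambda>w. sin (snd w)) w = cos (snd w)"
proof -
  have c: "(cos has_real_derivative - sin (snd w)) (at (snd w))" "(sin has_real_derivative cos (snd w)) (at (snd w))" for w :: point
    by (auto intro!: derivative_eq_intros)
  have k: "continuous_on (snd ` S) (\<lambda>x. - sin x)" "continuous_on (snd ` S) cos" by (intro continuous_intros)+
  show "C1_on S (\<lambda>w. cos (snd w))" "C1_on S (\<lambda>w. sin (snd w))"
    by (rule C1_on_chain[OF C1_on_snd c(1) k(1)], rule C1_on_chain[OF C1_on_snd c(2) k(2)])
  show "w \<in> S \<Longrightarrow> D1 (\<lambda>w. cos (snd w)) w = 0" "w \<in> S \<Longrightarrow> D2 (\<lambda>w. cos (snd w)) w = - sin (snd w)"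
    using D1_chain[OF C1_on_snd c(1) k(1)] D2_chain[OF C1_on_snd c(1) k(1)] by (simp_all add: D_snd)
  show "w \<in> S \<Longrightarrow> D1 (\<lambda>w. sin (snd w)) w = 0" "w \<in> S \<Longrightarrow> D2 (\<lambda>w. sin (snd w)) w = cos (snd w)"
    using D1_chain[OF C1_on_snd c(2) k(2)] D2_chain[OF C1_on_snd c(2) k(2)] by (simp_all add: D_snd)
qed

text \<open>Velocity \<open>(u, v)\<close> and momentum \<open>(m, n) = \<rho> (u, v)\<close> as
  functions on state space, so that equations and entropy fluxes become compositions with the single
  map \<open>(\<rho>, \<theta>)\<close>.\<close>

definition st_u :: "real \<Rightarrow> point \<Rightarrow> real" where "st_u \<gamma> w = gas_q \<gamma> (fst w) * cos (snd w)"
definition st_v :: "real \<Rightarrow> point \<Rightarrow> real" where "st_v \<gamma> w = gas_q \<gamma> (fst w) * sin (snd w)"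
definition st_m :: "real \<Rightarrow> point \<Rightarrow> real" where "st_m \<gamma> w = fst w * st_u \<gamma> w"
definition st_n :: "real \<Rightarrow> point \<Rightarrow> real" where "st_n \<gamma> w = fst w * st_v \<gamma> w"

lemma
  assumes g: "1 \<le> \<gamma>"
  shows C1_on_st_u: "C1_on states (st_u \<gamma>)" and C1_on_st_v: "C1_on states (st_v \<gamma>)"
    and C1_on_st_m: "C1_on states (st_m \<gamma>)" and C1_on_st_n: "C1_on states (st_n \<gamma>)"
    and D1_st_u: "w \<in> states \<Longrightarrow> D1 (st_u \<gamma>) w = gas_q' \<gamma> (fst w) * cos (snd w)"
    and D2_st_u: "w \<in> states \<Longrightarrow> D2 (st_u \<gamma>) w = - (gas_q \<gamma> (fst w) * sin (snd w))"
    and D1_st_v: "w \<in> states \<Longrightarrow> D1 (st_v \<gamma>) w = gas_q' \<gamma> (fst w) * sin (snd w)"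
    and D2_st_v: "w \<in> states \<Longrightarrow> D2 (st_v \<gamma>) w = gas_q \<gamma> (fst w) * cos (snd w)"
    and D1_st_m: "w \<in> states \<Longrightarrow> D1 (st_m \<gamma>) w = (gas_q \<gamma> (fst w) + fst w * gas_q' \<gamma> (fst w)) * cos (snd w)"
    and D2_st_m: "w \<in> states \<Longrightarrow> D2 (st_m \<gamma>) w = - (fst w * gas_q \<gamma> (fst w) * sin (snd w))"
    and D1_st_n: "w \<in> states \<Longrightarrow> D1 (st_n \<gamma>) w = (gas_q \<gamma> (fst w) + fst w * gas_q' \<gamma> (fst w)) * sin (snd w)"
    and D2_st_n: "w \<in> states \<Longrightarrow> D2 (st_n \<gamma>) w = fst w * gas_q \<gamma> (fst w) * cos (snd w)"
proof -
  have "\<forall>r\<in>{0<..<1}. (gas_q \<gamma> has_real_derivative gas_q' \<gamma> r) (at r)" using gas_q_deriv[OF g] by blast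
  note q = this continuous_gas_q'[OF g]
  note Q = C1_on_states_fst[OF q] and DQ = D1_states_fst[OF q] D2_states_fst[OF q]
  note u = Q C1_on_cos and v = Q C1_on_sin
  show U: "C1_on states (st_u \<gamma>)" unfolding st_u_def[abs_def] by (rule C1_on_mult[OF u])
  show V: "C1_on states (st_v \<gamma>)" unfolding st_v_def[abs_def] by (rule C1_on_mult[OF v])
  show "C1_on states (st_m \<gamma>)" unfolding st_m_def[abs_def] by (rule C1_on_mult[OF C1_on_fst U])
  show "C1_on states (st_n \<gamma>)" unfolding st_n_def[abs_def] by (rule C1_on_mult[OF C1_on_fst V])
  show u1: "w \<in> states \<Longrightarrow> D1 (st_u \<gamma>) w = gas_q' \<gamma> (fst w) * cos (snd w)" for w
    unfolding st_u_def[abs_def] by (simp add: D1_mult[OF u] DQ D_cos)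
  show u2: "w \<in> states \<Longrightarrow> D2 (st_u \<gamma>) w = - (gas_q \<gamma> (fst w) * sin (snd w))" for w
    unfolding st_u_def[abs_def] by (simp add: D2_mult[OF u] DQ D_cos)
  show v1: "w \<in> states \<Longrightarrow> D1 (st_v \<gamma>) w = gas_q' \<gamma> (fst w) * sin (snd w)" for w
    unfolding st_v_def[abs_def] by (simp add: D1_mult[OF v] DQ D_sin)
  show v2: "w \<in> states \<Longrightarrow> D2 (st_v \<gamma>) w = gas_q \<gamma> (fst w) * cos (snd w)" for w
    unfolding st_v_def[abs_def] by (simp add: D2_mult[OF v] DQ D_sin)
  show "w \<in> states \<Longrightarrow> D1 (st_m \<gamma>) w = (gas_q \<gamma> (fst w) + fst w * gas_q' \<gamma> (fst w)) * cos (snd w)"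
    "w \<in> states \<Longrightarrow> D2 (st_m \<gamma>) w = - (fst w * gas_q \<gamma> (fst w) * sin (snd w))"
    unfolding st_m_def[abs_def]
    by (subst D1_mult[OF C1_on_fst U] D2_mult[OF C1_on_fst U], assumption,
        simp add: D_fst u1 u2 st_u_def algebra_simps)+
  show "w \<in> states \<Longrightarrow> D1 (st_n \<gamma>) w = (gas_q \<gamma> (fst w) + fst w * gas_q' \<gamma> (fst w)) * sin (snd w)"
    "w \<in> states \<Longrightarrow> D2 (st_n \<gamma>) w = fst w * gas_q \<gamma> (fst w) * cos (snd w)"
    unfolding st_n_def[abs_def]
    by (subst D1_mult[OF C1_on_fst V] D2_mult[OF C1_on_fst V], assumption,
        simp add: D_fst v1 v2 st_v_def algebra_simps)+
qed

text \<open>\<open>a\<close> and \<open>b\<close> are the multipliers with which the entropy balance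
  \<open>Q1\<^sub>x + Q2\<^sub>y = a ((\<rho> u)\<^sub>x + (\<rho> v)\<^sub>y) + b (v\<^sub>x - u\<^sub>y)\<close> follows from the two equations.\<close>
definition entropy_pair :: "real \<Rightarrow> (point \<Rightarrow> real) \<Rightarrow> (point \<Rightarrow> real) \<Rightarrow> (point \<Rightarrow> real) \<Rightarrow> (point \<Rightarrow> real) \<Rightarrow> bool" where
  "entropy_pair \<gamma> Q1 Q2 a b \<longleftrightarrow> C1_on states Q1 \<and> C1_on states Q2 \<and> C1_on states a \<and> C1_on states b \<and>
     (\<forall>w\<in>states. D1 Q1 w = a w * D1 (st_m \<gamma>) w + b w * D1 (st_v \<gamma>) w \<and>
        D2 Q1 w = a w * D2 (st_m \<gamma>) w + b w * D2 (st_v \<gamma>) w \<and>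
        D1 Q2 w = a w * D1 (st_n \<gamma>) w - b w * D1 (st_u \<gamma>) w \<and>
        D2 Q2 w = a w * D2 (st_n \<gamma>) w - b w * D2 (st_u \<gamma>) w)"

text \<open>The pair generated by \<open>H = \<theta>\<^sup>2 / 2 + g(\<mu>)\<close>, whose multipliers make both viscous terms dissipative.\<close>
lemma energy_pair_exists:
  assumes g: "1 \<le> \<gamma>"
  obtains Q1 Q2 a where "entropy_pair \<gamma> Q1 Q2 a (\<lambda>w. - snd w)"
    "\<And>w. w \<in> states \<Longrightarrow> D1 a w = - ((gas_c \<gamma> (gas_q \<gamma> (fst w)))\<^sup>2 / (gas_q \<gamma> (fst w) * fst w)\<^sup>2)"
    "\<And>w. w \<in> states \<Longrightarrow> D2 a w = 0"
proof -
  \<comment> \<open>The derivative of the multiplier. For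
    \<open>H = \<theta>\<^sup>2 / 2 + g(\<mu>)\<close> the entropy equation reads
    \<open>g'' = - (1 - M\<^sup>2) / \<rho>\<^sup>2\<close>. With
    \<open>d\<mu>/d\<rho> = c\<^sup>2 / q\<^sup>2\<close> the \<open>\<rho>\<close>-derivative of
    \<open>g'\<close> is \<open>1 / \<rho>\<^sup>2 - c\<^sup>2 / (\<rho> q)\<^sup>2\<close>, and the
    multiplier is \<open>g' + 1 / \<rho>\<close>.\<close>
  define f where "f = (\<lambda>r. - (r powr (\<gamma> - 1) / (gas_q \<gamma> r * r)\<^sup>2))"
  have fc: "continuous_on {0<..<1} f"
    unfolding f_def using gas_q_props(5)[OF g] by (intro continuous_intros continuous_gas_q[OF g]) (force simp: less_imp_le)+
  \<comment> \<open>\<open>f\<close> is singular at \<open>r = 1\<close>, where \<open>q\<close>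
    vanishes, so the antiderivative is taken on the open interval only.\<close>
  have "\<exists>F. \<forall>x::real. ereal 0 < ereal x \<longrightarrow> ereal x < ereal 1 \<longrightarrow> (F has_vector_derivative f x) (at x)"
  proof (rule einterval_antiderivative)
    fix x assume "ereal 0 < ereal x" "ereal x < ereal 1"
    then show "isCont f x" using fc by (simp add: continuous_on_eq_continuous_at)
  qed simp
  then obtain A where A0: "\<forall>x::real. ereal 0 < ereal x \<longrightarrow> ereal x < ereal 1 \<longrightarrow> (A has_vector_derivative f x) (at x)"
    by (elim exE)
  have "\<forall>x\<in>{0<..<1}. (A has_real_derivative f x) (at x)"
    using A0 by (simp add: has_real_derivative_iff_has_vector_derivative)
  note A = this fc
  let ?a = "\<lambda>w::point. A (fst w)"
  note a1 = C1_on_states_fst[OF A] and da = D1_states_fst[OF A] D2_states_fst[OF A]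
  have i: "\<forall>r\<in>{0<..<1}. ((\<lambda>r. 1 / r) has_real_derivative - 1 / r\<^sup>2) (at r)"
    by (auto intro!: derivative_eq_intros simp: power2_eq_square)
  have ic: "continuous_on {0<..<1} (\<lambda>r::real. - 1 / r\<^sup>2)" by (intro continuous_intros) auto
  note i1 = C1_on_states_fst[OF i ic] and di = D1_states_fst[OF i ic] D2_states_fst[OF i ic]
  note G = C1_on_diff[OF a1 i1]
  have dG: "D1 (\<lambda>w. A (fst w) - 1 / fst w) w = f (fst w) + 1 / (fst w)\<^sup>2" "D2 (\<lambda>w. A (fst w) - 1 / fst w) w = 0"
    if "w \<in> states" for w
    by (simp_all add: D1_diff[OF a1 i1 that] D2_diff[OF a1 i1 that] da[OF that] di[OF that])
  note m = G C1_on_st_m[OF g] and n = G C1_on_st_n[OF g]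
  note v = C1_on_snd C1_on_st_v[OF g] and u = C1_on_snd C1_on_st_u[OF g]
  note m' = C1_on_mult[OF m] and n' = C1_on_mult[OF n] and v' = C1_on_mult[OF v] and u' = C1_on_mult[OF u]
  \<comment> \<open>Here \<open>A - 1 / \<rho>\<close> is \<open>H_\<mu>\<close>, and
    \<open>H_\<theta> = \<theta>\<close>.\<close>
  let ?Q1 = "\<lambda>w. (A (fst w) - 1 / fst w) * st_m \<gamma> w - snd w * st_v \<gamma> w"
  let ?Q2 = "\<lambda>w. (A (fst w) - 1 / fst w) * st_n \<gamma> w + snd w * st_u \<gamma> w"
  \<comment> \<open>Differentiating \<open>H_\<mu>\<close> produces exactly
    \<open>1 / \<rho>\<close> times the derivative of the momentum, which raises the multiplier from
    \<open>A - 1 / \<rho>\<close> to \<open>A\<close>.\<close>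
  have key: "r * (gas_q \<gamma> r * (f r + 1 / r\<^sup>2)) = (gas_q \<gamma> r + r * gas_q' \<gamma> r) / r" if "r \<in> {0<..<1}" for r
  proof -
    have "r > 0" "gas_q \<gamma> r > 0" using that gas_q_props(5)[OF g, of r] by auto
    then show ?thesis by (simp add: f_def gas_q'_def field_simps power2_eq_square)
  qed
  have "entropy_pair \<gamma> ?Q1 ?Q2 ?a (\<lambda>w. - snd w)"
    unfolding entropy_pair_def
  proof (intro conjI ballI)
    show "C1_on states ?Q1" by (rule C1_on_diff[OF m' v'])
    show "C1_on states ?Q2" by (rule C1_on_add[OF n' u'])
    show "C1_on states ?a" by (rule a1)
    show "C1_on states (\<lambda>w. - snd w)" by (rule C1_on_uminus[OF C1_on_snd])
    fix w :: point assume w: "w \<in> states"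
    then have r: "fst w \<in> {0<..<1}" "fst w \<noteq> 0" by (auto simp: mem_Times_iff)
    note k = key[OF r(1)]
    have "D1 ?Q1 w = (A (fst w) - 1 / fst w) * D1 (st_m \<gamma>) w + (fst w * (gas_q \<gamma> (fst w) * (f (fst w) + 1 / (fst w)\<^sup>2))) * cos (snd w) - snd w * D1 (st_v \<gamma>) w"
      unfolding D1_diff[OF m' v' w] D1_mult[OF m w] D1_mult[OF v w] dG[OF w] D_snd by (simp add: st_m_def st_u_def)
    also have "\<dots> = A (fst w) * D1 (st_m \<gamma>) w + - snd w * D1 (st_v \<gamma>) w"
      unfolding k D1_st_m[OF g w] using r(2) by (simp add: field_simps)
    finally show "D1 ?Q1 w = A (fst w) * D1 (st_m \<gamma>) w + - snd w * D1 (st_v \<gamma>) w" .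
    show "D2 ?Q1 w = A (fst w) * D2 (st_m \<gamma>) w + - snd w * D2 (st_v \<gamma>) w"
      unfolding D2_diff[OF m' v' w] D2_mult[OF m w] D2_mult[OF v w] dG[OF w] D_snd D2_st_m[OF g w]
      using r by (simp add: st_v_def algebra_simps)
    have "D1 ?Q2 w = (A (fst w) - 1 / fst w) * D1 (st_n \<gamma>) w + (fst w * (gas_q \<gamma> (fst w) * (f (fst w) + 1 / (fst w)\<^sup>2))) * sin (snd w) + snd w * D1 (st_u \<gamma>) w"
      unfolding D1_add[OF n' u' w] D1_mult[OF n w] D1_mult[OF u w] dG[OF w] D_snd by (simp add: st_n_def st_v_def)
    also have "\<dots> = A (fst w) * D1 (st_n \<gamma>) w - - snd w * D1 (st_u \<gamma>) w"
      unfolding k D1_st_n[OF g w] using r(2) by (simp add: field_simps)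
    finally show "D1 ?Q2 w = A (fst w) * D1 (st_n \<gamma>) w - - snd w * D1 (st_u \<gamma>) w" .
    show "D2 ?Q2 w = A (fst w) * D2 (st_n \<gamma>) w - - snd w * D2 (st_u \<gamma>) w"
      unfolding D2_add[OF n' u' w] D2_mult[OF n w] D2_mult[OF u w] dG[OF w] D_snd D2_st_n[OF g w]
      using r by (simp add: st_u_def algebra_simps)
  qed
  moreover have "D1 ?a w = - ((gas_c \<gamma> (gas_q \<gamma> (fst w)))\<^sup>2 / (gas_q \<gamma> (fst w) * fst w)\<^sup>2)" "D2 ?a w = 0" if "w \<in> states" for w
    using that gas_q_props(4)[OF g, of "fst w"] by (auto simp: da f_def mem_Times_iff)
  ultimately show ?thesis using that by blast
qed

lemma C_on_SucD: "C_on (Suc k) S f \<Longrightarrow> C_on k S (D1 f)" "C_on (Suc k) S f \<Longrightarrow> C_on k S (D2 f)"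
  by simp_all

text \<open>The multipliers are \<open>a = H_\<mu> + H_\<theta>\<theta> / \<rho>\<close> and
  \<open>b = \<rho> H_\<mu>\<theta> - H_\<theta>\<close>. The entropy equation rewrites the
  \<open>\<rho>\<close>-derivative of \<open>H_\<mu>\<close>, and symmetry of second derivatives
  that of \<open>H_\<theta>\<close>. Both multipliers contain second derivatives of
  \<open>H\<close>, so the class C^3 is what makes them C^1.\<close>

lemma entropy_generator_pair:
  assumes g: "1 \<le> \<gamma>" and \<mu>: "mu_function \<gamma> \<mu>" and H: "entropy_generator \<gamma> \<mu> H"
  obtains a b where
    "entropy_pair \<gamma> (\<lambda>w. entropy_Q1 \<gamma> \<mu> H (fst w) (snd w)) (\<lambda>w. entropy_Q2 \<gamma> \<mu> H (fst w) (snd w)) a b"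
proof -
  define \<mu>' where "\<mu>' = (\<lambda>r. (gas_c \<gamma> (gas_q \<gamma> r))\<^sup>2 / (gas_q \<gamma> r)\<^sup>2)"
  have m1: "(\<mu> has_real_derivative \<mu>' r) (at r)" if "r \<in> {0<..<1}" for r
    using \<mu> that unfolding mu_function_def \<mu>'_def by blast
  have e\<mu>: "\<mu>' r = r powr (\<gamma> - 1) / (gas_q \<gamma> r)\<^sup>2" if "r \<in> {0<..<1}" for r
    using that gas_q_props(4)[OF g, of r] by (simp add: \<mu>'_def)
  have pos: "\<mu>' r > 0" if "r \<in> {0<..<1}" for r
    using that gas_q_props(5)[OF g, of r] by (simp add: e\<mu>)
  have "continuous_on {0<..<1} (\<lambda>r. r powr (\<gamma> - 1) / (gas_q \<gamma> r)\<^sup>2)"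
    using gas_q_props(5)[OF g] by (intro continuous_intros continuous_gas_q[OF g]) (force simp: less_imp_le)+
  then have m2: "continuous_on {0<..<1} \<mu>'" by (rule continuous_on_eq) (rule e\<mu>[symmetric])
  have m1': "\<forall>r\<in>{0<..<1}. (\<mu> has_real_derivative \<mu>' r) (at r)" using m1 by blast
  have mono: "\<mu> x < \<mu> y" if "x \<in> {0<..<1}" "y \<in> {0<..<1}" "x < y" for x y
    by (rule DERIV_pos_imp_increasing[OF that(3)]) (use m1 pos that in fastforce)
  have inj: "inj_on \<mu> {0<..<1}"
    by (rule inj_onI) (metis mono less_irrefl linorder_neqE_linordered_idom)
  let ?S = "\<mu> ` {0<..<1} \<times> UNIV :: point set"
  \<comment> \<open>Derivatives of \<open>H\<close> at the points of the strip call for an open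
    strip. \<open>\<mu>\<close> is continuous and strictly increasing, so invariance of domain
    applies.\<close>
  have "open (\<mu> ` {0<..<1})"
  proof (rule invariance_of_domain)
    show "continuous_on {0<..<1} \<mu>" by (meson DERIV_isCont continuous_at_imp_continuous_on m1)
  qed (use inj in auto)
  then have S: "open ?S" by (intro open_Times) auto
  have C3: "C_upto (Suc (Suc (Suc 0))) ?S {} H" using H unfolding entropy_generator_def numeral_3_eq_3 by blast
  note C2 = C_on_SucD[OF C3]
  note C = C1_on_C_upto[OF C3 S] C1_on_C_upto[OF C2(1) S] C1_on_C_upto[OF C2(2) S]
    C1_on_C_upto[OF C_on_SucD(2)[OF C2(1)] S] C1_on_C_upto[OF C_on_SucD(2)[OF C2(2)] S]
  have PDE: "D1 (D1 H) (\<mu> r, t) = - (1 / r\<^sup>2 * (1 - (mach \<gamma> (gas_q \<gamma> r))\<^sup>2) * D2 (D2 H) (\<mu> r, t))"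
    if "r \<in> {0<..<1}" for r t
    using H that unfolding entropy_generator_def by (simp add: eq_neg_iff_add_eq_0)
  note M = C1_on_states_fst[OF m1' m2] and dM = D1_states_fst[OF m1' m2] D2_states_fst[OF m1' m2]
  have inS: "w \<in> states \<Longrightarrow> (\<mu> (fst w), snd w) \<in> ?S" for w :: point by (auto simp: mem_Times_iff)
  define N where "N = (\<lambda>w::point. (\<mu> (fst w), snd w))"
  have ch: "C1_on states (\<lambda>w. F (N w))"
    "w \<in> states \<Longrightarrow> D1 (\<lambda>w. F (N w)) w = D1 F (N w) * \<mu>' (fst w)"
    "w \<in> states \<Longrightarrow> D2 (\<lambda>w. F (N w)) w = D2 F (N w)" if "C1_on ?S F" for F w
    unfolding N_def
    using C1_on_chain2[OF M C1_on_snd that inS] D1_chain2[OF M C1_on_snd that inS] D2_chain2[OF M C1_on_snd that inS]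
    by (simp_all add: dM D_snd)
  define X where "X = (\<lambda>w. D1 H (N w))"
  define Y where "Y = (\<lambda>w. D2 H (N w))"
  define Z where "Z = (\<lambda>w. D2 (D1 H) (N w))"
  define V where "V = (\<lambda>w. D2 (D2 H) (N w))"
  have CX: "C1_on states X" "C1_on states Y" "C1_on states Z" "C1_on states V"
    unfolding X_def Y_def Z_def V_def using ch(1) C by blast+
  have dX: "D1 X w = - (1 / (fst w)\<^sup>2 * (1 - (mach \<gamma> (gas_q \<gamma> (fst w)))\<^sup>2) * V w) * \<mu>' (fst w)" "D2 X w = Z w"
    "D1 Y w = Z w * \<mu>' (fst w)" "D2 Y w = V w" if w: "w \<in> states" for w
  proof -
    have r: "fst w \<in> {0<..<1}" using w by (auto simp: mem_Times_iff)
    show "D1 X w = - (1 / (fst w)\<^sup>2 * (1 - (mach \<gamma> (gas_q \<gamma> (fst w)))\<^sup>2) * V w) * \<mu>' (fst w)" "D2 X w = Z w"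
      "D2 Y w = V w"
      unfolding X_def Y_def Z_def V_def
      using ch(2,3)[OF C(2) w] ch(3)[OF C(3) w] PDE[OF r, of "snd w"] by (simp_all add: N_def)
    have "D1 (D2 H) (N w) = D2 (D1 H) (N w)"
      by (rule mixed_partials_eq[OF S C(1-3), symmetric]) (use inS[OF w] in \<open>simp add: N_def\<close>)
    then show "D1 Y w = Z w * \<mu>' (fst w)" unfolding Y_def Z_def using ch(2)[OF C(3) w] by simp
  qed
  have i: "\<forall>r\<in>{0<..<1}. ((\<lambda>r. 1 / r) has_real_derivative - 1 / r\<^sup>2) (at r)"
    by (auto intro!: derivative_eq_intros simp: power2_eq_square)
  have ic: "continuous_on {0<..<1} (\<lambda>r::real. - 1 / r\<^sup>2)" by (intro continuous_intros) auto
  note i1 = C1_on_states_fst[OF i ic]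
  let ?a = "\<lambda>w. X w + 1 / fst w * V w" and ?b = "\<lambda>w. fst w * Z w - Y w"
  have Q1: "(\<lambda>w. entropy_Q1 \<gamma> \<mu> H (fst w) (snd w)) = (\<lambda>w. st_m \<gamma> w * X w - st_v \<gamma> w * Y w)"
    and Q2: "(\<lambda>w. entropy_Q2 \<gamma> \<mu> H (fst w) (snd w)) = (\<lambda>w. st_n \<gamma> w * X w + st_u \<gamma> w * Y w)"
    by (simp_all add: fun_eq_iff entropy_Q1_def entropy_Q2_def st_m_def st_n_def st_u_def st_v_def X_def Y_def N_def)
  note mX = C1_on_st_m[OF g] CX(1) and vY = C1_on_st_v[OF g] CX(2) and nX = C1_on_st_n[OF g] CX(1) and uY = C1_on_st_u[OF g] CX(2)
  note mX' = C1_on_mult[OF mX] and vY' = C1_on_mult[OF vY] and nX' = C1_on_mult[OF nX] and uY' = C1_on_mult[OF uY]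
  have "entropy_pair \<gamma> (\<lambda>w. entropy_Q1 \<gamma> \<mu> H (fst w) (snd w)) (\<lambda>w. entropy_Q2 \<gamma> \<mu> H (fst w) (snd w)) ?a ?b"
    unfolding entropy_pair_def Q1 Q2
  proof (intro conjI ballI)
    show "C1_on states (\<lambda>w. st_m \<gamma> w * X w - st_v \<gamma> w * Y w)" by (rule C1_on_diff[OF mX' vY'])
    show "C1_on states (\<lambda>w. st_n \<gamma> w * X w + st_u \<gamma> w * Y w)" by (rule C1_on_add[OF nX' uY'])
    show "C1_on states ?a" by (rule C1_on_add[OF CX(1) C1_on_mult[OF i1 CX(4)]])
    show "C1_on states ?b" by (rule C1_on_diff[OF C1_on_mult[OF C1_on_fst CX(3)] CX(2)])
    fix w :: point assume w: "w \<in> states"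
    define r where "r = fst w"
    define q where "q = gas_q \<gamma> r"
    define c where "c = r powr (\<gamma> - 1)"
    have r: "r \<in> {0<..<1}" "r > 0" using w by (auto simp: mem_Times_iff r_def)
    have q0: "q > 0" using gas_q_props(5)[OF g, of r] r by (simp add: q_def)
    have c0: "c > 0" using r by (simp add: c_def)
    have gc: "(gas_c \<gamma> q)\<^sup>2 = c" using gas_q_props(4)[OF g, of r] r by (simp add: q_def c_def)
    have mach: "(mach \<gamma> q)\<^sup>2 = q\<^sup>2 / c" by (simp add: mach_def power_divide gc)
    have \<mu>r: "\<mu>' r = c / q\<^sup>2" using e\<mu>[OF r(1)] by (simp add: q_def c_def)
    have qr: "gas_q' \<gamma> r = - c / (r * q)" by (simp add: gas_q'_def q_def c_def)
    note d = D1_st_m[OF g w] D2_st_m[OF g w] D1_st_n[OF g w] D2_st_n[OF g w] D1_st_u[OF g w] D2_st_u[OF g w] D1_st_v[OF g w] D2_st_v[OF g w]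
      st_m_def[of \<gamma> w] st_n_def[of \<gamma> w] st_u_def[of \<gamma> w] st_v_def[of \<gamma> w] dX[OF w]
    note d' = d[folded r_def, folded q_def, unfolded mach \<mu>r qr]
    \<comment> \<open>The entropy equation after inserting \<open>\<mu>' = c / q\<^sup>2\<close> and
      \<open>q' = - c / (\<rho> q)\<close>, where \<open>c\<close> denotes the square of the sound
      speed; \<open>eqs2\<close> is the identity \<open>q \<mu>' = - \<rho> q'\<close>.
      \<open>C\<close> stands for the cosine or the sine of the angle.\<close>
    have eqs: "r * (q * C) * (- (1 / r\<^sup>2 * (1 - q\<^sup>2 / c) * W) * (c / q\<^sup>2)) = 1 / r * W * ((q + r * (- c / (r * q))) * C)" for C W
      using r(2) q0 c0 by (simp add: field_simps power2_eq_square)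
    have eqs2: "q * C * (W * (c / q\<^sup>2)) = - (r * W * (- c / (r * q) * C))" for C W
      using r(2) q0 by (simp add: field_simps power2_eq_square)
    have "D1 (\<lambda>w. st_m \<gamma> w * X w - st_v \<gamma> w * Y w) w
      = st_m \<gamma> w * D1 X w + X w * D1 (st_m \<gamma>) w - (st_v \<gamma> w * D1 Y w + Y w * D1 (st_v \<gamma>) w)"
      by (simp add: D1_diff[OF mX' vY' w] D1_mult[OF mX w] D1_mult[OF vY w])
    also have "st_m \<gamma> w * D1 X w = 1 / r * V w * D1 (st_m \<gamma>) w" unfolding d' by (rule eqs)
    also have "st_v \<gamma> w * D1 Y w = - (r * Z w * D1 (st_v \<gamma>) w)" unfolding d' by (rule eqs2)
    finally show "D1 (\<lambda>w. st_m \<gamma> w * X w - st_v \<gamma> w * Y w) w = ?a w * D1 (st_m \<gamma>) w + ?b w * D1 (st_v \<gamma>) w"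
      unfolding r_def[symmetric] by (simp add: algebra_simps)
    have "D1 (\<lambda>w. st_n \<gamma> w * X w + st_u \<gamma> w * Y w) w
      = st_n \<gamma> w * D1 X w + X w * D1 (st_n \<gamma>) w + (st_u \<gamma> w * D1 Y w + Y w * D1 (st_u \<gamma>) w)"
      by (simp add: D1_add[OF nX' uY' w] D1_mult[OF nX w] D1_mult[OF uY w])
    also have "st_n \<gamma> w * D1 X w = 1 / r * V w * D1 (st_n \<gamma>) w" unfolding d' by (rule eqs)
    also have "st_u \<gamma> w * D1 Y w = - (r * Z w * D1 (st_u \<gamma>) w)" unfolding d' by (rule eqs2)
    finally show "D1 (\<lambda>w. st_n \<gamma> w * X w + st_u \<gamma> w * Y w) w = ?a w * D1 (st_n \<gamma>) w - ?b w * D1 (st_u \<gamma>) w"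
      unfolding r_def[symmetric] by (simp add: algebra_simps)
    show "D2 (\<lambda>w. st_m \<gamma> w * X w - st_v \<gamma> w * Y w) w = ?a w * D2 (st_m \<gamma>) w + ?b w * D2 (st_v \<gamma>) w"
      unfolding D2_diff[OF mX' vY' w] D2_mult[OF mX w] D2_mult[OF vY w] r_def[symmetric] d'
      using r(2) by (simp add: field_simps)
    show "D2 (\<lambda>w. st_n \<gamma> w * X w + st_u \<gamma> w * Y w) w = ?a w * D2 (st_n \<gamma>) w - ?b w * D2 (st_u \<gamma>) w"
      unfolding D2_add[OF nX' uY' w] D2_mult[OF nX w] D2_mult[OF uY w] r_def[symmetric] d'
      using r(2) by (simp add: field_simps)
  qed
  then show ?thesis by (rule that)
qed

section \<open>Local energy estimate\<close>

lemma nsq_norm: "nsq z = (norm z)\<^sup>2"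
  by (simp add: nsq_def norm_prod_def)

lemma C1_on_sum:
  assumes "finite I" "\<And>i. i \<in> I \<Longrightarrow> C1_on S (f i)"
  shows "C1_on S (\<lambda>z. \<Sum>i\<in>I. f i z)"
  using assms by (induction I rule: finite_induct) (simp_all add: C1_on_const C1_on_add)

text \<open>A sum of bumps over a finite cover is positive on \<open>K\<close>, hence at least some
  \<open>m > 0\<close> there. Composition with \<open>1 - (max 0 (1 - u))\<^sup>2\<close> at
  \<open>u = S / m\<close> flattens it to 1 on \<open>K\<close> and keeps it C^1.\<close>

lemma C1_cutoff:
  assumes "compact K" "open \<Omega>" "K \<subseteq> \<Omega>"
  obtains \<eta> :: "point \<Rightarrow> real" where "C1_on UNIV \<eta>" "bounded (supp \<eta>)" "closure (supp \<eta>) \<subseteq> \<Omega>"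
    "\<And>z. z \<in> K \<Longrightarrow> \<eta> z = 1" "\<And>z. 0 \<le> \<eta> z" "\<And>z. \<eta> z \<le> 1"
proof -
  have "\<forall>x\<in>K. \<exists>r>0. cball x r \<subseteq> \<Omega>" using assms open_contains_cball by blast
  then obtain r where r: "\<And>x. x \<in> K \<Longrightarrow> r x > 0" "\<And>x. x \<in> K \<Longrightarrow> cball x (r x) \<subseteq> \<Omega>" by metis
  have "K \<subseteq> (\<Union>x\<in>K. ball x (r x))" using r(1) by auto
  then obtain I where I: "I \<subseteq> K" "finite I" "K \<subseteq> (\<Union>x\<in>I. ball x (r x))"
    using compactE_image[OF assms(1), of K "\<lambda>x. ball x (r x)"] by auto
  define S where "S = (\<lambda>z. \<Sum>x\<in>I. bump (r x) (x - z))"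
  have S1: "C1_on UNIV S" unfolding S_def by (rule C1_on_sum[OF I(2) C1_on_reflect[OF C1_on_bump]])
  have nn: "0 \<le> bump (r x) (x - z)" if "x \<in> I" for x z using bump_nonneg r(1) I(1) that by blast
  have S0: "0 \<le> S z" for z unfolding S_def using nn by (rule sum_nonneg)
  have Spos: "0 < S z" if z: "z \<in> K" for z
  proof -
    obtain x where x: "x \<in> I" "z \<in> ball x (r x)" using I(3) z by blast
    have "nsq (x - z) < (r x)\<^sup>2" unfolding nsq_norm using x(2) by (intro power_strict_mono) (auto simp: dist_norm)
    then have "nsq (x - z) / (r x)\<^sup>2 < 1" using r(1)[of x] x(1) I(1) by auto
    moreover have "r x > 0" using r(1) x(1) I(1) by blast
    ultimately have "0 < bump (r x) (x - z)" unfolding bump_def by (intro mult_pos_pos) auto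
    then show ?thesis unfolding S_def using x(1) nn by (intro sum_pos2[OF I(2) x(1)]) auto
  qed
  have Ssupp: "z \<in> (\<Union>x\<in>I. cball x (r x))" if z: "S z \<noteq> 0" for z
  proof -
    have "\<exists>x\<in>I. bump (r x) (x - z) \<noteq> 0"
    proof (rule ccontr)
      assume "\<not> ?thesis"
      then have "\<forall>x\<in>I. bump (r x) (x - z) = 0" by blast
      then have "S z = 0" unfolding S_def by (rule sum.neutral)
      with z show False ..
    qed
    then obtain x where x: "x \<in> I" "bump (r x) (x - z) \<noteq> 0" by (elim bexE)
    have rx: "r x > 0" using r(1) x(1) I(1) by blast
    have "nsq (x - z) / (r x)\<^sup>2 < 1" using x(2) by (auto simp: bump_def max_def split: if_splits)
    then have "(norm (x - z))\<^sup>2 \<le> (r x)\<^sup>2" using rx by (simp add: nsq_norm[symmetric])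
    then have "norm (x - z) \<le> r x" by (rule power2_le_imp_le) (use rx in simp)
    then show ?thesis using x(1) by (auto simp: dist_norm)
  qed
  obtain m where m: "m > 0" "\<And>z. z \<in> K \<Longrightarrow> m \<le> S z"
  proof (cases "K = {}")
    case False
    obtain x where "x \<in> K" "\<forall>y\<in>K. S x \<le> S y"
      using continuous_attains_inf[OF assms(1) False continuous_on_subset[OF C1_onD(4)[OF S1]]] by auto
    then show ?thesis using Spos that[of "S x"] by blast
  qed (use that[of 1] in auto)
  define \<eta> where "\<eta> = (\<lambda>z. 1 - (max 0 (1 - 1 / m * S z))\<^sup>2)"
  have c: "C1_on UNIV \<eta>"
    unfolding \<eta>_def
    by (rule C1_on_diff[OF C1_on_const C1_on_chain[OF C1_on_cmult[OF S1] DERIV_max_sq]]) (intro continuous_intros)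
  have u: "0 \<le> 1 / m * S z" for z using S0 m(1) by simp
  have cs: "supp \<eta> \<subseteq> (\<Union>x\<in>I. cball x (r x))" 
  proof
    fix z assume z: "z \<in> supp \<eta>"
    have "S z \<noteq> 0"
    proof
      assume "S z = 0"
      then have "\<eta> z = 0" by (simp add: \<eta>_def)
      with z show False by simp
    qed
    then show "z \<in> (\<Union>x\<in>I. cball x (r x))" by (rule Ssupp)
  qed
  have comp: "compact (\<Union>x\<in>I. cball x (r x))" using I(2) by (intro compact_UN) auto
  have cl: "closure (supp \<eta>) \<subseteq> (\<Union>x\<in>I. cball x (r x))"
    by (rule closure_minimal[OF cs compact_imp_closed[OF comp]])
  show ?thesis
  proof (rule that[OF c])
    show "bounded (supp \<eta>)" by (rule bounded_subset[OF compact_imp_bounded[OF comp] cs])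
    show "closure (supp \<eta>) \<subseteq> \<Omega>" using cl r(2) I(1) by blast
    show "\<eta> z = 1" if "z \<in> K" for z
    proof -
      have "1 \<le> 1 / m * S z" using m(2)[OF that] m(1) by (simp add: field_simps)
      then show ?thesis by (simp add: \<eta>_def)
    qed
    have "(max 0 (1 - 1 / m * S z))\<^sup>2 \<le> 1\<^sup>2" for z using u[of z] by (intro power_mono) auto
    then show "0 \<le> \<eta> z" "\<eta> z \<le> 1" for z by (simp_all add: \<eta>_def)
  qed
qed

locale cutoff =
  fixes \<Omega> :: "point set" and \<eta> :: "point \<Rightarrow> real"
  assumes open_\<Omega>: "open \<Omega>"
    and \<eta>: "C1_on UNIV \<eta>" "bounded (supp \<eta>)" "closure (supp \<eta>) \<subseteq> \<Omega>" "\<And>z. 0 \<le> \<eta> z" "\<And>z. \<eta> z \<le> 1"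
begin

text \<open>After squaring, the gradient of the weight still carries a factor \<open>\<eta>\<close>.
  This factor joins the gradients of the solution, so the cross terms can be absorbed into an energy
  weighted by \<open>m\<close>.\<close>

definition m :: "point \<Rightarrow> real" where "m z = \<eta> z * \<eta> z"

lemma m_C1: "C1_on UNIV m"
  and D_m: "D1 m z = 2 * (\<eta> z * D1 \<eta> z)" "D2 m z = 2 * (\<eta> z * D2 \<eta> z)"
  using C1_on_mult[OF \<eta>(1) \<eta>(1)] D1_mult[OF \<eta>(1) \<eta>(1)] D2_mult[OF \<eta>(1) \<eta>(1)]
  by (simp_all add: m_def[abs_def])

lemma m_bounds: "0 \<le> m z" "m z \<le> 1"
  using \<eta>(4)[of z] \<eta>(5)[of z] by (simp_all add: m_def mult_le_one)

lemma m_supp: "supp m = supp \<eta>" by (auto simp: m_def)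

lemma supp_in_\<Omega>: "\<eta> z \<noteq> 0 \<Longrightarrow> z \<in> \<Omega>"
  using \<eta>(3) closure_subset[of "supp \<eta>"] by blast

text \<open>Off \<open>\<Omega>\<close> the values of \<open>F\<close> and of its
  \<open>deriv\<close> are arbitrary, yet the product rule holds at every point: there
  \<open>h\<close>, its derivatives and the derivatives of the product all vanish.\<close>

lemma mult_cutoff:
  assumes h: "C1_on UNIV h" "supp h \<subseteq> supp \<eta>" and F: "C1_on \<Omega> F"
  shows "C1_on UNIV (\<lambda>z. h z * F z)" "D1 (\<lambda>z. h z * F z) z = h z * D1 F z + F z * D1 h z"
    "D2 (\<lambda>z. h z * F z) z = h z * D2 F z + F z * D2 h z" "bounded (supp (\<lambda>z. h z * F z))"
proof -
  note h' = C1_on_subset[OF h(1) subset_UNIV]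
  have sub: "supp (\<lambda>z. h z * F z) \<subseteq> supp \<eta>" using h(2) by auto
  then have cl: "closure (supp (\<lambda>z. h z * F z)) \<subseteq> closure (supp \<eta>)" by (rule closure_mono)
  have cl': "closure (supp h) \<subseteq> closure (supp \<eta>)" by (rule closure_mono[OF h(2)])
  show "C1_on UNIV (\<lambda>z. h z * F z)"
    by (rule C1_on_UNIV_extend[OF C1_on_mult[OF h' F] order_trans[OF cl \<eta>(3)] open_\<Omega>])
  show "bounded (supp (\<lambda>z. h z * F z))" by (rule bounded_subset[OF \<eta>(2) sub])
  have "D1 (\<lambda>z. h z * F z) z = h z * D1 F z + F z * D1 h z \<and> D2 (\<lambda>z. h z * F z) z = h z * D2 F z + F z * D2 h z"
  proof (cases "z \<in> \<Omega>")
    case True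
    then show ?thesis using D1_mult[OF h' F] D2_mult[OF h' F] by simp
  next
    case False
    then have z: "z \<notin> closure (supp \<eta>)" using \<eta>(3) by blast
    then have z1: "z \<notin> closure (supp (\<lambda>z. h z * F z))" and z2: "z \<notin> closure (supp h)" using cl cl' by blast+
    have "h z = 0" using z2 closure_subset[of "supp h"] by blast
    then show ?thesis by (simp add: D_eq_0_outside[OF z1] D_eq_0_outside[OF z2])
  qed
  then show "D1 (\<lambda>z. h z * F z) z = h z * D1 F z + F z * D1 h z" "D2 (\<lambda>z. h z * F z) z = h z * D2 F z + F z * D2 h z"
    by auto
qed

lemmas mult_m = mult_cutoff[OF m_C1 equalityD1[OF m_supp]]
lemmas mult_\<eta> = mult_cutoff[OF \<eta>(1) order_refl]

end

text \<open>The equations inside the domain, in state variables, with viscosities \<open>s1\<close>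
  and \<open>s2\<close> as functions of the density. \<open>range\<close> keeps the flow away from
  stagnation and vacuum at each interior point, so every coefficient is C^1 along the
  solution.\<close>

locale viscous_flow = cutoff \<Omega> \<eta> for \<Omega> \<eta> +
  fixes \<gamma> \<epsilon> :: real and \<rho> \<theta> :: "point \<Rightarrow> real" and s1 s2 :: "real \<Rightarrow> real"
  assumes gamma: "1 \<le> \<gamma>" and eps: "0 < \<epsilon>"
    and s1: "C1_on states (\<lambda>w. s1 (fst w))" and s2: "C1_on states (\<lambda>w. s2 (fst w))"
    and \<rho>: "C1_on \<Omega> \<rho>" "C1_on \<Omega> (D1 \<rho>)" "C1_on \<Omega> (D2 \<rho>)"
    and \<theta>: "C1_on \<Omega> \<theta>" "C1_on \<Omega> (D1 \<theta>)" "C1_on \<Omega> (D2 \<theta>)"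
    and range: "z \<in> \<Omega> \<Longrightarrow> \<rho> z \<in> {0<..<1}"
    and eq1: "z \<in> \<Omega> \<Longrightarrow> D1 (\<lambda>p. st_v \<gamma> (\<rho> p, \<theta> p)) z - D2 (\<lambda>p. st_u \<gamma> (\<rho> p, \<theta> p)) z
      = \<epsilon> * (D1 (\<lambda>p. s1 (\<rho> p) * D1 \<theta> p) z + D2 (\<lambda>p. s1 (\<rho> p) * D2 \<theta> p) z)"
    and eq2: "z \<in> \<Omega> \<Longrightarrow> D1 (\<lambda>p. st_m \<gamma> (\<rho> p, \<theta> p)) z + D2 (\<lambda>p. st_n \<gamma> (\<rho> p, \<theta> p)) z
      = \<epsilon> * (D1 (\<lambda>p. s2 (\<rho> p) * D1 \<rho> p) z + D2 (\<lambda>p. s2 (\<rho> p) * D2 \<rho> p) z)"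
begin

abbreviation W :: "point \<Rightarrow> point" where "W z \<equiv> (\<rho> z, \<theta> z)"

lemma W_states: "z \<in> \<Omega> \<Longrightarrow> W z \<in> states"
  using range by auto

lemma compose:
  assumes "C1_on states F"
  shows "C1_on \<Omega> (\<lambda>z. F (W z))"
    "z \<in> \<Omega> \<Longrightarrow> D1 (\<lambda>z. F (W z)) z = D1 F (W z) * D1 \<rho> z + D2 F (W z) * D1 \<theta> z"
    "z \<in> \<Omega> \<Longrightarrow> D2 (\<lambda>z. F (W z)) z = D1 F (W z) * D2 \<rho> z + D2 F (W z) * D2 \<theta> z"
  using C1_on_chain2[OF \<rho>(1) \<theta>(1) assms W_states] D1_chain2[OF \<rho>(1) \<theta>(1) assms W_states]
    D2_chain2[OF \<rho>(1) \<theta>(1) assms W_states] by simp_all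

definition E :: "point \<Rightarrow> real" where
  "E z = m z * ((D1 \<rho> z)\<^sup>2 + (D2 \<rho> z)\<^sup>2 + (D1 \<theta> z)\<^sup>2 + (D2 \<theta> z)\<^sup>2)"

definition G :: "point \<Rightarrow> real" where "G z = (D1 \<eta> z)\<^sup>2 + (D2 \<eta> z)\<^sup>2"

lemma E_integrable: "integrable lborel E" and E_nonneg: "0 \<le> E z"
proof -
  have sq: "integrable lborel (\<lambda>z. (\<eta> z * F z)\<^sup>2)" if "C1_on \<Omega> F" for F
    unfolding power2_eq_square
    by (rule integrable_Cc[OF continuous_on_mult[OF C1_onD(4) C1_onD(4)] bounded_supp_mult(1)];
        rule mult_\<eta>[OF that])
  have "E = (\<lambda>z. (\<eta> z * D1 \<rho> z)\<^sup>2 + (\<eta> z * D2 \<rho> z)\<^sup>2 + (\<eta> z * D1 \<theta> z)\<^sup>2 + (\<eta> z * D2 \<theta> z)\<^sup>2)"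
    by (simp add: fun_eq_iff E_def m_def power2_eq_square algebra_simps)
  then show "integrable lborel E"
    using sq[OF \<rho>(2)] sq[OF \<rho>(3)] sq[OF \<theta>(2)] sq[OF \<theta>(3)] by simp
  show "0 \<le> E z" by (simp add: E_def m_bounds)
qed

lemma G_integrable: "integrable lborel G" and Dm_integrable: "integrable lborel (\<lambda>z. \<bar>D1 m z\<bar> + \<bar>D2 m z\<bar>)"
proof -
  have i: "integrable lborel (\<lambda>z. (F z)\<^sup>2)" if "continuous_on UNIV F" "bounded (supp F)" for F :: "point \<Rightarrow> real"
    unfolding power2_eq_square by (intro integrable_Cc continuous_on_mult bounded_supp_mult(1) that)
  show "integrable lborel G" unfolding G_def[abs_def]
    by (intro Bochner_Integration.integrable_add i C1_onD(2,3)[OF \<eta>(1)] bounded_supp_D \<eta>(2))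
  have "bounded (supp m)" unfolding m_supp by (rule \<eta>(2))
  then show "integrable lborel (\<lambda>z. \<bar>D1 m z\<bar> + \<bar>D2 m z\<bar>)"
    by (intro Bochner_Integration.integrable_add integrable_abs integrable_Cc C1_onD(2,3)[OF m_C1] bounded_supp_D)
qed

text \<open>The entropy balance multiplied by the cutoff \<open>m\<close> reads \<open>div QQ = div PP + R\<close>.\<close>
context
  fixes Q1 Q2 a b :: "point \<Rightarrow> real"
  assumes pair: "entropy_pair \<gamma> Q1 Q2 a b"
begin

definition "QQ1 = (\<lambda>z. m z * Q1 (W z))"
definition "QQ2 = (\<lambda>z. m z * Q2 (W z))"
definition "p1 = (\<lambda>z. a (W z) * (s2 (\<rho> z) * D1 \<rho> z) + b (W z) * (s1 (\<rho> z) * D1 \<theta> z))"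
definition "p2 = (\<lambda>z. a (W z) * (s2 (\<rho> z) * D2 \<rho> z) + b (W z) * (s1 (\<rho> z) * D2 \<theta> z))"
definition "PP1 = (\<lambda>z. \<epsilon> * (m z * p1 z))"
definition "PP2 = (\<lambda>z. \<epsilon> * (m z * p2 z))"
text \<open>By definition the part of the localized balance that is not in divergence form. The
  equations enter only when it is computed inside \<open>\<Omega>\<close>. Being a sum of
  derivatives of functions of bounded support, it has integral zero.\<close>

definition "R = (\<lambda>z. D1 QQ1 z + D2 QQ2 z - (D1 PP1 z + D2 PP2 z))"

lemma pairD: "C1_on states Q1" "C1_on states Q2" "C1_on states a" "C1_on states b"
  using pair by (simp_all add: entropy_pair_def)

lemma flux_C1: "C1_on \<Omega> (\<lambda>z. s1 (\<rho> z) * D1 \<theta> z)" "C1_on \<Omega> (\<lambda>z. s1 (\<rho> z) * D2 \<theta> z)"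
  "C1_on \<Omega> (\<lambda>z. s2 (\<rho> z) * D1 \<rho> z)" "C1_on \<Omega> (\<lambda>z. s2 (\<rho> z) * D2 \<rho> z)"
  using compose(1)[OF s1] compose(1)[OF s2] by (auto intro!: C1_on_mult \<rho> \<theta>)

lemma p_C1: "C1_on \<Omega> p1" "C1_on \<Omega> p2"
  unfolding p1_def p2_def by (intro C1_on_add C1_on_mult[OF compose(1)] pairD flux_C1)+

lemma QQ_C1: "C1_on UNIV QQ1" "C1_on UNIV QQ2" "bounded (supp QQ1)" "bounded (supp QQ2)"
  unfolding QQ1_def QQ2_def by (rule mult_m[OF compose(1)[OF pairD(1)]] mult_m[OF compose(1)[OF pairD(2)]])+

lemma PP_C1: "C1_on UNIV PP1" "C1_on UNIV PP2" "bounded (supp PP1)" "bounded (supp PP2)"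
  unfolding PP1_def PP2_def
  by (rule C1_on_cmult mult_m[OF p_C1(1)] mult_m[OF p_C1(2)] bounded_supp_mult(2))+

lemma R_Cc: "continuous_on UNIV R" "bounded (supp R)"
proof -
  show "continuous_on UNIV R" unfolding R_def
    by (intro continuous_on_diff continuous_on_add C1_onD(2,3) QQ_C1 PP_C1)
  have "bounded (supp (D1 QQ1) \<union> supp (D2 QQ2) \<union> (supp (D1 PP1) \<union> supp (D2 PP2)))"
    using bounded_supp_D(1)[OF QQ_C1(3)] bounded_supp_D(2)[OF QQ_C1(4)] bounded_supp_D(1)[OF PP_C1(3)] bounded_supp_D(2)[OF PP_C1(4)]
    by simp
  then show "bounded (supp R)" by (rule bounded_subset) (auto simp: R_def)
qed

lemma R_integral: "(LINT z|lborel. R z) = 0"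
proof -
  have i: "integrable lborel (D1 QQ1)" "integrable lborel (D2 QQ2)" "integrable lborel (D1 PP1)" "integrable lborel (D2 PP2)"
    by (rule integrable_Cc[OF C1_onD(2)[OF QQ_C1(1)] bounded_supp_D(1)[OF QQ_C1(3)]]
      integrable_Cc[OF C1_onD(3)[OF QQ_C1(2)] bounded_supp_D(2)[OF QQ_C1(4)]]
      integrable_Cc[OF C1_onD(2)[OF PP_C1(1)] bounded_supp_D(1)[OF PP_C1(3)]]
      integrable_Cc[OF C1_onD(3)[OF PP_C1(2)] bounded_supp_D(2)[OF PP_C1(4)]])+
  then show ?thesis unfolding R_def
    using LINT_D_eq_0(1)[OF QQ_C1(1,3)] LINT_D_eq_0(2)[OF QQ_C1(2,4)] LINT_D_eq_0(1)[OF PP_C1(1,3)] LINT_D_eq_0(2)[OF PP_C1(2,4)]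
    by simp
qed

lemma balance:
  assumes z: "z \<in> \<Omega>"
  shows "D1 (\<lambda>z. Q1 (W z)) z + D2 (\<lambda>z. Q2 (W z)) z
    = \<epsilon> * (a (W z) * (D1 (\<lambda>p. s2 (\<rho> p) * D1 \<rho> p) z + D2 (\<lambda>p. s2 (\<rho> p) * D2 \<rho> p) z)
      + b (W z) * (D1 (\<lambda>p. s1 (\<rho> p) * D1 \<theta> p) z + D2 (\<lambda>p. s1 (\<rho> p) * D2 \<theta> p) z))"
proof -
  note w = W_states[OF z]
  have e: "D1 Q1 (W z) = a (W z) * D1 (st_m \<gamma>) (W z) + b (W z) * D1 (st_v \<gamma>) (W z)"
    "D2 Q1 (W z) = a (W z) * D2 (st_m \<gamma>) (W z) + b (W z) * D2 (st_v \<gamma>) (W z)"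
    "D1 Q2 (W z) = a (W z) * D1 (st_n \<gamma>) (W z) - b (W z) * D1 (st_u \<gamma>) (W z)"
    "D2 Q2 (W z) = a (W z) * D2 (st_n \<gamma>) (W z) - b (W z) * D2 (st_u \<gamma>) (W z)"
    using pair w unfolding entropy_pair_def by blast+
  have "D1 (\<lambda>z. Q1 (W z)) z + D2 (\<lambda>z. Q2 (W z)) z
    = a (W z) * (D1 (\<lambda>p. st_m \<gamma> (W p)) z + D2 (\<lambda>p. st_n \<gamma> (W p)) z)
      + b (W z) * (D1 (\<lambda>p. st_v \<gamma> (W p)) z - D2 (\<lambda>p. st_u \<gamma> (W p)) z)"
    unfolding compose(2)[OF pairD(1) z] compose(3)[OF pairD(2) z] e
      compose(2)[OF C1_on_st_m[OF gamma] z] compose(3)[OF C1_on_st_n[OF gamma] z]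
      compose(2)[OF C1_on_st_v[OF gamma] z] compose(3)[OF C1_on_st_u[OF gamma] z]
    by (simp add: algebra_simps)
  then show ?thesis unfolding eq1[OF z] eq2[OF z] by (simp add: algebra_simps)
qed

lemma R_eq: "R z = (m z * D1 (\<lambda>z. Q1 (W z)) z + Q1 (W z) * D1 m z) + (m z * D2 (\<lambda>z. Q2 (W z)) z + Q2 (W z) * D2 m z)
    - (\<epsilon> * (m z * D1 p1 z + p1 z * D1 m z) + \<epsilon> * (m z * D2 p2 z + p2 z * D2 m z))"
  unfolding R_def QQ1_def QQ2_def PP1_def PP2_def
  by (simp add: mult_m(2)[OF compose(1)[OF pairD(1)]] mult_m(3)[OF compose(1)[OF pairD(2)]]
    D1_cmult[OF mult_m(1)[OF p_C1(1)]] D2_cmult[OF mult_m(1)[OF p_C1(2)]] mult_m(2)[OF p_C1(1)] mult_m(3)[OF p_C1(2)])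

lemma R_outside: "\<eta> z = 0 \<Longrightarrow> R z = 0"
  unfolding R_eq by (simp add: D_m m_def)

text \<open>The second-order terms of the divergence of \<open>(p1, p2)\<close> are exactly the
  production found in \<open>balance\<close> and cancel. What is left are terms with derivatives of
  the cutoff and a quadratic form in the first derivatives.\<close>

lemma R_inside:
  assumes z: "z \<in> \<Omega>"
  shows "R z = (D1 m z * Q1 (W z) + D2 m z * Q2 (W z))
    - \<epsilon> * (p1 z * D1 m z + p2 z * D2 m z)
    - \<epsilon> * (m z * ((D1 a (W z) * D1 \<rho> z + D2 a (W z) * D1 \<theta> z) * (s2 (\<rho> z) * D1 \<rho> z)
        + (D1 a (W z) * D2 \<rho> z + D2 a (W z) * D2 \<theta> z) * (s2 (\<rho> z) * D2 \<rho> z)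
        + (D1 b (W z) * D1 \<rho> z + D2 b (W z) * D1 \<theta> z) * (s1 (\<rho> z) * D1 \<theta> z)
        + (D1 b (W z) * D2 \<rho> z + D2 b (W z) * D2 \<theta> z) * (s1 (\<rho> z) * D2 \<theta> z)))"
proof -
  note ca = compose(1)[OF pairD(3)] and cb = compose(1)[OF pairD(4)]
  have dp: "D1 p1 z = (a (W z) * D1 (\<lambda>z. s2 (\<rho> z) * D1 \<rho> z) z + (s2 (\<rho> z) * D1 \<rho> z) * D1 (\<lambda>z. a (W z)) z)
      + (b (W z) * D1 (\<lambda>z. s1 (\<rho> z) * D1 \<theta> z) z + (s1 (\<rho> z) * D1 \<theta> z) * D1 (\<lambda>z. b (W z)) z)"
    "D2 p2 z = (a (W z) * D2 (\<lambda>z. s2 (\<rho> z) * D2 \<rho> z) z + (s2 (\<rho> z) * D2 \<rho> z) * D2 (\<lambda>z. a (W z)) z)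
      + (b (W z) * D2 (\<lambda>z. s1 (\<rho> z) * D2 \<theta> z) z + (s1 (\<rho> z) * D2 \<theta> z) * D2 (\<lambda>z. b (W z)) z)"
    unfolding p1_def p2_def
      D1_add[OF C1_on_mult[OF ca flux_C1(3)] C1_on_mult[OF cb flux_C1(1)] z]
      D2_add[OF C1_on_mult[OF ca flux_C1(4)] C1_on_mult[OF cb flux_C1(2)] z]
      D1_mult[OF ca flux_C1(3) z] D1_mult[OF cb flux_C1(1) z] D2_mult[OF ca flux_C1(4) z] D2_mult[OF cb flux_C1(2) z]
    by (rule refl)+
  have "R z = m z * (D1 (\<lambda>z. Q1 (W z)) z + D2 (\<lambda>z. Q2 (W z)) z) + (D1 m z * Q1 (W z) + D2 m z * Q2 (W z))
    - \<epsilon> * (p1 z * D1 m z + p2 z * D2 m z) - \<epsilon> * (m z * (D1 p1 z + D2 p2 z))"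
    unfolding R_eq by (simp add: algebra_simps)
  then show ?thesis
    unfolding balance[OF z] dp compose(2,3)[OF pairD(3) z] compose(2,3)[OF pairD(4) z] by (simp add: algebra_simps)
qed

context
  fixes M A :: real
  assumes M: "\<And>z. \<eta> z \<noteq> 0 \<Longrightarrow> \<bar>Q1 (W z)\<bar> \<le> M" "\<And>z. \<eta> z \<noteq> 0 \<Longrightarrow> \<bar>Q2 (W z)\<bar> \<le> M"
    and A: "\<And>z. \<eta> z \<noteq> 0 \<Longrightarrow> \<bar>a (W z)\<bar> \<le> A" "\<And>z. \<eta> z \<noteq> 0 \<Longrightarrow> \<bar>b (W z)\<bar> \<le> A"
      "\<And>z. \<eta> z \<noteq> 0 \<Longrightarrow> \<bar>s1 (\<rho> z)\<bar> \<le> A" "\<And>z. \<eta> z \<noteq> 0 \<Longrightarrow> \<bar>s2 (\<rho> z)\<bar> \<le> A"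
    and M0: "0 \<le> M" and A0: "0 \<le> A"
begin

lemma QQ_bound: "\<bar>QQ1 z\<bar> \<le> M" "\<bar>QQ2 z\<bar> \<le> M"
proof -
  have "\<bar>m z\<bar> * \<bar>F\<bar> \<le> M" if "\<eta> z \<noteq> 0 \<Longrightarrow> \<bar>F\<bar> \<le> M" for F
  proof (cases "\<eta> z = 0")
    case False
    have "\<bar>m z\<bar> * \<bar>F\<bar> \<le> 1 * M" using m_bounds[of z] that[OF False] by (intro mult_mono) auto
    then show ?thesis by simp
  qed (use M0 in \<open>simp add: m_def\<close>)
  then show "\<bar>QQ1 z\<bar> \<le> M" "\<bar>QQ2 z\<bar> \<le> M" unfolding QQ1_def QQ2_def abs_mult using M by blast+
qed

lemma p_bound:
  assumes "\<eta> z \<noteq> 0"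
  shows "\<bar>p1 z\<bar> \<le> A\<^sup>2 * (\<bar>D1 \<rho> z\<bar> + \<bar>D1 \<theta> z\<bar>)" "\<bar>p2 z\<bar> \<le> A\<^sup>2 * (\<bar>D2 \<rho> z\<bar> + \<bar>D2 \<theta> z\<bar>)"
proof -
  have "\<bar>c * (s * x)\<bar> \<le> A\<^sup>2 * \<bar>x\<bar>" if "\<bar>c\<bar> \<le> A" "\<bar>s\<bar> \<le> A" for c s x
  proof -
    have "\<bar>c\<bar> * \<bar>s\<bar> \<le> A * A" using that A0 by (intro mult_mono) auto
    then have "(\<bar>c\<bar> * \<bar>s\<bar>) * \<bar>x\<bar> \<le> (A * A) * \<bar>x\<bar>" by (rule mult_right_mono) simp
    then show ?thesis by (simp add: abs_mult power2_eq_square mult.assoc)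
  qed
  note t = this
  show "\<bar>p1 z\<bar> \<le> A\<^sup>2 * (\<bar>D1 \<rho> z\<bar> + \<bar>D1 \<theta> z\<bar>)" unfolding p1_def distrib_left
    by (rule order_trans[OF abs_triangle_ineq add_mono[OF t[OF A(1,4)] t[OF A(2,3)]]]; rule assms)
  show "\<bar>p2 z\<bar> \<le> A\<^sup>2 * (\<bar>D2 \<rho> z\<bar> + \<bar>D2 \<theta> z\<bar>)" unfolding p2_def distrib_left
    by (rule order_trans[OF abs_triangle_ineq add_mono[OF t[OF A(1,4)] t[OF A(2,3)]]]; rule assms)
qed

text \<open>The factor \<open>\<epsilon>\<^sup>2\<close> meets an energy of order
  \<open>1 / \<epsilon>\<close>, which is why these fields tend to zero in \<open>L\<^sup>2\<close>.
  The inequality \<open>m\<^sup>2 \<le> m\<close> brings the weight down to that of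
  \<open>E\<close>.\<close>

lemma PP_bound: "(PP1 z)\<^sup>2 + (PP2 z)\<^sup>2 \<le> 2 * \<epsilon>\<^sup>2 * A ^ 4 * E z"
proof (cases "\<eta> z = 0")
  case True
  then show ?thesis by (simp add: PP1_def PP2_def E_def m_def)
next
  case False
  have t: "p\<^sup>2 \<le> 2 * A ^ 4 * (x\<^sup>2 + y\<^sup>2)" if "\<bar>p\<bar> \<le> A\<^sup>2 * (\<bar>x\<bar> + \<bar>y\<bar>)" for p x y :: real
  proof -
    have "\<bar>p\<bar>\<^sup>2 \<le> (A\<^sup>2 * (\<bar>x\<bar> + \<bar>y\<bar>))\<^sup>2" using that by (rule power_mono) simp
    also have "\<dots> = A ^ 4 * (\<bar>x\<bar> + \<bar>y\<bar>)\<^sup>2" by (simp add: power_mult_distrib flip: power_mult)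
    also have "\<dots> \<le> A ^ 4 * (2 * (x\<^sup>2 + y\<^sup>2))"
      using sum_squares_bound[of "\<bar>x\<bar>" "\<bar>y\<bar>"] A0 by (intro mult_left_mono) (auto simp: power2_sum)
    finally show ?thesis by (simp add: algebra_simps)
  qed
  have "(PP1 z)\<^sup>2 + (PP2 z)\<^sup>2 = \<epsilon>\<^sup>2 * ((m z)\<^sup>2 * ((p1 z)\<^sup>2 + (p2 z)\<^sup>2))"
    by (simp add: PP1_def PP2_def power_mult_distrib algebra_simps)
  also have "\<dots> \<le> \<epsilon>\<^sup>2 * (m z * (2 * A ^ 4 * ((D1 \<rho> z)\<^sup>2 + (D1 \<theta> z)\<^sup>2) + 2 * A ^ 4 * ((D2 \<rho> z)\<^sup>2 + (D2 \<theta> z)\<^sup>2)))"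
  proof (intro mult_left_mono mult_mono add_mono t p_bound[OF False])
    show "(m z)\<^sup>2 \<le> m z" using m_bounds[of z] by (simp add: power2_eq_square mult_left_le)
  qed (use m_bounds in auto)
  also have "\<dots> = 2 * \<epsilon>\<^sup>2 * A ^ 4 * E z" by (simp add: E_def algebra_simps)
  finally show ?thesis .
qed

text \<open>Young's inequality with a free parameter, from the square of
  \<open>k \<eta> \<bar>x\<bar> - A\<^sup>2 \<bar>d\<bar>\<close> divided by \<open>k\<close>. The
  factor \<open>\<eta>\<close> left in the gradient of \<open>m\<close> supplies the weight of
  \<open>E\<close>.\<close>

lemma Dm_bound:
  assumes "\<eta> z \<noteq> 0" "0 < k"
  shows "\<bar>p1 z * D1 m z + p2 z * D2 m z\<bar> \<le> k * E z + (2 * A ^ 4 / k) * G z"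
proof -
  have t: "\<bar>p * (2 * (\<eta> z * d))\<bar> \<le> k * (m z * (x\<^sup>2 + y\<^sup>2)) + (2 * A ^ 4 / k) * d\<^sup>2"
    if "\<bar>p\<bar> \<le> A\<^sup>2 * (\<bar>x\<bar> + \<bar>y\<bar>)" for p d x y :: real
  proof -
    have y: "2 * (A\<^sup>2 * \<bar>d\<bar>) * (\<eta> z * \<bar>x\<bar>) \<le> k * (m z * x\<^sup>2) + (A ^ 4 / k) * d\<^sup>2" for x :: real
    proof -
      have "0 \<le> (k * (\<eta> z * \<bar>x\<bar>) - A\<^sup>2 * \<bar>d\<bar>)\<^sup>2 / k" using assms(2) by simp
      also have "\<dots> = k * (m z * x\<^sup>2) - 2 * (A\<^sup>2 * \<bar>d\<bar>) * (\<eta> z * \<bar>x\<bar>) + (A ^ 4 / k) * d\<^sup>2"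
        using assms(2) by (simp add: power2_diff power_mult_distrib m_def field_simps power2_eq_square power4_eq_xxxx)
      finally show ?thesis by simp
    qed
    have "\<bar>p * (2 * (\<eta> z * d))\<bar> = \<bar>p\<bar> * (2 * (\<eta> z * \<bar>d\<bar>))" using \<eta>(4)[of z] by (simp add: abs_mult)
    also have "\<dots> \<le> (A\<^sup>2 * (\<bar>x\<bar> + \<bar>y\<bar>)) * (2 * (\<eta> z * \<bar>d\<bar>))"
      using that \<eta>(4)[of z] by (intro mult_right_mono) auto
    also have "\<dots> = 2 * (A\<^sup>2 * \<bar>d\<bar>) * (\<eta> z * \<bar>x\<bar>) + 2 * (A\<^sup>2 * \<bar>d\<bar>) * (\<eta> z * \<bar>y\<bar>)" by (simp add: algebra_simps)
    also have "\<dots> \<le> (k * (m z * x\<^sup>2) + (A ^ 4 / k) * d\<^sup>2) + (k * (m z * y\<^sup>2) + (A ^ 4 / k) * d\<^sup>2)"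
      by (intro add_mono y)
    also have "\<dots> = k * (m z * (x\<^sup>2 + y\<^sup>2)) + (2 * A ^ 4 / k) * d\<^sup>2" by (simp add: algebra_simps)
    finally show ?thesis .
  qed
  have "\<bar>p1 z * D1 m z + p2 z * D2 m z\<bar> \<le> (k * (m z * ((D1 \<rho> z)\<^sup>2 + (D1 \<theta> z)\<^sup>2)) + (2 * A ^ 4 / k) * (D1 \<eta> z)\<^sup>2)
      + (k * (m z * ((D2 \<rho> z)\<^sup>2 + (D2 \<theta> z)\<^sup>2)) + (2 * A ^ 4 / k) * (D2 \<eta> z)\<^sup>2)"
    unfolding D_m by (rule order_trans[OF abs_triangle_ineq add_mono[OF t t]]; rule p_bound[OF assms(1)])
  also have "\<dots> = k * E z + (2 * A ^ 4 / k) * G z" by (simp add: E_def G_def algebra_simps add_divide_distrib)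
  finally show ?thesis .
qed

lemma DmQ_bound:
  assumes "\<eta> z \<noteq> 0"
  shows "\<bar>D1 m z * Q1 (W z) + D2 m z * Q2 (W z)\<bar> \<le> M * (\<bar>D1 m z\<bar> + \<bar>D2 m z\<bar>)"
proof -
  have "\<bar>D1 m z\<bar> * \<bar>Q1 (W z)\<bar> \<le> \<bar>D1 m z\<bar> * M" "\<bar>D2 m z\<bar> * \<bar>Q2 (W z)\<bar> \<le> \<bar>D2 m z\<bar> * M"
    by (intro mult_left_mono M[OF assms]; simp)+
  then show ?thesis
    using abs_triangle_ineq[of "D1 m z * Q1 (W z)" "D2 m z * Q2 (W z)"] by (simp add: abs_mult algebra_simps)
qed

text \<open>For an arbitrary entropy pair the quadratic form has no sign. It is dominated by
  \<open>E\<close>, and the factor \<open>\<epsilon>\<close> in front matches the energy bound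
  obtained from the special pair.\<close>

lemma R_bound:
  assumes dA: "\<And>z. \<eta> z \<noteq> 0 \<Longrightarrow> \<bar>D1 a (W z)\<bar> \<le> A" "\<And>z. \<eta> z \<noteq> 0 \<Longrightarrow> \<bar>D2 a (W z)\<bar> \<le> A"
      "\<And>z. \<eta> z \<noteq> 0 \<Longrightarrow> \<bar>D1 b (W z)\<bar> \<le> A" "\<And>z. \<eta> z \<noteq> 0 \<Longrightarrow> \<bar>D2 b (W z)\<bar> \<le> A"
  shows "\<bar>R z\<bar> \<le> M * (\<bar>D1 m z\<bar> + \<bar>D2 m z\<bar>) + \<epsilon> * ((1 + 4 * A\<^sup>2) * E z + 2 * A ^ 4 * G z)"
proof (cases "\<eta> z = 0")
  case True
  then show ?thesis using R_outside M0 eps E_nonneg[of z] by (simp add: G_def)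
next
  case False
  note z = supp_in_\<Omega>[OF False]
  have t: "\<bar>(c1 * x + c2 * y) * (s * v)\<bar> \<le> 2 * A\<^sup>2 * (x\<^sup>2 + y\<^sup>2)"
    if "\<bar>c1\<bar> \<le> A" "\<bar>c2\<bar> \<le> A" "\<bar>s\<bar> \<le> A" "v = x \<or> v = y" for c1 c2 s x y v :: real
  proof -
    have "\<bar>c1 * x + c2 * y\<bar> \<le> A * (\<bar>x\<bar> + \<bar>y\<bar>)"
      using mult_right_mono[OF that(1), of "\<bar>x\<bar>"] mult_right_mono[OF that(2), of "\<bar>y\<bar>"] abs_triangle_ineq[of "c1 * x" "c2 * y"]
      by (simp add: abs_mult algebra_simps)
    moreover have "\<bar>s * v\<bar> \<le> A * (\<bar>x\<bar> + \<bar>y\<bar>)"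
      unfolding abs_mult using that A0 by (intro mult_mono) auto
    ultimately have "\<bar>(c1 * x + c2 * y) * (s * v)\<bar> \<le> (A * (\<bar>x\<bar> + \<bar>y\<bar>)) * (A * (\<bar>x\<bar> + \<bar>y\<bar>))"
      unfolding abs_mult[of "c1 * x + c2 * y"] using A0 by (intro mult_mono) auto
    also have "\<dots> = A\<^sup>2 * (\<bar>x\<bar> + \<bar>y\<bar>)\<^sup>2" by (simp add: power2_eq_square algebra_simps)
    also have "\<dots> \<le> A\<^sup>2 * (2 * (x\<^sup>2 + y\<^sup>2))"
      using sum_squares_bound[of "\<bar>x\<bar>" "\<bar>y\<bar>"] by (intro mult_left_mono) (auto simp: power2_sum)
    finally show ?thesis by (simp add: algebra_simps)
  qed
  let ?x1 = "D1 \<rho> z" and ?x2 = "D2 \<rho> z" and ?y1 = "D1 \<theta> z" and ?y2 = "D2 \<theta> z"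
  let ?t1 = "(D1 a (W z) * ?x1 + D2 a (W z) * ?y1) * (s2 (\<rho> z) * ?x1)"
  let ?t2 = "(D1 a (W z) * ?x2 + D2 a (W z) * ?y2) * (s2 (\<rho> z) * ?x2)"
  let ?t3 = "(D1 b (W z) * ?x1 + D2 b (W z) * ?y1) * (s1 (\<rho> z) * ?y1)"
  let ?t4 = "(D1 b (W z) * ?x2 + D2 b (W z) * ?y2) * (s1 (\<rho> z) * ?y2)"
  have "\<bar>?t1\<bar> \<le> 2 * A\<^sup>2 * (?x1\<^sup>2 + ?y1\<^sup>2)" "\<bar>?t2\<bar> \<le> 2 * A\<^sup>2 * (?x2\<^sup>2 + ?y2\<^sup>2)"
    "\<bar>?t3\<bar> \<le> 2 * A\<^sup>2 * (?x1\<^sup>2 + ?y1\<^sup>2)" "\<bar>?t4\<bar> \<le> 2 * A\<^sup>2 * (?x2\<^sup>2 + ?y2\<^sup>2)"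
    by (rule t[OF dA(1,2) A(4)] t[OF dA(3,4) A(3)]; simp add: False)+
  then have "\<bar>?t1 + ?t2 + ?t3 + ?t4\<bar> \<le> 4 * A\<^sup>2 * (?x1\<^sup>2 + ?x2\<^sup>2 + ?y1\<^sup>2 + ?y2\<^sup>2)" by (simp add: algebra_simps)
  then have "\<bar>m z * (?t1 + ?t2 + ?t3 + ?t4)\<bar> \<le> m z * (4 * A\<^sup>2 * (?x1\<^sup>2 + ?x2\<^sup>2 + ?y1\<^sup>2 + ?y2\<^sup>2))"
    unfolding abs_mult[of "m z"] using m_bounds[of z] by (simp add: mult_left_mono)
  then have 1: "\<bar>m z * (?t1 + ?t2 + ?t3 + ?t4)\<bar> \<le> 4 * A\<^sup>2 * E z" by (simp add: E_def algebra_simps)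
  have 2: "\<bar>p1 z * D1 m z + p2 z * D2 m z\<bar> \<le> E z + 2 * A ^ 4 * G z" using Dm_bound[OF False, of 1] by simp
  have e: "\<bar>\<epsilon> * x\<bar> \<le> \<epsilon> * y" if "\<bar>x\<bar> \<le> y" for x y using that eps by (simp add: abs_mult)
  have "\<bar>R z\<bar> \<le> M * (\<bar>D1 m z\<bar> + \<bar>D2 m z\<bar>) + \<epsilon> * (E z + 2 * A ^ 4 * G z) + \<epsilon> * (4 * A\<^sup>2 * E z)"
    unfolding R_inside[OF z]
    by (rule order_trans[OF abs_triangle_ineq4 add_mono[OF order_trans[OF abs_triangle_ineq4 add_mono[OF DmQ_bound[OF False] e[OF 2]]] e[OF 1]]])
  then show ?thesis by (simp add: algebra_simps)
qed

text \<open>As \<open>R\<close> integrates to zero, a pointwise lower bound by the dissipation minus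
  cutoff terms is enough. With \<open>b = - \<theta>\<close> and \<open>a\<close> depending on
  \<open>\<rho>\<close> alone the mixed terms disappear and the quadratic form is definite. Young's
  inequality with parameter \<open>k / 2\<close> spends half of it on the cutoff terms.\<close>

lemma energy_estimate:
  assumes b: "b = (\<lambda>w. - snd w)" and a: "\<And>w. w \<in> states \<Longrightarrow> D2 a w = 0"
    and k: "0 < k" "\<And>z. \<eta> z \<noteq> 0 \<Longrightarrow> k \<le> - D1 a (W z) * s2 (\<rho> z)" "\<And>z. \<eta> z \<noteq> 0 \<Longrightarrow> k \<le> s1 (\<rho> z)"
  shows "\<epsilon> * (k / 2) * (LINT z|lborel. E z)
    \<le> M * (LINT z|lborel. \<bar>D1 m z\<bar> + \<bar>D2 m z\<bar>) + \<epsilon> * (4 * A ^ 4 / k) * (LINT z|lborel. G z)"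
proof -
  have pt: "\<epsilon> * (k / 2) * E z - M * (\<bar>D1 m z\<bar> + \<bar>D2 m z\<bar>) - \<epsilon> * (4 * A ^ 4 / k) * G z \<le> R z" for z
  proof (cases "\<eta> z = 0")
    case True
    have "E z = 0" using True by (simp add: E_def m_def)
    moreover have "0 \<le> \<epsilon> * (4 * A ^ 4 / k) * G z" using eps k(1) A0 by (intro mult_nonneg_nonneg) (auto simp: G_def)
    moreover have "0 \<le> M * (\<bar>D1 m z\<bar> + \<bar>D2 m z\<bar>)" using M0 by simp
    ultimately show ?thesis using R_outside[OF True] by simp
  next
    case False
    note z = supp_in_\<Omega>[OF False]
    have db: "D1 b (W z) = 0" "D2 b (W z) = -1"
      unfolding b using D1_uminus[OF C1_on_snd[of UNIV], of "W z"] D2_uminus[OF C1_on_snd[of UNIV], of "W z"]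
      by (simp_all add: D_snd)
    let ?x1 = "D1 \<rho> z" and ?x2 = "D2 \<rho> z" and ?y1 = "D1 \<theta> z" and ?y2 = "D2 \<theta> z"
    have "k * (?x1\<^sup>2 + ?x2\<^sup>2) \<le> (- D1 a (W z) * s2 (\<rho> z)) * (?x1\<^sup>2 + ?x2\<^sup>2)"
      by (rule mult_right_mono[OF k(2)[OF False]]) simp
    moreover have "k * (?y1\<^sup>2 + ?y2\<^sup>2) \<le> s1 (\<rho> z) * (?y1\<^sup>2 + ?y2\<^sup>2)"
      by (rule mult_right_mono[OF k(3)[OF False]]) simp
    ultimately have "k * (?x1\<^sup>2 + ?x2\<^sup>2 + ?y1\<^sup>2 + ?y2\<^sup>2) \<le>
      (- D1 a (W z) * s2 (\<rho> z)) * (?x1\<^sup>2 + ?x2\<^sup>2) + s1 (\<rho> z) * (?y1\<^sup>2 + ?y2\<^sup>2)" by (simp add: distrib_left)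
    from mult_left_mono[OF this m_bounds(1)[of z]]
    have "k * E z \<le> m z * ((- D1 a (W z) * s2 (\<rho> z)) * (?x1\<^sup>2 + ?x2\<^sup>2) + s1 (\<rho> z) * (?y1\<^sup>2 + ?y2\<^sup>2))"
      by (simp add: E_def algebra_simps)
    then have diss: "k * E z \<le> - (m z * ((D1 a (W z) * ?x1 + D2 a (W z) * ?y1) * (s2 (\<rho> z) * ?x1)
        + (D1 a (W z) * ?x2 + D2 a (W z) * ?y2) * (s2 (\<rho> z) * ?x2)
        + (D1 b (W z) * ?x1 + D2 b (W z) * ?y1) * (s1 (\<rho> z) * ?y1)
        + (D1 b (W z) * ?x2 + D2 b (W z) * ?y2) * (s1 (\<rho> z) * ?y2)))"
      unfolding a[OF W_states[OF z]] db by (simp add: power2_eq_square algebra_simps)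
    have "p1 z * D1 m z + p2 z * D2 m z \<le> (k / 2) * E z + (4 * A ^ 4 / k) * G z"
      using Dm_bound[OF False, of "k / 2"] k(1) by simp
    from mult_left_mono[OF diss less_imp_le[OF eps]] mult_left_mono[OF this less_imp_le[OF eps]] DmQ_bound[OF False]
    show ?thesis unfolding R_inside[OF z] by (simp add: algebra_simps abs_le_iff)
  qed
  have i: "integrable lborel (\<lambda>z. \<epsilon> * (k / 2) * E z)" "integrable lborel (\<lambda>z. M * (\<bar>D1 m z\<bar> + \<bar>D2 m z\<bar>))"
    "integrable lborel (\<lambda>z. \<epsilon> * (4 * A ^ 4 / k) * G z)"
    by (intro integrable_mult_right E_integrable G_integrable Dm_integrable)+
  have "(LINT z|lborel. \<epsilon> * (k / 2) * E z - M * (\<bar>D1 m z\<bar> + \<bar>D2 m z\<bar>) - \<epsilon> * (4 * A ^ 4 / k) * G z) \<le> (LINT z|lborel. R z)"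
    by (rule integral_mono[OF _ integrable_Cc[OF R_Cc] pt]) (intro Bochner_Integration.integrable_diff i)
  then show ?thesis
    unfolding R_integral Bochner_Integration.integral_diff[OF Bochner_Integration.integrable_diff[OF i(1,2)] i(3)]
      Bochner_Integration.integral_diff[OF i(1,2)] integral_mult_right_zero by simp
qed

end

end

end

section \<open>Bounds uniform along the sequence of solutions\<close>

lemma continuous_on_states_bounded:
  assumes "continuous_on states f" "compact K" "K \<subseteq> states"
  shows "\<exists>A\<ge>0. \<forall>w\<in>K. \<bar>f w\<bar> \<le> (A::real)"
proof -
  have "bounded (f ` K)"
    using assms by (intro compact_imp_bounded compact_continuous_image continuous_on_subset[OF assms(1)])
  then obtain A where A: "A > 0" "\<forall>y\<in>f ` K. norm y \<le> A" unfolding bounded_pos by (elim exE conjE)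
  then show ?thesis by (intro exI[of _ A]) auto
qed

lemma continuous_on_states_pos:
  assumes "continuous_on states f" "compact K" "K \<subseteq> states" "\<forall>w\<in>states. 0 < f w"
  shows "\<exists>k>0. \<forall>w\<in>K. k \<le> (f w :: real)"
proof (cases "K = {}")
  case False
  obtain x where x: "x \<in> K" "\<forall>y\<in>K. f x \<le> f y"
    using continuous_attains_inf[OF assms(2) False continuous_on_subset[OF assms(1,3)]] by blast
  have "0 < f x" using x(1) assms(3,4) by blast
  then show ?thesis using x(2) by blast
qed (auto intro: exI[of _ 1])

lemma entropy_pair_bounds:
  assumes pair: "entropy_pair \<gamma> Q1 Q2 a b" and s: "C1_on states (\<lambda>w. s1 (fst w))" "C1_on states (\<lambda>w. s2 (fst w))"
    and K: "compact K" "K \<subseteq> states"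
  shows "\<exists>A\<ge>0. \<forall>w\<in>K. \<bar>Q1 w\<bar> \<le> (A::real) \<and> \<bar>Q2 w\<bar> \<le> A \<and> \<bar>a w\<bar> \<le> A \<and> \<bar>b w\<bar> \<le> A
    \<and> \<bar>s1 (fst w)\<bar> \<le> A \<and> \<bar>s2 (fst w)\<bar> \<le> A
    \<and> \<bar>D1 a w\<bar> \<le> A \<and> \<bar>D2 a w\<bar> \<le> A \<and> \<bar>D1 b w\<bar> \<le> A \<and> \<bar>D2 b w\<bar> \<le> A"
proof -
  let ?f = "\<lambda>w. \<bar>Q1 w\<bar> + \<bar>Q2 w\<bar> + \<bar>a w\<bar> + \<bar>b w\<bar> + \<bar>s1 (fst w)\<bar> + \<bar>s2 (fst w)\<bar>
    + \<bar>D1 a w\<bar> + \<bar>D2 a w\<bar> + \<bar>D1 b w\<bar> + \<bar>D2 b w\<bar>"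
  have p: "C1_on states Q1" "C1_on states Q2" "C1_on states a" "C1_on states b"
    using pair by (simp_all add: entropy_pair_def)
  have "continuous_on states ?f"
    by (intro continuous_on_add continuous_on_rabs C1_onD(2-4)[OF p(3)] C1_onD(2-4)[OF p(4)]
      C1_onD(4)[OF p(1)] C1_onD(4)[OF p(2)] C1_onD(4)[OF s(1)] C1_onD(4)[OF s(2)])
  from continuous_on_states_bounded[OF this K]
  obtain A where A: "0 \<le> A" "\<forall>w\<in>K. \<bar>?f w\<bar> \<le> A" by (elim exE conjE)
  show ?thesis
  proof (intro exI[of _ A] conjI[OF A(1)] ballI)
    fix w assume "w \<in> K"
    have bound: "x1 \<le> A \<and> x2 \<le> A \<and> x3 \<le> A \<and> x4 \<le> A \<and> x5 \<le> A \<and> x6 \<le> A \<and> x7 \<le> A \<and> x8 \<le> A \<and> x9 \<le> A \<and> x10 \<le> A"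
      if "x1 + x2 + x3 + x4 + x5 + x6 + x7 + x8 + x9 + x10 \<le> A" "0 \<le> x1" "0 \<le> x2" "0 \<le> x3" "0 \<le> x4" "0 \<le> x5"
        "0 \<le> x6" "0 \<le> x7" "0 \<le> x8" "0 \<le> x9" "0 \<le> x10" for x1 x2 x3 x4 x5 x6 x7 x8 x9 x10 :: real
      using that by (intro conjI) linarith+
    have "?f w \<le> A" by (rule order_trans[OF abs_ge_self bspec[OF A(2) \<open>w \<in> K\<close>]])
    then show "\<bar>Q1 w\<bar> \<le> A \<and> \<bar>Q2 w\<bar> \<le> A \<and> \<bar>a w\<bar> \<le> A \<and> \<bar>b w\<bar> \<le> A
      \<and> \<bar>s1 (fst w)\<bar> \<le> A \<and> \<bar>s2 (fst w)\<bar> \<le> A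
      \<and> \<bar>D1 a w\<bar> \<le> A \<and> \<bar>D2 a w\<bar> \<le> A \<and> \<bar>D1 b w\<bar> \<le> A \<and> \<bar>D2 b w\<bar> \<le> A"
      by (rule bound) (rule abs_ge_zero)+
  qed
qed

text \<open>All constants are bounds, over one compact set of states, for functions that do not
  depend on \<open>n\<close>. On that set the two dissipation coefficients, \<open>s1\<close> and
  \<open>s2\<close> times minus the derivative of \<open>a\<close>, have positive lower
  bounds.\<close>

lemma viscous_energy_bound:
  fixes \<rho> \<theta> :: "nat \<Rightarrow> point \<Rightarrow> real"
  assumes flow: "\<And>n. viscous_flow \<Omega> \<eta> \<gamma> (\<epsilon> n) (\<rho> n) (\<theta> n) s1 s2"
    and pos: "\<And>r. r \<in> {0<..<1} \<Longrightarrow> 0 < s1 r" "\<And>r. r \<in> {0<..<1} \<Longrightarrow> 0 < s2 r"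
    and e0: "\<And>n. \<epsilon> n \<le> e0"
    and K: "compact K" "K \<subseteq> states" "\<And>n z. \<eta> z \<noteq> 0 \<Longrightarrow> (\<rho> n z, \<theta> n z) \<in> K"
  shows "\<exists>C\<ge>0. \<forall>n. \<epsilon> n * (LINT z|lborel. viscous_flow.E \<eta> (\<rho> n) (\<theta> n) z) \<le> C"
proof -
  interpret v0: viscous_flow \<Omega> \<eta> \<gamma> "\<epsilon> 0" "\<rho> 0" "\<theta> 0" s1 s2 by (rule flow)
  note g = v0.gamma
  obtain Q1 Q2 a where pair: "entropy_pair \<gamma> Q1 Q2 a (\<lambda>w. - snd w)"
    and da: "\<And>w. w \<in> states \<Longrightarrow> D1 a w = - ((gas_c \<gamma> (gas_q \<gamma> (fst w)))\<^sup>2 / (gas_q \<gamma> (fst w) * fst w)\<^sup>2)"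
    and da2: "\<And>w. w \<in> states \<Longrightarrow> D2 a w = 0"
    by (rule energy_pair_exists[OF g]) blast
  obtain A where A0: "0 \<le> A" and A: "\<And>w. w \<in> K \<Longrightarrow> \<bar>Q1 w\<bar> \<le> A \<and> \<bar>Q2 w\<bar> \<le> A \<and> \<bar>a w\<bar> \<le> A \<and> \<bar>- snd w\<bar> \<le> A
    \<and> \<bar>s1 (fst w)\<bar> \<le> A \<and> \<bar>s2 (fst w)\<bar> \<le> A
    \<and> \<bar>D1 a w\<bar> \<le> A \<and> \<bar>D2 a w\<bar> \<le> A \<and> \<bar>D1 (\<lambda>w. - snd w) w\<bar> \<le> A \<and> \<bar>D2 (\<lambda>w. - snd w) w\<bar> \<le> A"
    using entropy_pair_bounds[OF pair v0.s1 v0.s2 K(1,2)] by (elim exE conjE) (erule that, erule bspec)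
  have a1: "C1_on states a" using pair by (simp add: entropy_pair_def)
  have c2: "continuous_on states (\<lambda>w. - D1 a w * s2 (fst w))"
    by (intro continuous_on_mult continuous_on_minus C1_onD(2)[OF a1] C1_onD(4)[OF v0.s2])
  have p2: "\<forall>w\<in>states. 0 < - D1 a w * s2 (fst w)"
  proof
    fix w :: point assume w: "w \<in> states"
    have r: "fst w \<in> {0<..<1}" using w by (auto simp: mem_Times_iff)
    then have "(gas_c \<gamma> (gas_q \<gamma> (fst w)))\<^sup>2 > 0" "gas_q \<gamma> (fst w) > 0"
      using gas_q_props(4,5)[OF g, of "fst w"] by auto
    then show "0 < - D1 a w * s2 (fst w)" unfolding da[OF w] using pos(2)[OF r] r by simp
  qed
  from continuous_on_states_pos[OF c2 K(1,2) p2]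
  obtain k2 where k2: "0 < k2" "\<forall>w\<in>K. k2 \<le> - D1 a w * s2 (fst w)" by (elim exE conjE)
  have p1: "\<forall>w\<in>states. 0 < s1 (fst w)" using pos(1) by auto
  from continuous_on_states_pos[OF C1_onD(4)[OF v0.s1] K(1,2) p1]
  obtain k1 where k1: "0 < k1" "\<forall>w\<in>K. k1 \<le> s1 (fst w)" by (elim exE conjE)
  define k where "k = min k1 k2"
  have k: "0 < k" using k1 k2 by (simp add: k_def)
  let ?Nm = "LINT z|lborel. \<bar>D1 (cutoff.m \<eta>) z\<bar> + \<bar>D2 (cutoff.m \<eta>) z\<bar>"
  let ?NG = "LINT z|lborel. viscous_flow.G \<eta> z"
  have NG: "0 \<le> ?NG" by (simp add: v0.G_def)
  have Nm: "0 \<le> ?Nm" by simp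
  define C where "C = (A * ?Nm + e0 * (4 * A ^ 4 / k) * ?NG) / (k / 2)"
  have e00: "0 \<le> e0" using e0[of 0] v0.eps by linarith
  show ?thesis
  proof (intro exI[of _ C] conjI allI)
    show "0 \<le> C" unfolding C_def using A0 Nm e00 k NG
      by (intro divide_nonneg_pos add_nonneg_nonneg mult_nonneg_nonneg) auto
    fix n
    interpret v: viscous_flow \<Omega> \<eta> \<gamma> "\<epsilon> n" "\<rho> n" "\<theta> n" s1 s2 by (rule flow)
    have AA: "\<eta> z \<noteq> 0 \<Longrightarrow> \<bar>Q1 (\<rho> n z, \<theta> n z)\<bar> \<le> A" "\<eta> z \<noteq> 0 \<Longrightarrow> \<bar>Q2 (\<rho> n z, \<theta> n z)\<bar> \<le> A"
      "\<eta> z \<noteq> 0 \<Longrightarrow> \<bar>a (\<rho> n z, \<theta> n z)\<bar> \<le> A" "\<eta> z \<noteq> 0 \<Longrightarrow> \<bar>- snd (\<rho> n z, \<theta> n z)\<bar> \<le> A"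
      "\<eta> z \<noteq> 0 \<Longrightarrow> \<bar>s1 (\<rho> n z)\<bar> \<le> A" "\<eta> z \<noteq> 0 \<Longrightarrow> \<bar>s2 (\<rho> n z)\<bar> \<le> A" for z
      using A[OF K(3)[of z n]] by simp_all
    have "\<epsilon> n * (k / 2) * (LINT z|lborel. v.E z) \<le> A * ?Nm + \<epsilon> n * (4 * A ^ 4 / k) * ?NG"
    proof (rule v.energy_estimate[OF pair AA A0 A0 refl da2 k])
      show "k \<le> - D1 a (\<rho> n z, \<theta> n z) * s2 (\<rho> n z)" "k \<le> s1 (\<rho> n z)" if "\<eta> z \<noteq> 0" for z
        using bspec[OF k1(2) K(3)[OF that, of n]] bspec[OF k2(2) K(3)[OF that, of n]] by (simp_all add: k_def min_le_iff_disj)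
    qed
    also have "\<dots> \<le> A * ?Nm + e0 * (4 * A ^ 4 / k) * ?NG"
      using e0[of n] NG A0 k by (intro add_left_mono mult_right_mono) auto
    finally have "\<epsilon> n * (LINT z|lborel. v.E z) * (k / 2) \<le> A * ?Nm + e0 * (4 * A ^ 4 / k) * ?NG"
      by (simp only: mult.assoc mult.commute[of "k / 2"])
    then show "\<epsilon> n * (LINT z|lborel. v.E z) \<le> C" unfolding C_def using k by (subst pos_le_divide_eq) auto
  qed
qed

text \<open>The energy bound comes from the special pair and is used for an arbitrary one. A bounded
  \<open>\<epsilon> \<integral>E\<close> controls the remainder in \<open>L\<^sup>1\<close>, and
  \<open>\<epsilon>\<^sup>2 \<integral>E = \<epsilon> (\<epsilon> \<integral>E)\<close> tends to
  zero.\<close>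

lemma viscous_flow_decomposition:
  fixes \<rho> \<theta> :: "nat \<Rightarrow> point \<Rightarrow> real"
  assumes flow: "\<And>n. viscous_flow \<Omega> \<eta> \<gamma> (\<epsilon> n) (\<rho> n) (\<theta> n) s1 s2"
    and pos: "\<And>r. r \<in> {0<..<1} \<Longrightarrow> 0 < s1 r" "\<And>r. r \<in> {0<..<1} \<Longrightarrow> 0 < s2 r"
    and eps: "\<epsilon> \<longlonglongrightarrow> 0"
    and K: "compact K" "K \<subseteq> states" "\<And>n z. \<eta> z \<noteq> 0 \<Longrightarrow> (\<rho> n z, \<theta> n z) \<in> K"
    and pair: "entropy_pair \<gamma> Q1 Q2 a b"
  shows "\<exists>(A::real) (C::real) (\<delta>::nat \<Rightarrow> real).
    (\<forall>n z. \<bar>viscous_flow.QQ1 \<eta> (\<rho> n) (\<theta> n) Q1 z\<bar> \<le> A) \<and> (\<forall>n z. \<bar>viscous_flow.QQ2 \<eta> (\<rho> n) (\<theta> n) Q2 z\<bar> \<le> A)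
    \<and> (\<forall>n. (LINT z|lborel. \<bar>viscous_flow.R \<eta> (\<epsilon> n) (\<rho> n) (\<theta> n) s1 s2 Q1 Q2 a b z\<bar>) \<le> C)
    \<and> (\<forall>n. (LINT z|lborel. (viscous_flow.PP1 \<eta> (\<epsilon> n) (\<rho> n) (\<theta> n) s1 s2 a b z)\<^sup>2
      + (viscous_flow.PP2 \<eta> (\<epsilon> n) (\<rho> n) (\<theta> n) s1 s2 a b z)\<^sup>2) \<le> \<delta> n)
    \<and> \<delta> \<longlonglongrightarrow> 0"
proof -
  interpret v0: viscous_flow \<Omega> \<eta> \<gamma> "\<epsilon> 0" "\<rho> 0" "\<theta> 0" s1 s2 by (rule flow)
  have "bounded (range \<epsilon>)" using eps by (intro convergent_imp_bounded) (auto simp: convergent_def)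
  then obtain e0 where e0': "\<forall>y\<in>range \<epsilon>. norm y \<le> e0" unfolding bounded_pos by blast
  have e0: "\<epsilon> n \<le> e0" for n using e0' by (auto dest: spec[of _ n] simp: abs_le_iff)
  obtain CE where CE: "0 \<le> CE" "\<And>n. \<epsilon> n * (LINT z|lborel. viscous_flow.E \<eta> (\<rho> n) (\<theta> n) z) \<le> CE"
  proof -
    have "\<exists>C\<ge>0. \<forall>n. \<epsilon> n * (LINT z|lborel. viscous_flow.E \<eta> (\<rho> n) (\<theta> n) z) \<le> C"
      by (rule viscous_energy_bound[where K = K]; fact)
    then show thesis using that by blast
  qed
  obtain A where A0: "0 \<le> A" and A: "\<And>w. w \<in> K \<Longrightarrow> \<bar>Q1 w\<bar> \<le> A \<and> \<bar>Q2 w\<bar> \<le> A \<and> \<bar>a w\<bar> \<le> A \<and> \<bar>b w\<bar> \<le> A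
    \<and> \<bar>s1 (fst w)\<bar> \<le> A \<and> \<bar>s2 (fst w)\<bar> \<le> A
    \<and> \<bar>D1 a w\<bar> \<le> A \<and> \<bar>D2 a w\<bar> \<le> A \<and> \<bar>D1 b w\<bar> \<le> A \<and> \<bar>D2 b w\<bar> \<le> A"
    using entropy_pair_bounds[OF pair v0.s1 v0.s2 K(1,2)] by (elim exE conjE) (erule that, erule bspec)
  let ?Nm = "LINT z|lborel. \<bar>D1 (cutoff.m \<eta>) z\<bar> + \<bar>D2 (cutoff.m \<eta>) z\<bar>"
  let ?NG = "LINT z|lborel. viscous_flow.G \<eta> z"
  have NG: "0 \<le> ?NG" by (simp add: v0.G_def)
  define C where "C = A * ?Nm + ((1 + 4 * A\<^sup>2) * CE + 2 * A ^ 4 * (e0 * ?NG))"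
  define \<delta> where "\<delta> = (\<lambda>n. \<epsilon> n * (2 * A ^ 4 * CE))"
  have AA: "\<eta> z \<noteq> 0 \<Longrightarrow> \<bar>Q1 (\<rho> n z, \<theta> n z)\<bar> \<le> A" "\<eta> z \<noteq> 0 \<Longrightarrow> \<bar>Q2 (\<rho> n z, \<theta> n z)\<bar> \<le> A"
    "\<eta> z \<noteq> 0 \<Longrightarrow> \<bar>a (\<rho> n z, \<theta> n z)\<bar> \<le> A" "\<eta> z \<noteq> 0 \<Longrightarrow> \<bar>b (\<rho> n z, \<theta> n z)\<bar> \<le> A"
    "\<eta> z \<noteq> 0 \<Longrightarrow> \<bar>s1 (\<rho> n z)\<bar> \<le> A" "\<eta> z \<noteq> 0 \<Longrightarrow> \<bar>s2 (\<rho> n z)\<bar> \<le> A"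
    and BB: "\<eta> z \<noteq> 0 \<Longrightarrow> \<bar>D1 a (\<rho> n z, \<theta> n z)\<bar> \<le> A" "\<eta> z \<noteq> 0 \<Longrightarrow> \<bar>D2 a (\<rho> n z, \<theta> n z)\<bar> \<le> A"
    "\<eta> z \<noteq> 0 \<Longrightarrow> \<bar>D1 b (\<rho> n z, \<theta> n z)\<bar> \<le> A" "\<eta> z \<noteq> 0 \<Longrightarrow> \<bar>D2 b (\<rho> n z, \<theta> n z)\<bar> \<le> A" for n z
    using A[OF K(3)[of z n]] by simp_all
  show ?thesis
  proof (rule exI[of _ A], rule exI[of _ C], rule exI[of _ \<delta>], intro conjI allI)
    fix n
    interpret v: viscous_flow \<Omega> \<eta> \<gamma> "\<epsilon> n" "\<rho> n" "\<theta> n" s1 s2 by (rule flow)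
    show "\<bar>v.QQ1 Q1 z\<bar> \<le> A" for z by (rule v.QQ_bound(1)[OF pair AA A0 A0])
    show "\<bar>v.QQ2 Q2 z\<bar> \<le> A" for z by (rule v.QQ_bound(2)[OF pair AA A0 A0])
    have iR: "integrable lborel (\<lambda>z. \<bar>v.R Q1 Q2 a b z\<bar>)"
      by (intro integrable_abs integrable_Cc v.R_Cc[OF pair])
    have "(LINT z|lborel. \<bar>v.R Q1 Q2 a b z\<bar>)
      \<le> (LINT z|lborel. A * (\<bar>D1 (cutoff.m \<eta>) z\<bar> + \<bar>D2 (cutoff.m \<eta>) z\<bar>) + \<epsilon> n * ((1 + 4 * A\<^sup>2) * v.E z + 2 * A ^ 4 * v.G z))"
    proof (rule integral_mono[OF iR])
      show "integrable lborel (\<lambda>z. A * (\<bar>D1 (cutoff.m \<eta>) z\<bar> + \<bar>D2 (cutoff.m \<eta>) z\<bar>) + \<epsilon> n * ((1 + 4 * A\<^sup>2) * v.E z + 2 * A ^ 4 * v.G z))"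
        by (intro Bochner_Integration.integrable_add integrable_mult_right v.Dm_integrable v.E_integrable v.G_integrable)
      show "\<bar>v.R Q1 Q2 a b z\<bar> \<le> A * (\<bar>D1 (cutoff.m \<eta>) z\<bar> + \<bar>D2 (cutoff.m \<eta>) z\<bar>) + \<epsilon> n * ((1 + 4 * A\<^sup>2) * v.E z + 2 * A ^ 4 * v.G z)" for z
        by (rule v.R_bound[OF pair AA A0 A0 BB])
    qed
    also have "\<dots> = A * ?Nm + \<epsilon> n * ((1 + 4 * A\<^sup>2) * (LINT z|lborel. v.E z) + 2 * A ^ 4 * ?NG)"
    proof -
      note i = v.Dm_integrable[THEN integrable_mult_right, of A] v.E_integrable[THEN integrable_mult_right, of "1 + 4 * A\<^sup>2"]
        v.G_integrable[THEN integrable_mult_right, of "2 * A ^ 4"]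
      note i' = Bochner_Integration.integrable_add[OF i(2,3)]
      show ?thesis
        unfolding Bochner_Integration.integral_add[OF i(1) integrable_mult_right[OF i']] integral_mult_right_zero
          Bochner_Integration.integral_add[OF i(2,3)] ..
    qed
    also have "\<dots> = A * ?Nm + ((1 + 4 * A\<^sup>2) * (\<epsilon> n * (LINT z|lborel. v.E z)) + 2 * A ^ 4 * (\<epsilon> n * ?NG))"
      by (simp add: algebra_simps)
    also have "\<dots> \<le> C" unfolding C_def
      using CE(2)[of n] e0[of n] NG A0 by (intro add_left_mono add_mono mult_left_mono mult_right_mono) auto
    finally show "(LINT z|lborel. \<bar>v.R Q1 Q2 a b z\<bar>) \<le> C" .
    have "(LINT z|lborel. (v.PP1 a b z)\<^sup>2 + (v.PP2 a b z)\<^sup>2) \<le> (LINT z|lborel. 2 * (\<epsilon> n)\<^sup>2 * A ^ 4 * v.E z)"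
    proof (rule integral_mono)
      show "integrable lborel (\<lambda>z. (v.PP1 a b z)\<^sup>2 + (v.PP2 a b z)\<^sup>2)"
        unfolding power2_eq_square
        by (intro Bochner_Integration.integrable_add integrable_Cc continuous_on_mult bounded_supp_mult(1)
          C1_onD(4)[OF v.PP_C1(1)[OF pair]] C1_onD(4)[OF v.PP_C1(2)[OF pair]] v.PP_C1(3,4)[OF pair])
      show "integrable lborel (\<lambda>z. 2 * (\<epsilon> n)\<^sup>2 * A ^ 4 * v.E z)" by (intro integrable_mult_right v.E_integrable)
      show "(v.PP1 a b z)\<^sup>2 + (v.PP2 a b z)\<^sup>2 \<le> 2 * (\<epsilon> n)\<^sup>2 * A ^ 4 * v.E z" for z
        by (rule v.PP_bound[OF pair AA A0 A0])
    qed
    also have "\<dots> = (\<epsilon> n * (2 * A ^ 4)) * (\<epsilon> n * (LINT z|lborel. v.E z))"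
      by (simp add: power2_eq_square)
    also have "\<dots> \<le> (\<epsilon> n * (2 * A ^ 4)) * CE" using CE(2)[of n] v.eps A0 by (intro mult_left_mono) auto
    finally show "(LINT z|lborel. (v.PP1 a b z)\<^sup>2 + (v.PP2 a b z)\<^sup>2) \<le> \<delta> n" by (simp add: \<delta>_def mult.assoc)
  next
    show "\<delta> \<longlonglongrightarrow> 0" unfolding \<delta>_def using tendsto_mult_right[OF eps, of "2 * A ^ 4 * CE"] by simp
  qed
qed

section \<open>Compactness of the entropy production\<close>

lemma C_upto_imp_C_on: "C_upto k \<Omega> S f \<Longrightarrow> C_on k \<Omega> f"
proof (induction k arbitrary: f)
  case 0
  then obtain g where "continuous_on (\<Omega> \<union> S) g" "\<forall>z\<in>\<Omega>. g z = f z" by auto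
  then show ?case using continuous_on_subset[of "\<Omega> \<union> S" g \<Omega>] by auto
next
  case (Suc k)
  then obtain g where "continuous_on (\<Omega> \<union> S) g" "\<forall>z\<in>\<Omega>. g z = f z" by auto
  then have "\<exists>g. continuous_on (\<Omega> \<union> {}) g \<and> (\<forall>z\<in>\<Omega>. g z = f z)"
    using continuous_on_subset[of "\<Omega> \<union> S" g \<Omega>] by auto
  then show ?case using Suc by simp
qed

lemma C_upto_2_C1:
  assumes "C_upto 2 \<Omega> S f" "open \<Omega>"
  shows "C1_on \<Omega> f" "C1_on \<Omega> (D1 f)" "C1_on \<Omega> (D2 f)"
proof -
  have c: "C_on (Suc (Suc 0)) \<Omega> f" using C_upto_imp_C_on[OF assms(1)] by (simp add: numeral_2_eq_2)
  show "C1_on \<Omega> f" by (rule C1_on_C_upto[OF c assms(2)])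
  show "C1_on \<Omega> (D1 f)" by (rule C1_on_C_upto[OF C_on_SucD(1)[OF c] assms(2)])
  show "C1_on \<Omega> (D2 f)" by (rule C1_on_C_upto[OF C_on_SucD(2)[OF c] assms(2)])
qed

lemma viscosity_coeff_C1:
  assumes g: "1 \<le> \<gamma>" and s: "smooth_real {q. ereal q < q_cav \<gamma>} \<sigma>"
  shows "C1_on states (\<lambda>w. \<sigma> (gas_q \<gamma> (fst w)))"
proof -
  let ?g' = "\<lambda>r. deriv \<sigma> (gas_q \<gamma> r) * gas_q' \<gamma> r"
  have q: "ereal (gas_q \<gamma> r) < q_cav \<gamma>" if "r \<in> {0<..<1}" for r
    using gas_q_props(2)[OF g, of r] that by auto
  have d0: "\<sigma> field_differentiable (at x)" and d1: "deriv \<sigma> field_differentiable (at x)" if "ereal x < q_cav \<gamma>" for x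
    using s that unfolding smooth_real_def by (auto dest: spec[of _ 0] spec[of _ "Suc 0"])
  have "\<forall>r\<in>{0<..<1}. ((\<lambda>r. \<sigma> (gas_q \<gamma> r)) has_real_derivative ?g' r) (at r)"
  proof
    fix r :: real assume r: "r \<in> {0<..<1}"
    have "(\<sigma> has_real_derivative deriv \<sigma> (gas_q \<gamma> r)) (at (gas_q \<gamma> r))"
      using d0[OF q[OF r]] by (simp add: field_differentiable_derivI)
    then show "((\<lambda>r. \<sigma> (gas_q \<gamma> r)) has_real_derivative ?g' r) (at r)"
      using gas_q_deriv[OF g r] by (rule DERIV_chain2)
  qed
  moreover have "continuous_on {0<..<1} ?g'"
  proof (rule continuous_on_mult[OF _ continuous_gas_q'[OF g]])
    have "continuous_on (gas_q \<gamma> ` {0<..<1}) (deriv \<sigma>)"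
    proof (rule continuous_at_imp_continuous_on, rule ballI)
      fix x assume "x \<in> gas_q \<gamma> ` {0<..<1}"
      then have "ereal x < q_cav \<gamma>" using q by blast
      from field_differentiable_imp_continuous_at[OF d1[OF this]] show "isCont (deriv \<sigma>) x" .
    qed
    then show "continuous_on {0<..<1} (\<lambda>r. deriv \<sigma> (gas_q \<gamma> r))"
      by (rule continuous_on_compose2[OF _ continuous_gas_q[OF g]]) simp
  qed
  ultimately show ?thesis by (rule C1_on_states_fst)
qed

lemma VP_solution_viscous_flow:
  assumes g: "1 \<le> \<gamma>" and \<eta>: "cutoff \<Omega> \<eta>" and s: "viscosity_coeffs \<gamma> \<sigma>1 \<sigma>2" and e: "0 < \<epsilon>"
    and VP: "VP_solution \<gamma> \<sigma>1 \<sigma>2 u_inf v_inf \<Omega> \<Gamma>1 \<Gamma>2 \<epsilon> \<rho> \<theta>"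
    and range: "\<And>z. z \<in> \<Omega> \<Longrightarrow> \<rho> z \<in> {0<..<1}"
  shows "viscous_flow \<Omega> \<eta> \<gamma> \<epsilon> \<rho> \<theta> (\<lambda>r. \<sigma>1 (gas_q \<gamma> r)) (\<lambda>r. \<sigma>2 (gas_q \<gamma> r))"
proof -
  interpret cutoff \<Omega> \<eta> by (rule \<eta>)
  have v: "vel_u \<gamma> \<rho> \<theta> = (\<lambda>p. st_u \<gamma> (\<rho> p, \<theta> p))" "vel_v \<gamma> \<rho> \<theta> = (\<lambda>p. st_v \<gamma> (\<rho> p, \<theta> p))"
    "(\<lambda>p. \<rho> p * st_u \<gamma> (\<rho> p, \<theta> p)) = (\<lambda>p. st_m \<gamma> (\<rho> p, \<theta> p))" "(\<lambda>p. \<rho> p * st_v \<gamma> (\<rho> p, \<theta> p)) = (\<lambda>p. st_n \<gamma> (\<rho> p, \<theta> p))"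
    by (simp_all add: fun_eq_iff vel_u_def vel_v_def st_u_def st_v_def st_m_def st_n_def)
  have C2: "C_upto 2 \<Omega> \<Gamma>1 \<rho>" "C_upto 2 \<Omega> \<Gamma>1 \<theta>"
    using VP unfolding VP_solution_def Let_def by blast+
  have eqs: "\<forall>z\<in>\<Omega>. D1 (vel_v \<gamma> \<rho> \<theta>) z - D2 (vel_u \<gamma> \<rho> \<theta>) z = \<epsilon> * divergence (\<lambda>z. \<sigma>1 (gas_q \<gamma> (\<rho> z)) *\<^sub>R grad \<theta> z) z"
    "\<forall>z\<in>\<Omega>. D1 (\<lambda>p. \<rho> p * vel_u \<gamma> \<rho> \<theta> p) z + D2 (\<lambda>p. \<rho> p * vel_v \<gamma> \<rho> \<theta> p) z
      = \<epsilon> * divergence (\<lambda>z. \<sigma>2 (gas_q \<gamma> (\<rho> z)) *\<^sub>R grad \<rho> z) z"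
    using VP unfolding VP_solution_def Let_def by blast+
  have sm: "smooth_real {q. ereal q < q_cav \<gamma>} \<sigma>1" "smooth_real {q. ereal q < q_cav \<gamma>} \<sigma>2"
    using s unfolding viscosity_coeffs_def by blast+
  show ?thesis
  proof
    show "C1_on states (\<lambda>w. \<sigma>1 (gas_q \<gamma> (fst w)))" "C1_on states (\<lambda>w. \<sigma>2 (gas_q \<gamma> (fst w)))"
      by (rule viscosity_coeff_C1[OF g sm(1)] viscosity_coeff_C1[OF g sm(2)])+
    show "D1 (\<lambda>p. st_v \<gamma> (\<rho> p, \<theta> p)) z - D2 (\<lambda>p. st_u \<gamma> (\<rho> p, \<theta> p)) z =
      \<epsilon> * (D1 (\<lambda>p. \<sigma>1 (gas_q \<gamma> (\<rho> p)) * D1 \<theta> p) z + D2 (\<lambda>p. \<sigma>1 (gas_q \<gamma> (\<rho> p)) * D2 \<theta> p) z)"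
      "D1 (\<lambda>p. st_m \<gamma> (\<rho> p, \<theta> p)) z + D2 (\<lambda>p. st_n \<gamma> (\<rho> p, \<theta> p)) z =
      \<epsilon> * (D1 (\<lambda>p. \<sigma>2 (gas_q \<gamma> (\<rho> p)) * D1 \<rho> p) z + D2 (\<lambda>p. \<sigma>2 (gas_q \<gamma> (\<rho> p)) * D2 \<rho> p) z)"
      if "z \<in> \<Omega>" for z
      using bspec[OF eqs(1) that] bspec[OF eqs(2) that] unfolding v by (simp_all add: divergence_def grad_def)
  qed (use g e range C_upto_2_C1[OF C2(1) open_\<Omega>] C_upto_2_C1[OF C2(2) open_\<Omega>] in auto)
qed

section \<open>Compact subsets of the flow domain\<close>

lemma domain_boundary:
  assumes "domain_type_a \<Omega> \<Gamma>1 \<Gamma>2 \<or> domain_type_b \<Omega> \<Gamma>1 \<Gamma>2"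
  shows "open \<Omega>" "\<Gamma>1 \<noteq> {}" "\<Gamma>1 \<subseteq> frontier \<Omega>"
proof -
  have "open \<Omega> \<and> \<Gamma>1 \<noteq> {} \<and> \<Gamma>1 \<subseteq> frontier \<Omega>"
    using assms
  proof
    assume "domain_type_a \<Omega> \<Gamma>1 \<Gamma>2"
    then have *: "open \<Omega>" "frontier \<Omega> = \<Gamma>1 \<union> \<Gamma>2" "boundary_type_a \<Gamma>1 \<Gamma>2" unfolding domain_type_a_def by blast+
    then obtain g :: "real \<Rightarrow> point" where "\<Gamma>1 = g ` {0<..<1}" unfolding boundary_type_a_def by blast
    then show ?thesis using * by auto
  next
    assume "domain_type_b \<Omega> \<Gamma>1 \<Gamma>2"
    then have *: "open \<Omega>" "frontier \<Omega> = \<Gamma>1 \<union> \<Gamma>2" "\<exists>g :: real \<Rightarrow> point. \<Gamma>1 = path_image g"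
      unfolding domain_type_b_def by blast+
    then show ?thesis using path_image_nonempty by auto
  qed
  then show "open \<Omega>" "\<Gamma>1 \<noteq> {}" "\<Gamma>1 \<subseteq> frontier \<Omega>" by auto
qed

text \<open>Places a compact subset of the domain inside some \<open>\<Omega>_\<delta>\<close>,
  where the assumed lower bound \<open>\<alpha>(\<delta>)\<close> on the speed is available.\<close>

lemma compact_boundary_distance:
  fixes \<Omega> \<Gamma> K :: "point set"
  assumes "open \<Omega>" "\<Gamma> \<noteq> {}" "\<Gamma> \<subseteq> frontier \<Omega>" "compact K" "K \<subseteq> \<Omega>"
  obtains \<delta> where "0 < \<delta>" "\<And>z. z \<in> K \<Longrightarrow> \<delta> \<le> infdist z \<Gamma>"
proof -
  have "K \<inter> frontier \<Omega> = {}" using assms(1,5) by (auto simp: frontier_def interior_open)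
  then obtain d where d: "d > 0" "\<And>x y. x \<in> K \<Longrightarrow> y \<in> frontier \<Omega> \<Longrightarrow> d \<le> dist x y"
    using separate_compact_closed[OF assms(4) frontier_closed[of \<Omega>]] by blast
  show ?thesis
  proof (rule that[OF d(1)])
    fix z assume z: "z \<in> K"
    show "d \<le> infdist z \<Gamma>"
      unfolding infdist_notempty[OF assms(2)]
      by (rule cINF_greatest[OF assms(2)], rule d(2)[OF z], rule subsetD[OF assms(3)])
  qed
qed

lemma compactly_inside_superset:
  assumes "open \<Omega>" "compact K" "K \<subseteq> \<Omega>"
  obtains U where "compactly_inside U \<Omega>" "K \<subseteq> U"
proof -
  obtain \<eta> :: "point \<Rightarrow> real" where \<eta>: "C1_on UNIV \<eta>" "bounded (supp \<eta>)" "closure (supp \<eta>) \<subseteq> \<Omega>"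
    "\<And>z. z \<in> K \<Longrightarrow> \<eta> z = 1"
    by (rule C1_cutoff[OF assms(2,1,3)]) blast
  let ?U = "{z. 1 / 2 < \<eta> z}"
  have "open ?U" by (rule open_Collect_less[OF continuous_on_const C1_onD(4)[OF \<eta>(1)]])
  moreover have c: "closure ?U \<subseteq> closure (supp \<eta>)" by (rule closure_mono) auto
  moreover have "compact (closure ?U)"
  proof -
    have "?U \<subseteq> supp \<eta>" by auto
    from bounded_subset[OF \<eta>(2) this] show ?thesis by simp
  qed
  ultimately have "compactly_inside ?U \<Omega>" unfolding compactly_inside_def using \<eta>(3) by blast
  moreover have "K \<subseteq> ?U" using \<eta>(4) by auto
  ultimately show ?thesis by (rule that)
qed

text \<open>Supplies the pointwise boundedness asked for by the compactness criterion: the test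
  function is fixed, so its derivatives may appear in \<open>L\<^sup>1\<close>, and the fields enter
  only through their sup bound.\<close>

lemma divergence_pairing_bound:
  assumes F: "C1_on UNIV F1" "C1_on UNIV F2" "bounded (supp F1)" "bounded (supp F2)"
    and A: "\<And>z. \<bar>F1 z\<bar> \<le> A" "\<And>z. \<bar>F2 z\<bar> \<le> A" and \<phi>: "C1_on UNIV \<phi>" "bounded (supp \<phi>)"
  shows "\<bar>LINT z|lborel. (D1 F1 z + D2 F2 z) * \<phi> z\<bar>
    \<le> A * (LINT z|lborel. \<bar>D1 \<phi> z\<bar>) + A * (LINT z|lborel. \<bar>D2 \<phi> z\<bar>)"
proof -
  have b: "\<bar>LINT z|lborel. f z * g z\<bar> \<le> A * (LINT z|lborel. \<bar>g z\<bar>)"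
    if f: "continuous_on UNIV f" "\<And>z. \<bar>f z\<bar> \<le> A" and g: "continuous_on UNIV g" "bounded (supp g)" for f g :: "point \<Rightarrow> real"
  proof -
    have "\<bar>LINT z|lborel. f z * g z\<bar> \<le> (LINT z|lborel. \<bar>f z * g z\<bar>)" by (rule integral_abs_bound)
    also have "\<dots> \<le> (LINT z|lborel. A * \<bar>g z\<bar>)"
    proof (rule integral_mono)
      show "integrable lborel (\<lambda>z. \<bar>f z * g z\<bar>)"
        by (intro integrable_abs integrable_Cc continuous_on_mult f(1) g(1) bounded_supp_mult(2) g(2))
      show "integrable lborel (\<lambda>z. A * \<bar>g z\<bar>)" by (intro integrable_mult_right integrable_abs integrable_Cc g)
      show "\<bar>f z * g z\<bar> \<le> A * \<bar>g z\<bar>" for z unfolding abs_mult by (rule mult_right_mono[OF f(2)]) simp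
    qed
    finally show ?thesis by simp
  qed
  have i: "integrable lborel (\<lambda>z. D1 F1 z * \<phi> z)" "integrable lborel (\<lambda>z. D2 F2 z * \<phi> z)"
    by (rule integrable_Cc[OF continuous_on_mult[OF C1_onD(2)[OF F(1)] C1_onD(4)[OF \<phi>(1)]] bounded_supp_mult(2)[OF \<phi>(2)]]
      integrable_Cc[OF continuous_on_mult[OF C1_onD(3)[OF F(2)] C1_onD(4)[OF \<phi>(1)]] bounded_supp_mult(2)[OF \<phi>(2)]])+
  have "(LINT z|lborel. (D1 F1 z + D2 F2 z) * \<phi> z) = - (LINT z|lborel. F1 z * D1 \<phi> z) - (LINT z|lborel. F2 z * D2 \<phi> z)"
    using i integration_by_parts(1)[OF F(1) \<phi>(1) disjI1[OF F(3)]] integration_by_parts(2)[OF F(2) \<phi>(1) disjI1[OF F(4)]]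
    by (simp add: distrib_right)
  then show ?thesis
    using b[OF C1_onD(4)[OF F(1)] A(1) C1_onD(2)[OF \<phi>(1)] bounded_supp_D(1)[OF \<phi>(2)]]
      b[OF C1_onD(4)[OF F(2)] A(2) C1_onD(3)[OF \<phi>(1)] bounded_supp_D(2)[OF \<phi>(2)]]
    by linarith
qed

theorem proposition8p3:
  fixes \<gamma> u_inf v_inf q_star B :: real
    and \<Omega> \<Gamma>1 \<Gamma>2 :: "point set"
    and \<sigma>1 \<sigma>2 :: "real \<Rightarrow> real"
    and \<epsilon> :: "nat \<Rightarrow> real"
    and \<rho> \<theta> :: "nat \<Rightarrow> point \<Rightarrow> real"
    and \<alpha> :: "real \<Rightarrow> real"
    and \<mu> :: "real \<Rightarrow> real"
    and H :: "point \<Rightarrow> real"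
  assumes "1 \<le> \<gamma>" and "\<gamma> < 3"
    and "v_inf = 0" and "0 < u_inf" and "ereal u_inf < q_cav \<gamma>"
    and "domain_type_a \<Omega> \<Gamma>1 \<Gamma>2 \<or> domain_type_b \<Omega> \<Gamma>1 \<Gamma>2"
    and "viscosity_coeffs \<gamma> \<sigma>1 \<sigma>2"
    and "\<And>n. 0 < \<epsilon> n" and "\<epsilon> \<longlonglongrightarrow> 0"
    and "\<And>n. VP_solution \<gamma> \<sigma>1 \<sigma>2 u_inf v_inf \<Omega> \<Gamma>1 \<Gamma>2 (\<epsilon> n) (\<rho> n) (\<theta> n)"
    and "ereal q_star < q_cav \<gamma>"
    and "\<And>n z. z \<in> \<Omega> \<Longrightarrow> gas_q \<gamma> (\<rho> n z) \<le> q_star"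
    and "\<And>n z. z \<in> \<Omega> \<Longrightarrow> \<bar>\<theta> n z\<bar> \<le> B"
    and "\<And>\<delta>. 0 < \<delta> \<Longrightarrow> 0 < \<alpha> \<delta>" and "(\<alpha> \<longlongrightarrow> 0) (at_right 0)"
    and "\<And>\<delta> n z. 0 < \<delta> \<Longrightarrow> z \<in> \<Omega> \<Longrightarrow> \<delta> \<le> infdist z \<Gamma>1 \<Longrightarrow> \<alpha> \<delta> \<le> gas_q \<gamma> (\<rho> n z)"
    and "mu_function \<gamma> \<mu>" and "entropy_generator \<gamma> \<mu> H"
  shows "\<exists>K. compactin (Hm1_loc_topology \<Omega>) K \<and>
    (\<forall>n. distr_div \<Omega> (\<lambda>z. entropy_Q1 \<gamma> \<mu> H (\<rho> n z) (\<theta> n z))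
                     (\<lambda>z. entropy_Q2 \<gamma> \<mu> H (\<rho> n z) (\<theta> n z)) \<in> K)"
proof -
  note g = assms(1)
  note dom = domain_boundary[OF assms(6)]
  have rho01: "0 < \<rho> n z" "\<rho> n z \<le> 1" if "z \<in> \<Omega>" for n z
    using assms(10)[of n] closure_subset[of \<Omega>] that unfolding VP_solution_def Let_def by blast+
  have lower: "\<exists>c>0. \<forall>n. \<forall>z\<in>K. c \<le> gas_q \<gamma> (\<rho> n z)" if K: "compact K" "K \<subseteq> \<Omega>" for K
  proof -
    obtain \<delta> where \<delta>: "0 < \<delta>" "\<And>z. z \<in> K \<Longrightarrow> \<delta> \<le> infdist z \<Gamma>1"
      using compact_boundary_distance[OF dom K] by blast
    show ?thesis
      by (intro exI[of _ "\<alpha> \<delta>"] conjI assms(14)[OF \<delta>(1)] allI ballI assms(16)[OF \<delta>(1)] \<delta>(2) subsetD[OF K(2)])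
  qed
  \<comment> \<open>Density 1 means stagnation. The lower bound applied to the compact set
    \<open>{z}\<close> excludes it at each interior point.\<close>
  have range: "\<rho> n z \<in> {0<..<1}" if z: "z \<in> \<Omega>" for n z
  proof -
    obtain c where "c > 0" "c \<le> gas_q \<gamma> (\<rho> n z)" using lower[of "{z}"] z by auto
    moreover have "gas_q \<gamma> 1 = 0" using gas_q_eq[OF g, of 1] by (simp add: speed_sq_def)
    ultimately have "\<rho> n z \<noteq> 1" by auto
    then show ?thesis using rho01[OF z, of n] by simp
  qed
  \<comment> \<open>Speeds between \<open>c\<close> and \<open>q_star\<close> correspond to
    densities between two values strictly inside \<open>(0, 1)\<close>. The empty set is treated
    apart because \<open>c \<le> q_star\<close> is inferred from a point of
    \<open>K\<close>.\<close>
  have states: "\<exists>S. compact S \<and> S \<subseteq> states \<and> (\<forall>n. \<forall>z\<in>K. (\<rho> n z, \<theta> n z) \<in> S)" if K: "compact K" "K \<subseteq> \<Omega>" for K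
  proof (cases "K = {}")
    case False
    then obtain z0 where z0: "z0 \<in> K" by blast
    obtain c where c: "c > 0" "\<And>n z. z \<in> K \<Longrightarrow> c \<le> gas_q \<gamma> (\<rho> n z)" using lower[OF K] by blast
    have cq: "c \<le> q_star" using c(2)[OF z0, of 0] assms(12)[of z0 0] z0 K(2) by auto
    then have cc: "ereal c < q_cav \<gamma>" using assms(11) by (metis ereal_less_eq(3) order_le_less_trans)
    let ?S = "{gas_rho \<gamma> q_star .. gas_rho \<gamma> c} \<times> {- B .. B}"
    have "0 < gas_rho \<gamma> q_star" using gas_rho_inverse(1)[OF g _ assms(11)] c(1) cq by simp
    moreover have "gas_rho \<gamma> c < 1" by (rule gas_rho_less_1[OF g c(1) cc])
    ultimately have "?S \<subseteq> states" by auto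
    moreover have "compact ?S" by (intro compact_Times) auto
    moreover have "(\<rho> n z, \<theta> n z) \<in> ?S" if z: "z \<in> K" for n z
    proof -
      have z\<Omega>: "z \<in> \<Omega>" using z K by blast
      note q = gas_q_props[OF g rho01[OF z\<Omega>], of n]
      have "gas_rho \<gamma> q_star \<le> \<rho> n z" using gas_rho_antimono[OF g q(1) assms(12)[OF z\<Omega>, of n] assms(11)] q(3) by simp
      moreover have "\<rho> n z \<le> gas_rho \<gamma> c" using gas_rho_antimono[OF g less_imp_le[OF c(1)] c(2)[OF z, of n] q(2)] q(3) by simp
      moreover have "\<bar>\<theta> n z\<bar> \<le> B" by (rule assms(13)[OF z\<Omega>])
      ultimately show ?thesis by (simp add: abs_le_iff)
    qed
    ultimately show ?thesis by blast
  qed (auto intro: exI[of _ "{}"])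
  define s1 where "s1 = (\<lambda>r. \<sigma>1 (gas_q \<gamma> r))"
  define s2 where "s2 = (\<lambda>r. \<sigma>2 (gas_q \<gamma> r))"
  have pos: "0 < s1 r" "0 < s2 r" if "r \<in> {0<..<1}" for r
    using assms(7) gas_q_props(1,2)[OF g, of r] that unfolding viscosity_coeffs_def s1_def s2_def by auto
  obtain a b where pair: "entropy_pair \<gamma> (\<lambda>w. entropy_Q1 \<gamma> \<mu> H (fst w) (snd w)) (\<lambda>w. entropy_Q2 \<gamma> \<mu> H (fst w) (snd w)) a b"
    by (rule entropy_generator_pair[OF g assms(17,18)])
  define q1 where "q1 = (\<lambda>w. entropy_Q1 \<gamma> \<mu> H (fst w) (snd w))"
  define q2 where "q2 = (\<lambda>w. entropy_Q2 \<gamma> \<mu> H (fst w) (snd w))"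
  note pair' = pair[folded q1_def q2_def]
  define T where "T = (\<lambda>n. distr_div \<Omega> (\<lambda>z. entropy_Q1 \<gamma> \<mu> H (\<rho> n z) (\<theta> n z)) (\<lambda>z. entropy_Q2 \<gamma> \<mu> H (\<rho> n z) (\<theta> n z)))"
  \<comment> \<open>The cutoff equals 1 on \<open>closure U\<close>, so there the localized fields
    agree with the entropy fluxes and every statement about \<open>T n\<close> on tests in
    \<open>U\<close> becomes one about a continuous function of bounded support.\<close>
  have local: "(\<forall>n. \<exists>f. continuous_on UNIV f \<and> bounded (supp f) \<and> (\<forall>\<phi>\<in>test_functions U. T n \<phi> = (LINT z|lborel. f z * \<phi> z)))
    \<and> (\<forall>\<phi>\<in>test_functions U. \<exists>N. \<forall>n. \<bar>T n \<phi>\<bar> \<le> N)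
    \<and> (\<forall>r>0. \<exists>I. finite I \<and> (\<forall>n. \<exists>m\<in>I. \<forall>\<phi>\<in>unit_tests U. \<bar>T n \<phi> - T m \<phi>\<bar> \<le> r))"
    if U: "compactly_inside U \<Omega>" for U
  proof -
    have U': "compact (closure U)" "closure U \<subseteq> \<Omega>" "U \<subseteq> \<Omega>"
      using U closure_subset[of U] unfolding compactly_inside_def by blast+
    obtain \<eta> :: "point \<Rightarrow> real" where \<eta>: "C1_on UNIV \<eta>" "bounded (supp \<eta>)" "closure (supp \<eta>) \<subseteq> \<Omega>"
      "\<And>z. z \<in> closure U \<Longrightarrow> \<eta> z = 1" "\<And>z. 0 \<le> \<eta> z" "\<And>z. \<eta> z \<le> 1"
      by (rule C1_cutoff[OF U'(1) dom(1) U'(2)]) blast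
    have cut: "cutoff \<Omega> \<eta>" by unfold_locales (use dom(1) \<eta> in auto)
    have flow: "viscous_flow \<Omega> \<eta> \<gamma> (\<epsilon> n) (\<rho> n) (\<theta> n) s1 s2" for n
      unfolding s1_def s2_def by (rule VP_solution_viscous_flow[OF g cut assms(7,8,10) range])
    have "compact (closure (supp \<eta>))" using \<eta>(2) by simp
    from states[OF this \<eta>(3)] obtain S where S: "compact S" "S \<subseteq> states"
      and S': "\<forall>n. \<forall>z\<in>closure (supp \<eta>). (\<rho> n z, \<theta> n z) \<in> S" by (elim exE conjE)
    have S3: "(\<rho> n z, \<theta> n z) \<in> S" if "\<eta> z \<noteq> 0" for n z
      using S' that closure_subset[of "supp \<eta>"] by blast
    define F1 where "F1 = (\<lambda>n. viscous_flow.QQ1 \<eta> (\<rho> n) (\<theta> n) q1)"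
    define F2 where "F2 = (\<lambda>n. viscous_flow.QQ2 \<eta> (\<rho> n) (\<theta> n) q2)"
    define P1 where "P1 = (\<lambda>n. viscous_flow.PP1 \<eta> (\<epsilon> n) (\<rho> n) (\<theta> n) s1 s2 a b)"
    define P2 where "P2 = (\<lambda>n. viscous_flow.PP2 \<eta> (\<epsilon> n) (\<rho> n) (\<theta> n) s1 s2 a b)"
    define R where "R = (\<lambda>n. viscous_flow.R \<eta> (\<epsilon> n) (\<rho> n) (\<theta> n) s1 s2 q1 q2 a b)"
    note defs = F1_def F2_def P1_def P2_def R_def
    have "\<exists>A C \<delta>. (\<forall>n z. \<bar>F1 n z\<bar> \<le> A) \<and> (\<forall>n z. \<bar>F2 n z\<bar> \<le> A) \<and> (\<forall>n. (LINT z|lborel. \<bar>R n z\<bar>) \<le> C)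
      \<and> (\<forall>n. (LINT z|lborel. (P1 n z)\<^sup>2 + (P2 n z)\<^sup>2) \<le> \<delta> n) \<and> \<delta> \<longlonglongrightarrow> 0"
      unfolding defs
      by (rule viscous_flow_decomposition[where \<rho> = \<rho> and \<theta> = \<theta> and K = S]; fact flow pos assms(9) S S3 pair')
    then obtain A C \<delta> where b0: "\<forall>n z. \<bar>F1 n z\<bar> \<le> A" "\<forall>n z. \<bar>F2 n z\<bar> \<le> A" "\<forall>n. (LINT z|lborel. \<bar>R n z\<bar>) \<le> C"
      "\<forall>n. (LINT z|lborel. (P1 n z)\<^sup>2 + (P2 n z)\<^sup>2) \<le> \<delta> n" "\<delta> \<longlonglongrightarrow> 0"
      by (elim exE conjE)
    note bounds = b0(1,2)[rule_format] b0(3,4)[rule_format] b0(5)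
    have F: "C1_on UNIV (F1 n)" "C1_on UNIV (F2 n)" "bounded (supp (F1 n))" "bounded (supp (F2 n))" for n
      unfolding defs using viscous_flow.QQ_C1[OF flow pair'] by auto
    have P: "C1_on UNIV (P1 n)" "C1_on UNIV (P2 n)" "bounded (supp (P1 n))" "bounded (supp (P2 n))" for n
      unfolding defs using viscous_flow.PP_C1[OF flow pair'] by auto
    have RR: "continuous_on UNIV (R n)" "bounded (supp (R n))" for n
      unfolding defs using viscous_flow.R_Cc[OF flow pair'] by auto
    have div: "D1 (F1 n) z + D2 (F2 n) z = D1 (P1 n) z + D2 (P2 n) z + R n z" for n z
      unfolding defs by (subst viscous_flow.R_def[OF flow pair']) simp
    have F1_eq: "F1 n z = cutoff.m \<eta> z * q1 (\<rho> n z, \<theta> n z)" and F2_eq: "F2 n z = cutoff.m \<eta> z * q2 (\<rho> n z, \<theta> n z)" for n z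
      unfolding defs by (simp_all add: viscous_flow.QQ1_def[OF flow pair'] viscous_flow.QQ2_def[OF flow pair'])
    obtain L where L: "L > 0" "\<And>z. \<eta> z \<noteq> 0 \<Longrightarrow> \<bar>fst z\<bar> \<le> L \<and> \<bar>snd z\<bar> \<le> L" by (rule bounded_suppE[OF \<eta>(2)]) blast
    have supp: "\<bar>fst z\<bar> \<le> L \<and> \<bar>snd z\<bar> \<le> L" if "F1 n z \<noteq> 0 \<or> F2 n z \<noteq> 0" for n z
      by (rule L(2)) (use that in \<open>auto simp: F1_eq F2_eq cutoff.m_def[OF cut]\<close>)
    have T_eq: "T n \<phi> = (LINT z|lborel. (D1 (F1 n) z + D2 (F2 n) z) * \<phi> z)" if \<phi>: "\<phi> \<in> test_functions U" for n \<phi>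
      unfolding T_def
    proof (rule distr_div_eq[OF U'(3) \<phi> F(1,2)])
      fix z assume "z \<in> U"
      then have "\<eta> z = 1" using \<eta>(4) closure_subset[of U] by blast
      then show "F1 n z = entropy_Q1 \<gamma> \<mu> H (\<rho> n z) (\<theta> n z) \<and> F2 n z = entropy_Q2 \<gamma> \<mu> H (\<rho> n z) (\<theta> n z)"
        by (simp add: F1_eq F2_eq cutoff.m_def[OF cut] q1_def q2_def)
    qed
    have c: "continuous_on UNIV (\<lambda>z. D1 (F1 n) z + D2 (F2 n) z)" "bounded (supp (\<lambda>z. D1 (F1 n) z + D2 (F2 n) z))" for n
      by (intro continuous_on_add C1_onD(2,3) F bounded_supp_add bounded_supp_D)+
    have tb: "\<exists>I. finite I \<and> (\<forall>n. \<exists>m\<in>I. \<forall>\<phi>\<in>unit_tests U. \<bar>T n \<phi> - T m \<phi>\<bar> \<le> r)" if r: "r > 0" for r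
    proof -
      have "\<exists>I. finite I \<and> (\<forall>n. \<exists>m\<in>I. \<forall>\<phi>\<in>unit_tests U.
        \<bar>(LINT z|lborel. (D1 (F1 n) z + D2 (F2 n) z) * \<phi> z) - (LINT z|lborel. (D1 (F1 m) z + D2 (F2 m) z) * \<phi> z)\<bar> \<le> r)"
        by (rule divergence_totally_bounded[where ?P1.0 = P1 and ?P2.0 = P2 and b = R and L = L and M = A and C = C and \<delta> = \<delta>];
          fact U'(1) F P RR supp L(1) div bounds r)
      then show ?thesis using T_eq by simp
    qed
    show ?thesis
    proof (intro conjI allI ballI impI tb)
      show "\<exists>f. continuous_on UNIV f \<and> bounded (supp f) \<and> (\<forall>\<phi>\<in>test_functions U. T n \<phi> = (LINT z|lborel. f z * \<phi> z))" for n
        using c[of n] T_eq[of _ n] by (intro exI[of _ "\<lambda>z. D1 (F1 n) z + D2 (F2 n) z"] conjI ballI)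
      show "\<exists>N. \<forall>n. \<bar>T n \<phi>\<bar> \<le> N" if \<phi>: "\<phi> \<in> test_functions U" for \<phi>
        unfolding T_eq[OF \<phi>]
        using divergence_pairing_bound[OF F bounds(1,2) test_functionsD(1,2)[OF \<phi>]] by (intro exI allI)
    qed
  qed
  \<comment> \<open>Linearity and pointwise bounds concern tests on all of \<open>\<Omega>\<close>,
    whereas \<open>T n\<close> is represented only locally. The supports of the two tests are
    therefore enclosed in one common \<open>U\<close>.\<close>
  have inside: "\<exists>U. compactly_inside U \<Omega> \<and> closure (supp \<phi>) \<subseteq> U \<and> closure (supp \<psi>) \<subseteq> U"
    if \<phi>: "\<phi> \<in> test_functions \<Omega>" and \<psi>: "\<psi> \<in> test_functions \<Omega>" for \<phi> \<psi>
  proof -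
    obtain U where U: "compactly_inside U \<Omega>" "closure (supp \<phi>) \<union> closure (supp \<psi>) \<subseteq> U"
      by (rule compactly_inside_superset[OF dom(1) compact_Un[OF test_functionsD(4)[OF \<phi>] test_functionsD(4)[OF \<psi>]]
        Un_least[OF test_functionsD(3)[OF \<phi>] test_functionsD(3)[OF \<psi>]]])
    then show ?thesis by (intro exI[of _ U]) simp
  qed
  have restrict: "\<phi> \<in> test_functions U" if "\<phi> \<in> test_functions \<Omega>" "closure (supp \<phi>) \<subseteq> U" for \<phi> U
    using that by (simp add: test_functions_def)
  have "T n \<in> Hm1_loc \<Omega>" for n
  proof -
    have "T n \<in> extensional (test_functions \<Omega>)" by (simp add: T_def distr_div_def)
    moreover have "T n (\<lambda>z. x * \<phi> z + y * \<psi> z) = x * T n \<phi> + y * T n \<psi>"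
      if \<phi>: "\<phi> \<in> test_functions \<Omega>" and \<psi>: "\<psi> \<in> test_functions \<Omega>" for \<phi> \<psi> x y
    proof -
      obtain U where U: "compactly_inside U \<Omega>" "closure (supp \<phi>) \<subseteq> U" "closure (supp \<psi>) \<subseteq> U"
        using inside[OF \<phi> \<psi>] by blast
      note t = restrict[OF \<phi> U(2)] restrict[OF \<psi> U(3)]
      obtain f where f: "continuous_on UNIV f" "bounded (supp f)" "\<forall>\<phi>\<in>test_functions U. T n \<phi> = (LINT z|lborel. f z * \<phi> z)"
        using local[OF U(1)] by blast
      have i: "integrable lborel (\<lambda>z. f z * h z)" if "h \<in> test_functions U" for h
        by (rule integrable_Cc[OF continuous_on_mult[OF f(1) C1_onD(4)[OF test_functionsD(1)[OF that]]] bounded_supp_mult(1)[OF f(2)]])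
      have "(LINT z|lborel. f z * (x * \<phi> z + y * \<psi> z)) = (LINT z|lborel. x * (f z * \<phi> z) + y * (f z * \<psi> z))"
        by (simp add: algebra_simps)
      also have "\<dots> = x * (LINT z|lborel. f z * \<phi> z) + y * (LINT z|lborel. f z * \<psi> z)"
        using i[OF t(1)] i[OF t(2)] by simp
      finally show ?thesis
        using bspec[OF f(3) t(1)] bspec[OF f(3) t(2)] bspec[OF f(3) test_functions_lincomb[OF t]] by simp
    qed
    moreover have "bdd_above (Hm1_values U (T n))" if U: "compactly_inside U \<Omega>" for U
    proof -
      obtain f where f: "continuous_on UNIV f" "bounded (supp f)" "\<forall>\<phi>\<in>test_functions U. T n \<phi> = (LINT z|lborel. f z * \<phi> z)"
        using local[OF U] by blast
      obtain M where M: "\<And>z. \<bar>f z\<bar> \<le> M" "0 \<le> M" by (rule bounded_Cc[OF f(1,2)]) blast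
      have cU: "compact (closure U)" using U unfolding compactly_inside_def by blast
      show ?thesis
      proof (rule bdd_above_Hm1_valuesI)
        fix \<phi> assume \<phi>: "\<phi> \<in> unit_tests U"
        then have "T n \<phi> = (LINT z|lborel. f z * \<phi> z)" using f(3) by simp
        then show "\<bar>T n \<phi>\<bar> \<le> M * ((measure lborel (closure U) + 1) / 2)"
          using unit_tests_pairing[OF \<phi> cU f(1) M(2) M(1)] by simp
      qed
    qed
    ultimately show ?thesis by (simp add: Hm1_loc_def)
  qed
  moreover have "\<exists>N. \<forall>n. \<bar>T n \<phi>\<bar> \<le> N" if \<phi>: "\<phi> \<in> test_functions \<Omega>" for \<phi>
  proof -
    obtain U where U: "compactly_inside U \<Omega>" "closure (supp \<phi>) \<subseteq> U" using inside[OF \<phi> \<phi>] by blast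
    show ?thesis using local[OF U(1)] restrict[OF \<phi> U(2)] by simp
  qed
  ultimately have "\<exists>K. compactin (Hm1_loc_topology \<Omega>) K \<and> (\<forall>n. T n \<in> K)"
    using local by (intro compactin_Hm1_loc_closure) simp_all
  then show ?thesis by (simp add: T_def)
qed

end
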